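(* Let $(\mathcal N,P,h)$ be a 2-dimensional almost paracomplex Riemannian manifold with associated metric $\widetilde h(x',y')=h(x',Py')$, and let $(\mathcal S(\mathcal N),\phi,\xi,\eta,g)$ be the 3-dimensional apapR manifold with $\mathcal S(\mathcal N)=\mathbb R^+\times\mathcal N$, $\phi(x',a\tfrac{d}{dt})=(Px',0)$, $\xi=\tfrac{d}{dt}$, $\eta=dt$ and $g=dt^2+\cosh 2t\,h+\sinh 2t\,\widetilde h$. Then $(\mathcal S(\mathcal N),\phi,\xi,\eta,g)$: (1) belongs to $\mathcal F_1\oplus\mathcal F_4$; (2) belongs to $\mathcal F_4$ if and only if $(\mathcal N,P,h)$ is a $\mathcal W_0$-manifold; (3) cannot belong to $\mathcal F_1$.
   Context: An almost paracomplex Riemannian manifold $(\mathcal N,P,h)$ of dimension $2n$ is a differentiable manifold with an endomorphism $P$ of $T\mathcal N$ satisfying $P^2=I$, $P\neq I$, $\operatorname{tr}P=0$ (the eigenvalues $\pm1$ have the same multiplicity $n$) and a Riemannian metric $h$ with $h(Px',Py')=h(x',y')$. Let $\nabla'$ be the Levi-Civita connection of $h$; $(\mathcal N,P,h)$ is called a $\mathcal W_0$-manifold if $\nabla'P=0$. An almost paracontact almost paracomplex Riemannian manifold (apapR manifold) $(\mathcal M,\phi,\xi,\eta,g)$ is a $(2n+1)$-dimensional differentiable manifold with an endomorphism $\phi$ of $T\mathcal M$, a vector field $\xi$, a 1-form $\eta$ and a Riemannian metric $g$ such that $\phi^2=\mathcal I-\eta\otimes\xi$, $\eta(\xi)=1$,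 $\eta\circ\phi=0$, $\phi\xi=0$, $\operatorname{tr}\phi=0$, $g(\phi x,\phi y)=g(x,y)-\eta(x)\eta(y)$. Its fundamental tensor is $F(x,y,z)=g((\nabla_x\phi)y,z)$, where $\nabla$ is the Levi-Civita connection of $g$. For $\dim\mathcal M=3$, a $\phi$-basis $\{e_0,e_1,e_2\}$ of $T_p\mathcal M$ is an orthonormal basis with $e_0=\xi$, $\phi e_0=0$, $\phi e_1=e_2$, $\phi e_2=e_1$ (so $\eta(e_0)=1$, $\eta(e_1)=\eta(e_2)=0$). Put $F_{ijk}=F(e_i,e_j,e_k)$, $\theta(z)=\sum_{i=1}^{2}F(e_i,e_i,z)$, $\theta_k=\theta(e_k)$; thus $\theta_0=F_{110}+F_{220}$, $\theta_1=F_{111}=-F_{122}$, $\theta_2=F_{222}=-F_{211}$. For $x=x^ie_i$, $y=y^ie_i$, $z=z^ie_i$ define $$F^1(x,y,z)=(x^1\theta_1-x^2\theta_2)(y^1z^1-y^2z^2),$$ $$F^4(x,y,z)=\tfrac12\theta_0\{x^1(y^0z^1+y^1z^0)+x^2(y^0z^2+y^2z^0)\}.$$ A 3-dimensional apapR manifold belongs to the class $\mathcal F_1$ (resp. $\mathcal F_4$, resp. $\mathcal F_1\oplus\mathcal F_4$) if and only if $F=F^1$ (resp. $F=F^4$, resp. $F=F^1+F^4$) at every point. $\mathbb R^+$ is the set of positive reals, $t$ is its coordinate; tangent vectors of $\mathbb R^+\times\mathcal N$ are written $(x',a\tfrac{d}{dt})$ with $x'$ tangent to $\mathcal N$; $h$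 and $\widetilde h$ are pulled back to the product. *)

theory Defs
  imports "HOL-Analysis.Analysis" "HOL-Library.Function_Algebras"
begin

text \<open>Tangent vectors are represented as real-valued operators on functions; they form a real
  vector space under the pointwise operations.\<close>

instantiation "fun" :: (type, real_vector) real_vector
begin

definition scaleR_fun :: "real \<Rightarrow> ('a \<Rightarrow> 'b) \<Rightarrow> 'a \<Rightarrow> 'b" where
  "scaleR_fun c f = (\<lambda>x. c *\<^sub>R f x)"

instance
  by standard (auto simp: scaleR_fun_def plus_fun_def fun_eq_iff algebra_simps)

end


section \<open>Smooth manifolds\<close>

text \<open>\<open>Ck_on k S f\<close> means that \<open>f\<close> is of class \<open>C\<^sup>k\<close> on \<open>S\<close>; it is meant for open \<open>S\<close>.\<close>

primrec Ck_on :: "nat \<Rightarrow> 'e set \<Rightarrow> ('e::real_normed_vector \<Rightarrow> 'f::real_normed_vector) \<Rightarrow> bool" where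
  "Ck_on 0 S f \<longleftrightarrow> continuous_on S f"
| "Ck_on (Suc k) S f \<longleftrightarrow>
     (\<forall>x\<in>S. f differentiable (at x)) \<and>
     (\<forall>v. Ck_on k S (\<lambda>x. frechet_derivative f (at x) v))"

definition smooth_on :: "'e set \<Rightarrow> ('e::real_normed_vector \<Rightarrow> 'f::real_normed_vector) \<Rightarrow> bool" where
  "smooth_on S f \<longleftrightarrow> (\<forall>k. Ck_on k S f)"

text \<open>A chart is a pair \<open>(V, c)\<close> of a coordinate domain and a coordinate map, which is only
  relevant on \<open>V\<close>. The atlas need not be maximal.\<close>

record ('a, 'e) mfd =
  mtop :: "'a topology"
  atlas :: "('a set \<times> ('a \<Rightarrow> 'e)) set"

abbreviation pts :: "('a, 'e) mfd \<Rightarrow> 'a set" where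
  "pts M \<equiv> topspace (mtop M)"

definition smooth_manifold :: "('a, 'e::euclidean_space) mfd \<Rightarrow> bool" where
  "smooth_manifold M \<longleftrightarrow>
     Hausdorff_space (mtop M) \<and> second_countable (mtop M) \<and>
     (\<Union>(V, c)\<in>atlas M. V) = pts M \<and>
     (\<forall>(V, c)\<in>atlas M. openin (mtop M) V \<and> open (c ` V) \<and>
        homeomorphic_map (subtopology (mtop M) V) (top_of_set (c ` V)) c) \<and>
     (\<forall>(V, c)\<in>atlas M. \<forall>(V', c')\<in>atlas M. smooth_on (c ` (V \<inter> V')) (c' \<circ> inv_into V c))"

definition smooth_fun_on :: "('a, 'e::euclidean_space) mfd \<Rightarrow> 'a set \<Rightarrow> ('a \<Rightarrow> real) \<Rightarrow> bool" where
  "smooth_fun_on M U f \<longleftrightarrow> openin (mtop M) U \<and>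
     (\<forall>(V, c)\<in>atlas M. smooth_on (c ` (U \<inter> V)) (f \<circ> inv_into V c))"

definition smooth_near :: "('a, 'e::euclidean_space) mfd \<Rightarrow> 'a \<Rightarrow> ('a \<Rightarrow> real) \<Rightarrow> bool" where
  "smooth_near M p f \<longleftrightarrow> (\<exists>U. p \<in> U \<and> smooth_fun_on M U f)"


section \<open>Tangent vectors and tensor fields\<close>

text \<open>The tangent vectors at \<open>p\<close> are the operators \<open>f \<mapsto> (f \<circ> \<gamma>)'(0)\<close> on functions smooth near \<open>p\<close>,
  for smooth curves \<open>\<gamma>\<close> with \<open>\<gamma>(0) = p\<close>. As functions here are total, an operator is set to \<open>0\<close>
  on the functions that are not smooth near \<open>p\<close>, which makes equality of tangent vectors plain
  equality.\<close>

type_synonym 'a tvec = "('a \<Rightarrow> real) \<Rightarrow> real"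

definition smooth_curve_through :: "('a, 'e::euclidean_space) mfd \<Rightarrow> 'a \<Rightarrow> (real \<Rightarrow> 'a) \<Rightarrow> bool" where
  "smooth_curve_through M p \<gamma> \<longleftrightarrow> \<gamma> 0 = p \<and>
     (\<exists>\<epsilon>>0. continuous_map (top_of_set {-\<epsilon><..<\<epsilon>}) (mtop M) \<gamma> \<and>
        (\<forall>(V, c)\<in>atlas M. smooth_on {s \<in> {-\<epsilon><..<\<epsilon>}. \<gamma> s \<in> V} (c \<circ> \<gamma>)))"

definition velocity :: "('a, 'e::euclidean_space) mfd \<Rightarrow> (real \<Rightarrow> 'a) \<Rightarrow> 'a tvec" where
  "velocity M \<gamma> = (\<lambda>f. if smooth_near M (\<gamma> 0) f then deriv (\<lambda>s. f (\<gamma> s)) 0 else 0)"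

definition tangent_space :: "('a, 'e::euclidean_space) mfd \<Rightarrow> 'a \<Rightarrow> 'a tvec set" where
  "tangent_space M p = {velocity M \<gamma> |\<gamma>. smooth_curve_through M p \<gamma>}"

definition vector_field_on :: "('a, 'e::euclidean_space) mfd \<Rightarrow> 'a set \<Rightarrow> ('a \<Rightarrow> 'a tvec) \<Rightarrow> bool" where
  "vector_field_on M U X \<longleftrightarrow> openin (mtop M) U \<and>
     (\<forall>p\<in>U. X p \<in> tangent_space M p) \<and>
     (\<forall>V f. V \<subseteq> U \<longrightarrow> smooth_fun_on M V f \<longrightarrow> smooth_fun_on M V (\<lambda>p. X p f))"

definition linear_on_space :: "'v::real_vector set \<Rightarrow> ('v \<Rightarrow> 'w::real_vector) \<Rightarrow> bool" where
  "linear_on_space T A \<longleftrightarrow>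
     (\<forall>u\<in>T. \<forall>v\<in>T. A (u + v) = A u + A v) \<and> (\<forall>c. \<forall>u\<in>T. A (c *\<^sub>R u) = c *\<^sub>R A u)"

definition endomorphism_field :: "('a, 'e::euclidean_space) mfd \<Rightarrow> ('a \<Rightarrow> 'a tvec \<Rightarrow> 'a tvec) \<Rightarrow> bool" where
  "endomorphism_field M A \<longleftrightarrow>
     (\<forall>p\<in>pts M. A p ` tangent_space M p \<subseteq> tangent_space M p \<and>
                linear_on_space (tangent_space M p) (A p)) \<and>
     (\<forall>U X. vector_field_on M U X \<longrightarrow> vector_field_on M U (\<lambda>p. A p (X p)))"

definition one_form :: "('a, 'e::euclidean_space) mfd \<Rightarrow> ('a \<Rightarrow> 'a tvec \<Rightarrow> real) \<Rightarrow> bool" where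
  "one_form M \<eta> \<longleftrightarrow>
     (\<forall>p\<in>pts M. linear_on_space (tangent_space M p) (\<eta> p)) \<and>
     (\<forall>U X. vector_field_on M U X \<longrightarrow> smooth_fun_on M U (\<lambda>p. \<eta> p (X p)))"

definition riemannian_metric ::
  "('a, 'e::euclidean_space) mfd \<Rightarrow> ('a \<Rightarrow> 'a tvec \<Rightarrow> 'a tvec \<Rightarrow> real) \<Rightarrow> bool" where
  "riemannian_metric M g \<longleftrightarrow>
     (\<forall>p\<in>pts M. \<forall>u\<in>tangent_space M p.
        linear_on_space (tangent_space M p) (g p u) \<and>
        (\<forall>v\<in>tangent_space M p. g p u v = g p v u) \<and>
        (u \<noteq> 0 \<longrightarrow> g p u u > 0)) \<and>
     (\<forall>U X Y. vector_field_on M U X \<longrightarrow> vector_field_on M U Y \<longrightarrow>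
        smooth_fun_on M U (\<lambda>p. g p (X p) (Y p)))"

text \<open>The trace of an endomorphism of a finite-dimensional subspace; it does not depend on the
  chosen basis.\<close>

definition trace_on :: "'v::real_vector set \<Rightarrow> ('v \<Rightarrow> 'v) \<Rightarrow> real" where
  "trace_on T A = (let B = (SOME B. independent B \<and> span B = T)
                   in \<Sum>b\<in>B. representation B (A b) b)"


section \<open>The Levi-Civita connection\<close>

text \<open>\<open>D p v Y\<close> is the covariant derivative at \<open>p\<close> of the vector field \<open>Y\<close> in direction \<open>v\<close>.
  Connections act on vector fields defined on arbitrary open sets.\<close>

type_synonym 'a connection = "'a \<Rightarrow> 'a tvec \<Rightarrow> ('a \<Rightarrow> 'a tvec) \<Rightarrow> 'a tvec"

definition affine_connection :: "('a, 'e::euclidean_space) mfd \<Rightarrow> 'a connection \<Rightarrow> bool" where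
  "affine_connection M D \<longleftrightarrow>
     (\<forall>U Y. vector_field_on M U Y \<longrightarrow>
        (\<forall>p\<in>U. linear_on_space (tangent_space M p) (\<lambda>v. D p v Y)) \<and>
        (\<forall>X. vector_field_on M U X \<longrightarrow> vector_field_on M U (\<lambda>p. D p (X p) Y)) \<and>
        (\<forall>p\<in>U. \<forall>v\<in>tangent_space M p.
           D p v Y \<in> tangent_space M p \<and>
           (\<forall>Z. vector_field_on M U Z \<longrightarrow> D p v (\<lambda>q. Y q + Z q) = D p v Y + D p v Z) \<and>
           (\<forall>f. smooth_fun_on M U f \<longrightarrow>
              D p v (\<lambda>q. f q *\<^sub>R Y q) = v f *\<^sub>R Y p + f p *\<^sub>R D p v Y)))"

definition lie_bracket ::
  "('a, 'e::euclidean_space) mfd \<Rightarrow> ('a \<Rightarrow> 'a tvec) \<Rightarrow> ('a \<Rightarrow> 'a tvec) \<Rightarrow> 'a \<Rightarrow> 'a tvec" where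
  "lie_bracket M X Y p =
     (\<lambda>f. if smooth_near M p f then X p (\<lambda>q. Y q f) - Y p (\<lambda>q. X q f) else 0)"

definition levi_civita ::
  "('a, 'e::euclidean_space) mfd \<Rightarrow> ('a \<Rightarrow> 'a tvec \<Rightarrow> 'a tvec \<Rightarrow> real) \<Rightarrow> 'a connection \<Rightarrow> bool" where
  "levi_civita M g D \<longleftrightarrow> affine_connection M D \<and>
     (\<forall>U X Y. vector_field_on M U X \<longrightarrow> vector_field_on M U Y \<longrightarrow>
        (\<forall>p\<in>U. D p (X p) Y - D p (Y p) X = lie_bracket M X Y p)) \<and>
     (\<forall>U Y Z. vector_field_on M U Y \<longrightarrow> vector_field_on M U Z \<longrightarrow>
        (\<forall>p\<in>U. \<forall>v\<in>tangent_space M p.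
           v (\<lambda>q. g q (Y q) (Z q)) = g p (D p v Y) (Z p) + g p (Y p) (D p v Z)))"

text \<open>\<open>(\<nabla>\<^sub>x A) y = \<nabla>\<^sub>x (A Y) - A (\<nabla>\<^sub>x Y)\<close> for any local vector field \<open>Y\<close> extending \<open>y\<close>; the value
  does not depend on the extension.\<close>

definition cov_deriv_endo ::
  "('a, 'e::euclidean_space) mfd \<Rightarrow> 'a connection \<Rightarrow> ('a \<Rightarrow> 'a tvec \<Rightarrow> 'a tvec) \<Rightarrow>
   'a \<Rightarrow> 'a tvec \<Rightarrow> 'a tvec \<Rightarrow> 'a tvec" where
  "cov_deriv_endo M D A p x y =
     (let Y = (SOME Y. Y p = y \<and> (\<exists>U. p \<in> U \<and> vector_field_on M U Y))
      in D p x (\<lambda>q. A q (Y q)) - A p (D p x Y))"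


section \<open>Almost paracomplex Riemannian manifolds\<close>

definition almost_paracomplex_riemannian ::
  "('a, 'e::euclidean_space) mfd \<Rightarrow> ('a \<Rightarrow> 'a tvec \<Rightarrow> 'a tvec) \<Rightarrow>
   ('a \<Rightarrow> 'a tvec \<Rightarrow> 'a tvec \<Rightarrow> real) \<Rightarrow> bool" where
  "almost_paracomplex_riemannian N P h \<longleftrightarrow>
     smooth_manifold N \<and> even DIM('e) \<and> endomorphism_field N P \<and> riemannian_metric N h \<and>
     (\<forall>p\<in>pts N. \<forall>x\<in>tangent_space N p. P p (P p x) = x) \<and>
     (\<exists>p\<in>pts N. \<exists>x\<in>tangent_space N p. P p x \<noteq> x) \<and>
     (\<forall>p\<in>pts N. trace_on (tangent_space N p) (P p) = 0) \<and>
     (\<forall>p\<in>pts N. \<forall>x\<in>tangent_space N p. \<forall>y\<in>tangent_space N p. h p (P p x) (P p y) = h p x y)"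

definition associated_metric ::
  "('a \<Rightarrow> 'a tvec \<Rightarrow> 'a tvec) \<Rightarrow> ('a \<Rightarrow> 'a tvec \<Rightarrow> 'a tvec \<Rightarrow> real) \<Rightarrow>
   'a \<Rightarrow> 'a tvec \<Rightarrow> 'a tvec \<Rightarrow> real" where
  "associated_metric P h p x y = h p x (P p y)"

text \<open>In the classes below, the argument \<open>D\<close> is to be the Levi-Civita connection of the metric.\<close>

definition W0_manifold ::
  "('a, 'e::euclidean_space) mfd \<Rightarrow> ('a \<Rightarrow> 'a tvec \<Rightarrow> 'a tvec) \<Rightarrow>
   ('a \<Rightarrow> 'a tvec \<Rightarrow> 'a tvec \<Rightarrow> real) \<Rightarrow> 'a connection \<Rightarrow> bool" where
  "W0_manifold N P h D \<longleftrightarrow> almost_paracomplex_riemannian N P h \<and>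
     (\<forall>p\<in>pts N. \<forall>x\<in>tangent_space N p. \<forall>y\<in>tangent_space N p. cov_deriv_endo N D P p x y = 0)"


section \<open>Almost paracontact almost paracomplex Riemannian manifolds\<close>

definition apapR_manifold ::
  "('a, 'e::euclidean_space) mfd \<Rightarrow> ('a \<Rightarrow> 'a tvec \<Rightarrow> 'a tvec) \<Rightarrow> ('a \<Rightarrow> 'a tvec) \<Rightarrow>
   ('a \<Rightarrow> 'a tvec \<Rightarrow> real) \<Rightarrow> ('a \<Rightarrow> 'a tvec \<Rightarrow> 'a tvec \<Rightarrow> real) \<Rightarrow> bool" where
  "apapR_manifold M \<phi> \<xi> \<eta> g \<longleftrightarrow>
     smooth_manifold M \<and> odd DIM('e) \<and> endomorphism_field M \<phi> \<and>
     vector_field_on M (pts M) \<xi> \<and> one_form M \<eta> \<and> riemannian_metric M g \<and>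
     (\<forall>p\<in>pts M.
        \<eta> p (\<xi> p) = 1 \<and> \<phi> p (\<xi> p) = 0 \<and> trace_on (tangent_space M p) (\<phi> p) = 0 \<and>
        (\<forall>x\<in>tangent_space M p. \<phi> p (\<phi> p x) = x - \<eta> p x *\<^sub>R \<xi> p \<and> \<eta> p (\<phi> p x) = 0 \<and>
           (\<forall>y\<in>tangent_space M p. g p (\<phi> p x) (\<phi> p y) = g p x y - \<eta> p x * \<eta> p y)))"

definition fundamental_tensor ::
  "('a, 'e::euclidean_space) mfd \<Rightarrow> ('a \<Rightarrow> 'a tvec \<Rightarrow> 'a tvec) \<Rightarrow>
   ('a \<Rightarrow> 'a tvec \<Rightarrow> 'a tvec \<Rightarrow> real) \<Rightarrow> 'a connection \<Rightarrow>
   'a \<Rightarrow> 'a tvec \<Rightarrow> 'a tvec \<Rightarrow> 'a tvec \<Rightarrow> real" where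
  "fundamental_tensor M \<phi> g D p x y z = g p (cov_deriv_endo M D \<phi> p x y) z"

text \<open>A \<open>\<phi>\<close>-basis is given by its vectors \<open>e 0\<close>, \<open>e 1\<close>, \<open>e 2\<close>; only these values of \<open>e\<close> matter.\<close>

definition phi_basis ::
  "('a, 'e::euclidean_space) mfd \<Rightarrow> ('a \<Rightarrow> 'a tvec \<Rightarrow> 'a tvec) \<Rightarrow> ('a \<Rightarrow> 'a tvec) \<Rightarrow>
   ('a \<Rightarrow> 'a tvec \<Rightarrow> 'a tvec \<Rightarrow> real) \<Rightarrow> 'a \<Rightarrow> (nat \<Rightarrow> 'a tvec) \<Rightarrow> bool" where
  "phi_basis M \<phi> \<xi> g p e \<longleftrightarrow>
     (\<forall>i\<le>2. e i \<in> tangent_space M p) \<and> span (e ` {..2}) = tangent_space M p \<and>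
     (\<forall>i\<le>2. \<forall>j\<le>2. g p (e i) (e j) = (if i = j then 1 else 0)) \<and>
     e 0 = \<xi> p \<and> \<phi> p (e 0) = 0 \<and> \<phi> p (e 1) = e 2 \<and> \<phi> p (e 2) = e 1"

text \<open>For a trilinear form \<open>F\<close> on a tangent space and a basis \<open>e\<close>, \<open>lee_form F e k\<close> is the
  component \<open>\<theta>\<^sub>k\<close>. The arguments \<open>x\<close>, \<open>y\<close>, \<open>z\<close> of \<open>F1_part\<close> and \<open>F4_part\<close> are the coordinates
  with respect to \<open>e\<close>.\<close>

definition lee_form :: "('v \<Rightarrow> 'v \<Rightarrow> 'v \<Rightarrow> real) \<Rightarrow> (nat \<Rightarrow> 'v) \<Rightarrow> nat \<Rightarrow> real" where
  "lee_form F e k = (\<Sum>i=1..2. F (e i) (e i) (e k))"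

definition F1_part ::
  "('v \<Rightarrow> 'v \<Rightarrow> 'v \<Rightarrow> real) \<Rightarrow> (nat \<Rightarrow> 'v) \<Rightarrow> (nat \<Rightarrow> real) \<Rightarrow> (nat \<Rightarrow> real) \<Rightarrow> (nat \<Rightarrow> real) \<Rightarrow> real" where
  "F1_part F e x y z =
     (x 1 * lee_form F e 1 - x 2 * lee_form F e 2) * (y 1 * z 1 - y 2 * z 2)"

definition F4_part ::
  "('v \<Rightarrow> 'v \<Rightarrow> 'v \<Rightarrow> real) \<Rightarrow> (nat \<Rightarrow> 'v) \<Rightarrow> (nat \<Rightarrow> real) \<Rightarrow> (nat \<Rightarrow> real) \<Rightarrow> (nat \<Rightarrow> real) \<Rightarrow> real" where
  "F4_part F e x y z =
     1/2 * lee_form F e 0 *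
       (x 1 * (y 0 * z 1 + y 1 * z 0) + x 2 * (y 0 * z 2 + y 2 * z 0))"

definition vec_of_coords :: "(nat \<Rightarrow> 'v::real_vector) \<Rightarrow> (nat \<Rightarrow> real) \<Rightarrow> 'v" where
  "vec_of_coords e x = (\<Sum>i\<le>2. x i *\<^sub>R e i)"

text \<open>The parts \<open>F1_part\<close> and \<open>F4_part\<close> of \<open>F\<close> do not depend on the \<open>\<phi>\<close>-basis, so that requiring
  the equation for all \<open>\<phi>\<close>-bases at a point is the same as requiring it for one.\<close>

definition class_of_part ::
  "(('a tvec \<Rightarrow> 'a tvec \<Rightarrow> 'a tvec \<Rightarrow> real) \<Rightarrow> (nat \<Rightarrow> 'a tvec) \<Rightarrow>
     (nat \<Rightarrow> real) \<Rightarrow> (nat \<Rightarrow> real) \<Rightarrow> (nat \<Rightarrow> real) \<Rightarrow> real) \<Rightarrow>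
   ('a, 'e::euclidean_space) mfd \<Rightarrow> ('a \<Rightarrow> 'a tvec \<Rightarrow> 'a tvec) \<Rightarrow> ('a \<Rightarrow> 'a tvec) \<Rightarrow>
   ('a \<Rightarrow> 'a tvec \<Rightarrow> real) \<Rightarrow> ('a \<Rightarrow> 'a tvec \<Rightarrow> 'a tvec \<Rightarrow> real) \<Rightarrow> 'a connection \<Rightarrow> bool" where
  "class_of_part Q M \<phi> \<xi> \<eta> g D \<longleftrightarrow>
     apapR_manifold M \<phi> \<xi> \<eta> g \<and> DIM('e) = 3 \<and>
     (\<forall>p\<in>pts M. \<forall>e. phi_basis M \<phi> \<xi> g p e \<longrightarrow>
        (\<forall>x y z. fundamental_tensor M \<phi> g D p
                   (vec_of_coords e x) (vec_of_coords e y) (vec_of_coords e z)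
               = Q (fundamental_tensor M \<phi> g D p) e x y z))"

definition "class_F1 = class_of_part F1_part"
definition "class_F4 = class_of_part F4_part"
definition "class_F1_F4 = class_of_part (\<lambda>F e x y z. F1_part F e x y z + F4_part F e x y z)"


section \<open>The manifold \<open>S(N) = \<real>\<^sup>+ \<times> N\<close>\<close>

definition S_mfd :: "('a, 'e) mfd \<Rightarrow> (real \<times> 'a, real \<times> 'e) mfd" where
  "S_mfd N =
     \<lparr> mtop = prod_topology (top_of_set {0<..}) (mtop N),
       atlas = {({0<..} \<times> V, \<lambda>(t, q). (t, c q)) |V c. (V, c) \<in> atlas N} \<rparr>"

text \<open>\<open>S_tangent N (t, q) x' a\<close> is the tangent vector \<open>(x', a d/dt)\<close> of \<open>S(N)\<close> at \<open>(t, q)\<close>. Its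
  first component is recovered by \<open>N_part\<close>, the differential of the projection onto \<open>N\<close>, and its
  second one by \<open>S_eta\<close>, since \<open>dt(v) = v(t)\<close>.\<close>

definition S_tangent ::
  "('a, 'e::euclidean_space) mfd \<Rightarrow> real \<times> 'a \<Rightarrow> 'a tvec \<Rightarrow> real \<Rightarrow> (real \<times> 'a) tvec" where
  "S_tangent N p x' a =
     (\<lambda>f. if smooth_near (S_mfd N) p f
          then x' (\<lambda>q. f (fst p, q)) + a * deriv (\<lambda>t. f (t, snd p)) (fst p) else 0)"

definition N_part ::
  "('a, 'e::euclidean_space) mfd \<Rightarrow> real \<times> 'a \<Rightarrow> (real \<times> 'a) tvec \<Rightarrow> 'a tvec" where
  "N_part N p v = (\<lambda>f. if smooth_near N (snd p) f then v (f \<circ> snd) else 0)"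

definition S_eta :: "real \<times> 'a \<Rightarrow> (real \<times> 'a) tvec \<Rightarrow> real" where
  "S_eta p v = v fst"

definition S_xi :: "('a, 'e::euclidean_space) mfd \<Rightarrow> real \<times> 'a \<Rightarrow> (real \<times> 'a) tvec" where
  "S_xi N p = S_tangent N p 0 1"

definition S_phi ::
  "('a, 'e::euclidean_space) mfd \<Rightarrow> ('a \<Rightarrow> 'a tvec \<Rightarrow> 'a tvec) \<Rightarrow>
   real \<times> 'a \<Rightarrow> (real \<times> 'a) tvec \<Rightarrow> (real \<times> 'a) tvec" where
  "S_phi N P p v = S_tangent N p (P (snd p) (N_part N p v)) 0"

definition S_metric ::
  "('a, 'e::euclidean_space) mfd \<Rightarrow> ('a \<Rightarrow> 'a tvec \<Rightarrow> 'a tvec) \<Rightarrow>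
   ('a \<Rightarrow> 'a tvec \<Rightarrow> 'a tvec \<Rightarrow> real) \<Rightarrow>
   real \<times> 'a \<Rightarrow> (real \<times> 'a) tvec \<Rightarrow> (real \<times> 'a) tvec \<Rightarrow> real" where
  "S_metric N P h p u v =
     S_eta p u * S_eta p v
     + cosh (2 * fst p) * h (snd p) (N_part N p u) (N_part N p v)
     + sinh (2 * fst p) * associated_metric P h (snd p) (N_part N p u) (N_part N p v)"

end

theory Submission
  imports Defs
begin

text \<open>Write \<open>h\<close> and \<open>P\<close> for the metric and the product structure of \<open>N\<close>. The slice of \<open>S(N)\<close> at
  height \<open>t\<close> carries the metric \<open>g\<^sub>t(x, y) = h(exp(2tP) x, y)\<close>, which is \<open>e\<^bsup>2t\<^esup> h\<close> on the
  \<open>+1\<close>-eigenline of \<open>P\<close> and \<open>e\<^bsup>-2t\<^esup> h\<close> on the \<open>-1\<close>-eigenline. Everything rests on three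
  computations of the fundamental tensor \<open>F(x, y, z) = g((\<nabla>\<^sub>x \<phi>) y, z)\<close>, which is trilinear and
  symmetric in \<open>y\<close>, \<open>z\<close>.

  First, \<open>\<partial>\<^sub>t g\<^sub>t = 2 g\<^sub>t(\<phi> _, _)\<close>, and the bracket of \<open>\<xi>\<close> with a lifted field vanishes; hence
  \<open>\<nabla>\<^sub>x \<xi> = \<phi> x\<close> (\<open>D_xi\<close>) and \<open>F(x, y, \<xi>) = - g(\<phi> x, \<phi> y)\<close> (\<open>cone_F_xi\<close>). So \<open>\<theta>\<^sub>0 = -2\<close> at
  every point, which gives the \<open>F\<^sup>4\<close>-part and excludes the class \<open>F\<^sub>1\<close>.

  Second, \<open>F(x, y, y) = 0\<close> for every eigenvector \<open>y\<close> of \<open>\<phi>\<close> with eigenvalue \<open>\<plusminus>1\<close>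
  (\<open>F_eigenvector_diag\<close>), and \<open>F(\<xi>, y, z) = 0\<close> for eigenvectors with opposite eigenvalues
  (\<open>cone_F_xi_eigenvectors\<close>). In a \<open>\<phi>\<close>-basis, \<open>e\<^sub>1 + e\<^sub>2\<close> and \<open>e\<^sub>1 - e\<^sub>2\<close> are such eigenvectors, so the
  only components left free are \<open>F\<^sub>1\<^sub>1\<^sub>1 = - F\<^sub>1\<^sub>2\<^sub>2\<close> and \<open>F\<^sub>2\<^sub>1\<^sub>1 = - F\<^sub>2\<^sub>2\<^sub>2\<close>; these are exactly the
  components of \<open>F\<^sup>1\<close> (\<open>F_expand\<close>).

  Third, for local fields \<open>Y\<close>, \<open>Z\<close> of eigenvectors of \<open>P\<close> for the eigenvalues \<open>\<epsilon>\<close>, \<open>-\<epsilon>\<close>, the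
  Koszul formula reads \<open>F(Y, Y, Z) = - \<epsilon> (2 g(Y, [Y, Z]) + Z (g(Y, Y)))\<close>. The right side only sees
  the metric on the \<open>\<epsilon>\<close>-eigenline, so for the lifts to \<open>S(N)\<close> it is \<open>e\<^bsup>2\<epsilon>t\<^esup>\<close> times its value on
  \<open>N\<close> (\<open>cone_F_eigenvectors\<close>). As \<open>N\<close> is a surface, its tensor \<open>(\<nabla>' P)\<close> is determined by these
  values for \<open>\<epsilon> = 1\<close> and \<open>\<epsilon> = -1\<close>. Hence the \<open>F\<^sup>1\<close>-part vanishes if and only if \<open>\<nabla>' P = 0\<close>.

  The value of \<open>(\<nabla>\<^sub>x A) y\<close> is independent of the extension of \<open>y\<close> to a local field because \<open>A\<close>
  is self-adjoint (\<open>cov_deriv_endo_eq_nab\<close>). Lie brackets are tangent vectors, being differences of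
  covariant derivatives, and are identified by their values on coordinate functions.\<close>

section \<open>Calculus of \<open>C\<^sup>k\<close> maps\<close>

lemma Ck_on_cong:
  assumes "open S" "\<And>x. x \<in> S \<Longrightarrow> f x = g x" "Ck_on k S f"
  shows "Ck_on k S g"
  using assms(2,3)
proof (induction k arbitrary: f g)
  case 0
  then show ?case by (auto cong: continuous_on_cong)
next
  case (Suc k)
  have d: "g differentiable (at x)" "frechet_derivative g (at x) = frechet_derivative f (at x)"
    if "x \<in> S" for x
  proof -
    have fx: "f differentiable (at x)" using Suc.prems(2) that by simp
    have eq: "\<And>y. y \<in> S \<Longrightarrow> f y = g y" using Suc.prems(1) by simp
    show "g differentiable (at x)"
      using fx has_derivative_transform_within_open[of f _ x UNIV S g] assms(1) that eq
      unfolding differentiable_def by blast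
    show "frechet_derivative g (at x) = frechet_derivative f (at x)"
      using frechet_derivative_transform_within_open[OF fx assms(1) that eq] by simp
  qed
  have "Ck_on k S (\<lambda>x. frechet_derivative g (at x) v)" for v
    by (rule Suc.IH[of "\<lambda>x. frechet_derivative f (at x) v"]) (use Suc.prems d in auto)
  then show ?case using d by simp
qed

lemma Ck_on_lower: "Ck_on (Suc k) S f \<Longrightarrow> Ck_on k S f"
proof (induction k arbitrary: f)
  case 0
  then show ?case
    by (auto intro!: differentiable_imp_continuous_on simp: differentiable_on_def
        differentiable_at_withinI)
next
  case (Suc k)
  then show ?case by simp
qed

lemma Ck_on_subset: "Ck_on k S f \<Longrightarrow> T \<subseteq> S \<Longrightarrow> Ck_on k T f"
  by (induction k arbitrary: f) (auto intro: continuous_on_subset)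

lemma Ck_on_Union:
  assumes "\<And>T. T \<in> \<T> \<Longrightarrow> open T" "\<And>T. T \<in> \<T> \<Longrightarrow> Ck_on k T f"
  shows "Ck_on k (\<Union>\<T>) f"
  using assms(2)
proof (induction k arbitrary: f)
  case 0
  then show ?case using continuous_on_open_Union[of \<T> f] assms(1) by auto
qed auto

lemma Ck_on_const: "Ck_on k S (\<lambda>x. c)"
  by (induction k arbitrary: c) auto

lemma Ck_on_bounded_linear: "bounded_linear f \<Longrightarrow> Ck_on k S f"
proof (cases k)
  case (Suc n)
  assume f: "bounded_linear f"
  then have "frechet_derivative f (at x) = f" for x
    using bounded_linear_imp_has_derivative frechet_derivative_at by metis
  then show ?thesis using Suc f by (simp add: Ck_on_const bounded_linear_imp_differentiable)
qed (simp add: linear_continuous_on)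

lemma Ck_on_add:
  assumes "open S" "Ck_on k S f" "Ck_on k S g"
  shows "Ck_on k S (\<lambda>x. f x + g x)"
  using assms(2,3)
proof (induction k arbitrary: f g)
  case (Suc k)
  have "Ck_on k S (\<lambda>x. frechet_derivative (\<lambda>x. f x + g x) (at x) v)" for v
  proof (rule Ck_on_cong[OF assms(1)])
    show "Ck_on k S (\<lambda>x. frechet_derivative f (at x) v + frechet_derivative g (at x) v)"
      using Suc by simp
    show "frechet_derivative f (at x) v + frechet_derivative g (at x) v
        = frechet_derivative (\<lambda>x. f x + g x) (at x) v" if "x \<in> S" for x
    proof -
      have "((\<lambda>x. f x + g x) has_derivative
          (\<lambda>v. frechet_derivative f (at x) v + frechet_derivative g (at x) v)) (at x)"
        using Suc.prems that by (intro has_derivative_add) (auto simp flip: frechet_derivative_works)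
      from frechet_derivative_at[OF this] show ?thesis by metis
    qed
  qed
  then show ?case using Suc.prems by (auto intro: differentiable_add)
qed (auto intro: continuous_on_add)

lemma Ck_on_sum:
  assumes "open S" "\<And>i. i \<in> I \<Longrightarrow> Ck_on k S (f i)"
  shows "Ck_on k S (\<lambda>x. \<Sum>i\<in>I. f i x)"
  using assms(2)
  by (induction I rule: infinite_finite_induct) (auto intro: Ck_on_const Ck_on_add[OF assms(1)])

lemma Ck_on_bilinear:
  assumes "bounded_bilinear prd" "open S" "Ck_on k S f" "Ck_on k S g"
  shows "Ck_on k S (\<lambda>x. prd (f x) (g x))"
  using assms(3,4)
proof (induction k arbitrary: f g)
  case 0
  then show ?case using bounded_bilinear.continuous_on[OF assms(1)] by auto
next
  case (Suc k)
  have D: "((\<lambda>x. prd (f x) (g x)) has_derivative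
      (\<lambda>v. prd (f x) (frechet_derivative g (at x) v) + prd (frechet_derivative f (at x) v) (g x))) (at x)"
    if "x \<in> S" for x
    using Suc.prems that
    by (intro bounded_bilinear.FDERIV[OF assms(1)])
      (simp_all add: frechet_derivative_works[symmetric])
  have "Ck_on k S (\<lambda>x. frechet_derivative (\<lambda>x. prd (f x) (g x)) (at x) v)" for v
  proof (rule Ck_on_cong[OF assms(2)])
    show "Ck_on k S (\<lambda>x. prd (f x) (frechet_derivative g (at x) v)
                      + prd (frechet_derivative f (at x) v) (g x))"
      using Suc.prems Ck_on_lower[OF Suc.prems(1)] Ck_on_lower[OF Suc.prems(2)]
      by (intro Ck_on_add[OF assms(2)] Suc.IH) auto
    show "prd (f x) (frechet_derivative g (at x) v) + prd (frechet_derivative f (at x) v) (g x)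
        = frechet_derivative (\<lambda>x. prd (f x) (g x)) (at x) v" if "x \<in> S" for x
      using frechet_derivative_at[OF D[OF that]] by metis
  qed
  moreover have "\<forall>x\<in>S. (\<lambda>x. prd (f x) (g x)) differentiable (at x)"
    using D unfolding differentiable_def by blast
  ultimately show ?case unfolding Ck_on.simps by (intro conjI allI)
qed

lemma Ck_on_linear_compose:
  assumes "bounded_linear L" "open S" "Ck_on k S f"
  shows "Ck_on k S (\<lambda>x. L (f x))"
  using assms(3)
proof (induction k arbitrary: f)
  case 0
  then show ?case using bounded_linear.continuous_on[OF assms(1)] by auto
next
  case (Suc k)
  have D: "((\<lambda>x. L (f x)) has_derivative (\<lambda>v. L (frechet_derivative f (at x) v))) (at x)"
    if "x \<in> S" for x
    using Suc.prems that
    by (intro bounded_linear.has_derivative[OF assms(1)])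
      (simp add: frechet_derivative_works[symmetric])
  have "Ck_on k S (\<lambda>x. frechet_derivative (\<lambda>x. L (f x)) (at x) v)" for v
  proof (rule Ck_on_cong[OF assms(2)])
    show "Ck_on k S (\<lambda>x. L (frechet_derivative f (at x) v))"
      using Suc by auto
    show "L (frechet_derivative f (at x) v)
        = frechet_derivative (\<lambda>x. L (f x)) (at x) v" if "x \<in> S" for x
      using frechet_derivative_at[OF D[OF that]] by metis
  qed
  moreover have "\<forall>x\<in>S. (\<lambda>x. L (f x)) differentiable (at x)"
    using D unfolding differentiable_def by blast
  ultimately show ?case unfolding Ck_on.simps by (intro conjI allI)
qed

text \<open>Expanding \<open>(Dg)(x) v\<close> in a basis of the middle space writes the derivative of the composition as
  a finite sum of products of scalar functions and of compositions of lower order.\<close>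

lemma Ck_on_compose:
  fixes g :: "'a::real_normed_vector \<Rightarrow> 'b::euclidean_space" and f :: "'b \<Rightarrow> 'c::real_normed_vector"
  assumes "open S" "g ` S \<subseteq> T" "Ck_on k T f" "Ck_on k S g"
  shows "Ck_on k S (\<lambda>x. f (g x))"
  using assms(3,4)
proof (induction k arbitrary: f)
  case 0
  then show ?case using assms(2) continuous_on_compose2[of T f S g] by simp
next
  case (Suc k)
  have D: "((\<lambda>x. f (g x)) has_derivative
      (\<lambda>v. frechet_derivative f (at (g x)) (frechet_derivative g (at x) v))) (at x)"
    if "x \<in> S" for x
  proof -
    have "g differentiable (at x)" "f differentiable (at (g x))"
      using Suc.prems that assms(2) by (simp_all add: image_subset_iff)
    then show ?thesis
      unfolding frechet_derivative_works by (rule has_derivative_compose)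
  qed
  have "Ck_on k S (\<lambda>x. frechet_derivative (\<lambda>x. f (g x)) (at x) v)" for v
  proof (rule Ck_on_cong[OF assms(1)])
    show "Ck_on k S (\<lambda>x. \<Sum>b\<in>Basis. (frechet_derivative g (at x) v \<bullet> b)
                         *\<^sub>R frechet_derivative f (at (g x)) b)"
    proof (intro Ck_on_sum[OF assms(1)] Ck_on_bilinear[OF bounded_bilinear_scaleR assms(1)])
      fix b :: 'b assume "b \<in> Basis"
      show "Ck_on k S (\<lambda>x. frechet_derivative g (at x) v \<bullet> b)"
        using Suc.prems(2) by (intro Ck_on_linear_compose[OF bounded_linear_inner_left assms(1)]) simp
      show "Ck_on k S (\<lambda>x. frechet_derivative f (at (g x)) b)"
      proof (rule Suc.IH)
        show "Ck_on k T (\<lambda>y. frechet_derivative f (at y) b)" using Suc.prems(1) by simp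
        show "Ck_on k S g" by (rule Ck_on_lower[OF Suc.prems(2)])
      qed
    qed
    show "(\<Sum>b\<in>Basis. (frechet_derivative g (at x) v \<bullet> b) *\<^sub>R frechet_derivative f (at (g x)) b)
        = frechet_derivative (\<lambda>x. f (g x)) (at x) v" if "x \<in> S" for x
    proof -
      have lin: "linear (frechet_derivative f (at (g x)))"
        using Suc.prems(1) assms(2) that
        by (intro linear_frechet_derivative) (auto simp: image_subset_iff)
      let ?w = "frechet_derivative g (at x) v"
      have "(\<Sum>b\<in>Basis. (?w \<bullet> b) *\<^sub>R frechet_derivative f (at (g x)) b)
          = frechet_derivative f (at (g x)) (\<Sum>b\<in>Basis. (?w \<bullet> b) *\<^sub>R b)"
        by (simp only: linear_sum[OF lin] linear_scale[OF lin])
      also have "\<dots> = frechet_derivative f (at (g x)) ?w"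
        by (simp only: euclidean_representation)
      also have "\<dots> = frechet_derivative (\<lambda>x. f (g x)) (at x) v"
        using fun_cong[OF frechet_derivative_at[OF D[OF that]], of v] .
      finally show ?thesis .
    qed
  qed
  moreover have "\<forall>x\<in>S. (\<lambda>x. f (g x)) differentiable (at x)"
    using D unfolding differentiable_def by blast
  ultimately show ?case unfolding Ck_on.simps by (intro conjI allI)
qed

lemma smooth_on_cong:
  "open S \<Longrightarrow> (\<And>x. x \<in> S \<Longrightarrow> f x = g x) \<Longrightarrow> smooth_on S f \<Longrightarrow> smooth_on S g"
  unfolding smooth_on_def using Ck_on_cong[of S f g] by blast

lemma smooth_on_subset: "smooth_on S f \<Longrightarrow> T \<subseteq> S \<Longrightarrow> smooth_on T f"
  unfolding smooth_on_def using Ck_on_subset by blast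

lemma smooth_on_Union:
  "(\<And>T. T \<in> \<T> \<Longrightarrow> open T) \<Longrightarrow> (\<And>T. T \<in> \<T> \<Longrightarrow> smooth_on T f) \<Longrightarrow> smooth_on (\<Union>\<T>) f"
  unfolding smooth_on_def using Ck_on_Union[of \<T>] by blast

lemma smooth_on_const: "smooth_on S (\<lambda>x. c)"
  unfolding smooth_on_def by (simp add: Ck_on_const)

lemma smooth_on_bounded_linear: "bounded_linear f \<Longrightarrow> smooth_on S f"
  unfolding smooth_on_def by (simp add: Ck_on_bounded_linear)

lemma smooth_on_add: "open S \<Longrightarrow> smooth_on S f \<Longrightarrow> smooth_on S g \<Longrightarrow> smooth_on S (\<lambda>x. f x + g x)"
  unfolding smooth_on_def by (simp add: Ck_on_add)

lemma smooth_on_mult: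
  fixes f g :: "_ \<Rightarrow> real"
  shows "open S \<Longrightarrow> smooth_on S f \<Longrightarrow> smooth_on S g \<Longrightarrow> smooth_on S (\<lambda>x. f x * g x)"
  unfolding smooth_on_def by (simp add: Ck_on_bilinear[OF bounded_bilinear_mult])

lemma smooth_on_linear_compose:
  "bounded_linear L \<Longrightarrow> open S \<Longrightarrow> smooth_on S f \<Longrightarrow> smooth_on S (\<lambda>x. L (f x))"
  unfolding smooth_on_def by (simp add: Ck_on_linear_compose)

lemma smooth_on_compose:
  fixes g :: "'a::real_normed_vector \<Rightarrow> 'b::euclidean_space" and f :: "'b \<Rightarrow> 'c::real_normed_vector"
  shows "open S \<Longrightarrow> g ` S \<subseteq> T \<Longrightarrow> smooth_on T f \<Longrightarrow> smooth_on S g \<Longrightarrow> smooth_on S (\<lambda>x. f (g x))"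
  unfolding smooth_on_def using Ck_on_compose[of S g T _ f] by blast

lemma smooth_on_Pair:
  assumes "open S" "smooth_on S f" "smooth_on S g"
  shows "smooth_on S (\<lambda>x. (f x, g x))"
proof -
  have "bounded_linear (\<lambda>a. (a, 0))" "bounded_linear (\<lambda>b. (0, b))"
    by (auto intro!: bounded_linear_Pair bounded_linear_ident bounded_linear_zero)
  then have "smooth_on S (\<lambda>x. (f x, 0))" "smooth_on S (\<lambda>x. (0, g x))"
    using smooth_on_linear_compose[of "\<lambda>a. (a, 0)" S f] smooth_on_linear_compose[of "\<lambda>b. (0, b)" S g]
      assms by simp_all
  then have "smooth_on S (\<lambda>x. (f x, 0) + (0, g x))"
    by (rule smooth_on_add[OF assms(1)])
  then show ?thesis by simp
qed

lemma smooth_on_deriv: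
  "smooth_on S f \<Longrightarrow> smooth_on S (\<lambda>x. frechet_derivative f (at x) v)"
  unfolding smooth_on_def using Ck_on.simps(2)[of _ S f] by blast

lemma smooth_on_differentiable: "smooth_on S f \<Longrightarrow> x \<in> S \<Longrightarrow> f differentiable (at x)"
  unfolding smooth_on_def using Ck_on.simps(2)[of 0 S f] by blast

text \<open>Each of the two functions is the derivative of the other, so the induction on the order treats
  both at once.\<close>

lemma smooth_on_cosh_sinh: "smooth_on S (cosh :: real \<Rightarrow> real)" "smooth_on S (sinh :: real \<Rightarrow> real)"
proof -
  have d: "(cosh has_derivative (\<lambda>v. v * sinh x)) (at x)" "(sinh has_derivative (\<lambda>v. v * cosh x)) (at x)"
    for x :: real
    by (auto intro!: derivative_eq_intros simp: fun_eq_iff)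
  have f: "frechet_derivative cosh (at x) = (\<lambda>v. v * sinh x)"
      "frechet_derivative sinh (at x) = (\<lambda>v. v * cosh x)" for x :: real
    using d frechet_derivative_at by metis+
  have "Ck_on k UNIV (cosh :: real \<Rightarrow> real) \<and> Ck_on k UNIV (sinh :: real \<Rightarrow> real)" for k
  proof (induction k)
    case 0
    then show ?case by (auto intro!: continuous_intros)
  next
    case (Suc k)
    then show ?case using d
      by (auto simp: f differentiable_def
          intro!: Ck_on_linear_compose[OF bounded_linear_mult_right])
  qed
  then show "smooth_on S (cosh :: real \<Rightarrow> real)" "smooth_on S (sinh :: real \<Rightarrow> real)"
    unfolding smooth_on_def by (auto intro: Ck_on_subset[OF _ subset_UNIV])
qed

section \<open>Smooth functions and tangent vectors in charts\<close>

lemma sum_fun_apply: "(\<Sum>i\<in>I. f i) x = (\<Sum>i\<in>I. f i x)"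
  by (induction I rule: infinite_finite_induct) auto

text \<open>The tangent vector with coordinates \<open>w\<close> in the chart \<open>c\<close>. The value \<open>0\<close> on functions that are
  not smooth is the convention of \<^const>\<open>velocity\<close>.\<close>

definition chart_vec ::
  "('a, 'e::euclidean_space) mfd \<Rightarrow> 'a set \<Rightarrow> ('a \<Rightarrow> 'e) \<Rightarrow> 'a \<Rightarrow> 'e \<Rightarrow> 'a tvec" where
  "chart_vec M V c p w =
     (\<lambda>f. if smooth_near M p f then frechet_derivative (f \<circ> inv_into V c) (at (c p)) w else 0)"

locale smooth_mfd =
  fixes M :: "('a, 'e::euclidean_space) mfd"
  assumes smooth_manifold: "smooth_manifold M"
begin

lemma chart_openin: "(V, c) \<in> atlas M \<Longrightarrow> openin (mtop M) V"
  and chart_open_image: "(V, c) \<in> atlas M \<Longrightarrow> open (c ` V)"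
  and chart_homeo: "(V, c) \<in> atlas M \<Longrightarrow>
        homeomorphic_map (subtopology (mtop M) V) (top_of_set (c ` V)) c"
  and chart_transition: "(V, c) \<in> atlas M \<Longrightarrow> (V', c') \<in> atlas M \<Longrightarrow>
        smooth_on (c ` (V \<inter> V')) (c' \<circ> inv_into V c)"
  using smooth_manifold unfolding smooth_manifold_def by blast+

lemma chart_cover: "p \<in> pts M \<Longrightarrow> \<exists>V c. (V, c) \<in> atlas M \<and> p \<in> V"
  using smooth_manifold unfolding smooth_manifold_def by blast

lemma chart_subset: "(V, c) \<in> atlas M \<Longrightarrow> V \<subseteq> pts M"
  using chart_openin openin_subset by blast

lemma chart_inj: assumes "(V, c) \<in> atlas M" shows "inj_on c V"
  using homeomorphic_imp_injective_map[OF chart_homeo[OF assms]] chart_subset[OF assms]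
  by (simp add: Int_absorb1)

lemma chart_image_open:
  assumes "(V, c) \<in> atlas M" "openin (mtop M) W" shows "open (c ` (W \<inter> V))"
proof -
  have "openin (top_of_set (c ` V)) (c ` (W \<inter> V))"
    using homeomorphic_imp_open_map[OF chart_homeo[OF assms(1)]] assms(2)
    by (auto simp: open_map_def openin_subtopology)
  then show ?thesis using chart_open_image[OF assms(1)] by (simp add: openin_open_eq)
qed

lemma smooth_fun_on_openin: "smooth_fun_on M U f \<Longrightarrow> openin (mtop M) U"
  unfolding smooth_fun_on_def by simp

lemma smooth_fun_on_chartD:
  "smooth_fun_on M U f \<Longrightarrow> (V, c) \<in> atlas M \<Longrightarrow> smooth_on (c ` (U \<inter> V)) (f \<circ> inv_into V c)"
  unfolding smooth_fun_on_def by blast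

text \<open>Smoothness in one chart passes to all others through the transition maps.\<close>

lemma smooth_fun_on_chartI:
  assumes V: "(V, c) \<in> atlas M" and U: "openin (mtop M) U" "U \<subseteq> V"
    and f: "smooth_on (c ` U) (f \<circ> inv_into V c)"
  shows "smooth_fun_on M U f"
  unfolding smooth_fun_on_def
proof (intro conjI U(1) ballI, clarify)
  fix V' c' assume V': "(V', c') \<in> atlas M"
  let ?S = "c' ` (U \<inter> V')"
  have o: "open ?S" using chart_image_open[OF V' U(1)] .
  have inv: "inv_into V' c' (c' q) = q" if "q \<in> V'" for q
    using chart_inj[OF V'] that by simp
  have inv2: "inv_into V c (c q) = q" if "q \<in> V" for q
    using chart_inj[OF V] that by simp
  have "smooth_on ?S (\<lambda>x. (f \<circ> inv_into V c) ((c \<circ> inv_into V' c') x))"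
  proof (rule smooth_on_compose[OF o _ f])
    show "(c \<circ> inv_into V' c') ` ?S \<subseteq> c ` U" using inv by auto
    show "smooth_on ?S (c \<circ> inv_into V' c')"
      by (rule smooth_on_subset[OF chart_transition[OF V' V]]) (use U(2) in auto)
  qed
  then show "smooth_on ?S (f \<circ> inv_into V' c')"
    by (rule smooth_on_cong[OF o, rotated]) (use inv inv2 U(2) in auto)
qed

lemma smooth_fun_on_local:
  assumes "\<And>p. p \<in> U \<Longrightarrow> \<exists>W. p \<in> W \<and> W \<subseteq> U \<and> smooth_fun_on M W f"
  shows "smooth_fun_on M U f"
proof -
  define \<W> where "\<W> = {W. W \<subseteq> U \<and> smooth_fun_on M W f}"
  have U: "U = \<Union>\<W>" using assms unfolding \<W>_def by blast
  have W: "openin (mtop M) W" if "W \<in> \<W>" for W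
    using that smooth_fun_on_openin unfolding \<W>_def by blast
  have "smooth_on (c ` (U \<inter> V)) (f \<circ> inv_into V c)" if V: "(V, c) \<in> atlas M" for V c
  proof -
    have eq: "c ` (U \<inter> V) = \<Union>((\<lambda>W. c ` (W \<inter> V)) ` \<W>)" unfolding U by blast
    show ?thesis unfolding eq
      by (rule smooth_on_Union)
         (use W chart_image_open[OF V] smooth_fun_on_chartD[OF _ V] in \<open>auto simp: \<W>_def\<close>)
  qed
  moreover have "openin (mtop M) U" unfolding U using W by blast
  ultimately show ?thesis unfolding smooth_fun_on_def by blast
qed

lemma smooth_fun_on_subset:
  "smooth_fun_on M U f \<Longrightarrow> openin (mtop M) W \<Longrightarrow> W \<subseteq> U \<Longrightarrow> smooth_fun_on M W f"
  unfolding smooth_fun_on_def by (fastforce intro: smooth_on_subset)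

lemma smooth_fun_on_cong:
  assumes "smooth_fun_on M U f" "\<And>p. p \<in> U \<Longrightarrow> f p = g p"
  shows "smooth_fun_on M U g"
  unfolding smooth_fun_on_def
proof (intro conjI ballI smooth_fun_on_openin[OF assms(1)], clarify)
  fix V c assume V: "(V, c) \<in> atlas M"
  show "smooth_on (c ` (U \<inter> V)) (g \<circ> inv_into V c)"
    by (rule smooth_on_cong[OF chart_image_open[OF V smooth_fun_on_openin[OF assms(1)]]
          _ smooth_fun_on_chartD[OF assms(1) V]])
       (use assms(2) chart_inj[OF V] in auto)
qed

lemma smooth_fun_on_const: "openin (mtop M) U \<Longrightarrow> smooth_fun_on M U (\<lambda>p. a)"
  unfolding smooth_fun_on_def by (auto simp: o_def smooth_on_const)

lemma smooth_fun_on_add: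
  assumes "smooth_fun_on M U f" "smooth_fun_on M U g"
  shows "smooth_fun_on M U (\<lambda>p. f p + g p)"
  using assms smooth_on_add[OF chart_image_open[OF _ smooth_fun_on_openin[OF assms(1)]]]
  unfolding smooth_fun_on_def by (fastforce simp: o_def)

lemma smooth_fun_on_mult:
  assumes "smooth_fun_on M U f" "smooth_fun_on M U g"
  shows "smooth_fun_on M U (\<lambda>p. f p * g p)"
  using assms smooth_on_mult[OF chart_image_open[OF _ smooth_fun_on_openin[OF assms(1)]]]
  unfolding smooth_fun_on_def by (fastforce simp: o_def)

lemma smooth_fun_on_sum:
  assumes "openin (mtop M) U" "\<And>i. i \<in> I \<Longrightarrow> smooth_fun_on M U (f i)"
  shows "smooth_fun_on M U (\<lambda>p. \<Sum>i\<in>I. f i p)"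
  using assms(2)
  by (induction I rule: infinite_finite_induct)
     (auto intro: smooth_fun_on_const[OF assms(1)] smooth_fun_on_add)

lemma smooth_fun_on_coord:
  assumes V: "(V, c) \<in> atlas M" shows "smooth_fun_on M V (\<lambda>q. c q \<bullet> b)"
proof (rule smooth_fun_on_chartI[OF V chart_openin[OF V] order_refl])
  show "smooth_on (c ` V) ((\<lambda>q. c q \<bullet> b) \<circ> inv_into V c)"
    by (rule smooth_on_cong[OF chart_open_image[OF V] _
          smooth_on_bounded_linear[OF bounded_linear_inner_left[of b]]])
       (use chart_inj[OF V] in auto)
qed

lemma smooth_nearI: "smooth_fun_on M U f \<Longrightarrow> p \<in> U \<Longrightarrow> smooth_near M p f"
  unfolding smooth_near_def by blast

lemma smooth_near_cong:
  assumes W: "openin (mtop M) W" "p \<in> W" "\<And>q. q \<in> W \<Longrightarrow> f q = g q" and f: "smooth_near M p f"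
  shows "smooth_near M p g"
proof -
  obtain U where U: "p \<in> U" "smooth_fun_on M U f" using f unfolding smooth_near_def by blast
  have "smooth_fun_on M (U \<inter> W) f"
    by (rule smooth_fun_on_subset[OF U(2)]) (use W(1) smooth_fun_on_openin[OF U(2)] in auto)
  then have "smooth_fun_on M (U \<inter> W) g" by (rule smooth_fun_on_cong) (use W(3) in auto)
  then show ?thesis by (rule smooth_nearI) (use U W in auto)
qed

lemma smooth_near_in_chart:
  assumes V: "(V, c) \<in> atlas M" and p: "p \<in> V" and f: "smooth_near M p f"
  shows "(f \<circ> inv_into V c) differentiable (at (c p))"
proof -
  obtain U where U: "p \<in> U" "smooth_fun_on M U f" using f unfolding smooth_near_def by blast
  show ?thesis
    by (rule smooth_on_differentiable[OF smooth_fun_on_chartD[OF U(2) V]]) (use U(1) p in auto)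
qed

lemma chart_vec_linear:
  assumes V: "(V, c) \<in> atlas M" and p: "p \<in> V"
  shows "linear (chart_vec M V c p)"
proof (rule linearI; rule ext)
  fix u v :: 'e and a :: real and f :: "'a \<Rightarrow> real"
  let ?D = "frechet_derivative (f \<circ> inv_into V c) (at (c p))"
  have "smooth_near M p f \<Longrightarrow> linear ?D"
    by (rule linear_frechet_derivative[OF smooth_near_in_chart[OF V p]])
  then show "chart_vec M V c p (u + v) f = (chart_vec M V c p u + chart_vec M V c p v) f"
      "chart_vec M V c p (a *\<^sub>R u) f = (a *\<^sub>R chart_vec M V c p u) f"
    by (auto simp: chart_vec_def scaleR_fun_def linear_add linear_scale)
qed

lemma chart_vec_coord:
  assumes V: "(V, c) \<in> atlas M" and p: "p \<in> V"
  shows "chart_vec M V c p w (\<lambda>q. c q \<bullet> b) = w \<bullet> b"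
proof -
  have "((\<lambda>x. x \<bullet> b) has_derivative (\<lambda>x. x \<bullet> b)) (at (c p))"
    by (rule bounded_linear_imp_has_derivative[OF bounded_linear_inner_left])
  then have "((\<lambda>q. c q \<bullet> b) \<circ> inv_into V c has_derivative (\<lambda>x. x \<bullet> b)) (at (c p))"
    by (rule has_derivative_transform_within_open[OF _ chart_open_image[OF V]])
       (use p in \<open>auto simp: f_inv_into_f\<close>)
  then have "frechet_derivative ((\<lambda>q. c q \<bullet> b) \<circ> inv_into V c) (at (c p)) = (\<lambda>x. x \<bullet> b)"
    using frechet_derivative_at by metis
  then show ?thesis
    using smooth_nearI[OF smooth_fun_on_coord[OF V] p] by (simp add: chart_vec_def)
qed

lemma velocity_in_range_chart_vec:
  assumes V: "(V, c) \<in> atlas M" and p: "p \<in> V" and g: "smooth_curve_through M p \<gamma>"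
  shows "velocity M \<gamma> \<in> range (chart_vec M V c p)"
proof -
  obtain \<epsilon> where e: "\<epsilon> > 0" "continuous_map (top_of_set {-\<epsilon><..<\<epsilon>}) (mtop M) \<gamma>"
      "smooth_on {s \<in> {-\<epsilon><..<\<epsilon>}. \<gamma> s \<in> V} (c \<circ> \<gamma>)"
    using g V unfolding smooth_curve_through_def by blast
  have g0: "\<gamma> 0 = p" using g unfolding smooth_curve_through_def by simp
  let ?I = "{s \<in> {-\<epsilon><..<\<epsilon>}. \<gamma> s \<in> V}"
  have o: "open ?I"
    using openin_continuous_map_preimage[OF e(2) chart_openin[OF V]]
    by (simp add: openin_open_eq)
  have I0: "0 \<in> ?I" using e(1) g0 p by auto
  define L where "L = frechet_derivative (c \<circ> \<gamma>) (at 0)"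
  have L: "(c \<circ> \<gamma> has_derivative L) (at 0)"
    using smooth_on_differentiable[OF e(3) I0] unfolding L_def by (simp add: frechet_derivative_works)
  have "velocity M \<gamma> f = chart_vec M V c p (L 1) f" for f
  proof (cases "smooth_near M p f")
    case True
    define Df where "Df = frechet_derivative (f \<circ> inv_into V c) (at (c p))"
    have Df: "(f \<circ> inv_into V c has_derivative Df) (at (c p))"
      using smooth_near_in_chart[OF V p True] unfolding Df_def by (simp add: frechet_derivative_works)
    then have "((\<lambda>s. (f \<circ> inv_into V c) ((c \<circ> \<gamma>) s)) has_derivative (\<lambda>s. Df (L s))) (at 0)"
      using has_derivative_compose[OF L, of "f \<circ> inv_into V c" Df] g0 by (simp add: o_def)
    then have "((\<lambda>s. f (\<gamma> s)) has_derivative (\<lambda>s. Df (L s))) (at 0)"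
      by (rule has_derivative_transform_within_open[OF _ o I0]) (use chart_inj[OF V] in auto)
    moreover have "(\<lambda>s. Df (L s)) = (*) (Df (L 1))"
    proof
      fix s :: real
      have "Df (L (s *\<^sub>R 1)) = s *\<^sub>R Df (L 1)"
        using has_derivative_linear[OF L] has_derivative_linear[OF Df] by (simp only: linear_scale)
      then show "Df (L s) = Df (L 1) * s" by simp
    qed
    ultimately have "((\<lambda>s. f (\<gamma> s)) has_field_derivative Df (L 1)) (at 0)"
      by (simp add: has_field_derivative_def)
    then show ?thesis using True g0 by (simp add: velocity_def chart_vec_def Df_def DERIV_imp_deriv)
  qed (simp add: velocity_def chart_vec_def g0)
  then show ?thesis by blast
qed

text \<open>The curve with this velocity is a straight line in the chart.\<close>

lemma chart_vec_in_tangent_space: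
  assumes V: "(V, c) \<in> atlas M" and p: "p \<in> V"
  shows "chart_vec M V c p w \<in> tangent_space M p"
proof -
  let ?l = "\<lambda>s::real. c p + s *\<^sub>R w"
  define \<gamma> where "\<gamma> = (\<lambda>s. inv_into V c (?l s))"
  have "continuous_on UNIV ?l" by (intro continuous_intros)
  then have pre: "open (?l -` T)" if "open T" for T
    using that by (simp add: open_vimage)
  have "0 \<in> ?l -` (c ` V)" using p by simp
  then obtain \<epsilon> where e: "\<epsilon> > 0" "ball 0 \<epsilon> \<subseteq> ?l -` (c ` V)"
    using pre[OF chart_open_image[OF V]] openE by blast
  have ball: "ball 0 \<epsilon> = {-\<epsilon><..<\<epsilon>}" by (auto simp: dist_real_def)
  have inV: "\<gamma> s \<in> V" "c (\<gamma> s) = ?l s" if "s \<in> {-\<epsilon><..<\<epsilon>}" for s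
  proof -
    have "?l s \<in> c ` V" using that e(2) unfolding ball by blast
    then show "\<gamma> s \<in> V" "c (\<gamma> s) = ?l s" unfolding \<gamma>_def by (auto intro: inv_into_into f_inv_into_f)
  qed
  have preW: "{s \<in> {-\<epsilon><..<\<epsilon>}. \<gamma> s \<in> W} = {-\<epsilon><..<\<epsilon>} \<inter> ?l -` (c ` (W \<inter> V))" for W
  proof -
    have "\<gamma> s \<in> W \<longleftrightarrow> s \<in> ?l -` (c ` (W \<inter> V))" if "s \<in> {-\<epsilon><..<\<epsilon>}" for s
      using inj_on_image_mem_iff[OF chart_inj[OF V] inV(1)[OF that], of "W \<inter> V"] inV[OF that]
      by (simp add: vimage_def)
    then show ?thesis by blast
  qed
  have o: "open {s \<in> {-\<epsilon><..<\<epsilon>}. \<gamma> s \<in> W}" if "openin (mtop M) W" for W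
    unfolding preW using pre[OF chart_image_open[OF V that]] by auto
  have g0: "\<gamma> 0 = p" unfolding \<gamma>_def using chart_inj[OF V] p by simp
  have "continuous_map (top_of_set {-\<epsilon><..<\<epsilon>}) (mtop M) \<gamma>"
    unfolding continuous_map_def using inV(1) chart_subset[OF V] o
    by (auto simp: openin_open_eq)
  moreover have "smooth_on {s \<in> {-\<epsilon><..<\<epsilon>}. \<gamma> s \<in> V'} (c' \<circ> \<gamma>)" (is "smooth_on ?I _")
    if V': "(V', c') \<in> atlas M" for V' c'
  proof -
    have I: "open ?I" using o[OF chart_openin[OF V']] .
    have "smooth_on ?I (\<lambda>s. (c' \<circ> inv_into V c) (?l s))"
    proof (rule smooth_on_compose[OF I _ chart_transition[OF V V']])
      show "?l ` ?I \<subseteq> c ` (V \<inter> V')" using preW[of V'] by auto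
      show "smooth_on ?I ?l"
        by (intro smooth_on_add[OF I] smooth_on_const smooth_on_bounded_linear
            bounded_linear_scaleR_left)
    qed
    then show ?thesis by (simp add: \<gamma>_def o_def)
  qed
  ultimately have "smooth_curve_through M p \<gamma>"
    unfolding smooth_curve_through_def using g0 e(1) by blast
  moreover have "velocity M \<gamma> = chart_vec M V c p w"
  proof
    fix f
    show "velocity M \<gamma> f = chart_vec M V c p w f"
    proof (cases "smooth_near M p f")
      case True
      define Df where "Df = frechet_derivative (f \<circ> inv_into V c) (at (c p))"
      have Df: "(f \<circ> inv_into V c has_derivative Df) (at (?l 0))"
        using smooth_near_in_chart[OF V p True] unfolding Df_def by (simp add: frechet_derivative_works)
      have "(?l has_derivative (\<lambda>s. s *\<^sub>R w)) (at 0)"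
        by (auto intro!: derivative_eq_intros)
      from has_derivative_compose[OF this Df]
      have "((\<lambda>s. f (\<gamma> s)) has_derivative (\<lambda>s. Df (s *\<^sub>R w))) (at 0)" by (simp add: \<gamma>_def)
      moreover have "(\<lambda>s. Df (s *\<^sub>R w)) = (*) (Df w)"
        using has_derivative_linear[OF Df] by (auto simp: linear_scale)
      ultimately have "((\<lambda>s. f (\<gamma> s)) has_field_derivative Df w) (at 0)"
        by (simp add: has_field_derivative_def)
      then show ?thesis using True g0 by (simp add: velocity_def chart_vec_def Df_def DERIV_imp_deriv)
    qed (simp add: velocity_def chart_vec_def g0)
  qed
  ultimately show ?thesis
    unfolding tangent_space_def mem_Collect_eq by (intro exI[of _ \<gamma>]) simp
qed

lemma tangent_space_eq_range:
  assumes "(V, c) \<in> atlas M" "p \<in> V"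
  shows "tangent_space M p = range (chart_vec M V c p)"
proof
  show "tangent_space M p \<subseteq> range (chart_vec M V c p)"
    using velocity_in_range_chart_vec[OF assms] by (auto simp: tangent_space_def)
  show "range (chart_vec M V c p) \<subseteq> tangent_space M p"
    using chart_vec_in_tangent_space[OF assms] by auto
qed

lemma tangent_vec_chart:
  assumes V: "(V, c) \<in> atlas M" and p: "p \<in> V" and v: "v \<in> tangent_space M p"
  shows "v = (\<Sum>b\<in>Basis. v (\<lambda>q. c q \<bullet> b) *\<^sub>R chart_vec M V c p b)"
proof -
  obtain w where w: "v = chart_vec M V c p w"
    using v tangent_space_eq_range[OF V p] by blast
  have "chart_vec M V c p (\<Sum>b\<in>Basis. (w \<bullet> b) *\<^sub>R b) = (\<Sum>b\<in>Basis. (w \<bullet> b) *\<^sub>R chart_vec M V c p b)"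
    using chart_vec_linear[OF V p] by (simp add: linear_sum linear_scale)
  then show ?thesis unfolding w chart_vec_coord[OF V p] by (simp add: euclidean_representation)
qed

lemma tangent_vec_eqI:
  assumes V: "(V, c) \<in> atlas M" and p: "p \<in> V"
    and "u \<in> tangent_space M p" "v \<in> tangent_space M p"
    and "\<And>b. b \<in> Basis \<Longrightarrow> u (\<lambda>q. c q \<bullet> b) = v (\<lambda>q. c q \<bullet> b)"
  shows "u = v"
proof -
  have "u = (\<Sum>b\<in>Basis. u (\<lambda>q. c q \<bullet> b) *\<^sub>R chart_vec M V c p b)"
    by (rule tangent_vec_chart[OF V p assms(3)])
  also have "\<dots> = (\<Sum>b\<in>Basis. v (\<lambda>q. c q \<bullet> b) *\<^sub>R chart_vec M V c p b)"
    by (rule sum.cong) (simp_all only: assms(5))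
  also have "\<dots> = v" by (rule tangent_vec_chart[OF V p assms(4), symmetric])
  finally show ?thesis .
qed

lemma tangent_vec_not_smooth:
  assumes "p \<in> pts M" "v \<in> tangent_space M p" "\<not> smooth_near M p f"
  shows "v f = 0"
  using chart_cover[OF assms(1)] tangent_space_eq_range assms(2,3)
  by (fastforce simp: chart_vec_def)

text \<open>Tangent vectors only see germs. This is used throughout to replace a function by a formula for
  it that is valid near the point only.\<close>

lemma tangent_vec_local:
  assumes p: "p \<in> pts M" and v: "v \<in> tangent_space M p"
    and W: "openin (mtop M) W" "p \<in> W" "\<And>q. q \<in> W \<Longrightarrow> f q = g q"
  shows "v f = v g"
proof (cases "smooth_near M p f")
  case True
  then have g: "smooth_near M p g" using smooth_near_cong[of W p f g] W by blast
  obtain V c where V: "(V, c) \<in> atlas M" "p \<in> V" using chart_cover[OF p] by blast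
  obtain w where w: "v = chart_vec M V c p w"
    using v tangent_space_eq_range[OF V] by blast
  have "frechet_derivative (f \<circ> inv_into V c) (at (c p)) = frechet_derivative (g \<circ> inv_into V c) (at (c p))"
    by (rule frechet_derivative_transform_within_open[OF smooth_near_in_chart[OF V True]
          chart_image_open[OF V(1) W(1)]])
       (use W V chart_inj[OF V(1)] in auto)
  then show ?thesis using True g unfolding w by (simp add: chart_vec_def)
next
  case False
  moreover have "\<not> smooth_near M p g" using False smooth_near_cong[of W p g f] W by metis
  ultimately show ?thesis using tangent_vec_not_smooth[OF p v] by simp
qed

lemma tangent_vec_scale:
  assumes p: "p \<in> pts M" and v: "v \<in> tangent_space M p" and f: "smooth_near M p f"
  shows "v (\<lambda>q. r * f q) = r * v f"
proof -
  obtain V c where V: "(V, c) \<in> atlas M" "p \<in> V" using chart_cover[OF p] by blast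
  obtain w where w: "v = chart_vec M V c p w"
    using v tangent_space_eq_range[OF V] by blast
  obtain U where U: "p \<in> U" "smooth_fun_on M U f" using f unfolding smooth_near_def by blast
  have rf: "smooth_near M p (\<lambda>q. r * f q)"
    by (rule smooth_nearI[OF smooth_fun_on_mult[OF smooth_fun_on_const U(2)] U(1)])
       (rule smooth_fun_on_openin[OF U(2)])
  define Df where "Df = frechet_derivative (f \<circ> inv_into V c) (at (c p))"
  have Df: "(f \<circ> inv_into V c has_derivative Df) (at (c p))"
    using smooth_near_in_chart[OF V f] unfolding Df_def by (simp add: frechet_derivative_works)
  then have "((\<lambda>q. r * f q) \<circ> inv_into V c has_derivative (\<lambda>x. r * Df x)) (at (c p))"
    unfolding o_def by (rule has_derivative_mult_right)
  then have "frechet_derivative ((\<lambda>q. r * f q) \<circ> inv_into V c) (at (c p)) = (\<lambda>x. r * Df x)"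
    using frechet_derivative_at by metis
  then show ?thesis unfolding w using f rf by (simp add: chart_vec_def Df_def)
qed

lemma tangent_vec_const:
  assumes p: "p \<in> pts M" and v: "v \<in> tangent_space M p"
  shows "v (\<lambda>q. r) = 0"
proof -
  obtain V c where V: "(V, c) \<in> atlas M" "p \<in> V" using chart_cover[OF p] by blast
  obtain w where w: "v = chart_vec M V c p w"
    using v tangent_space_eq_range[OF V] by blast
  show ?thesis unfolding w by (simp add: chart_vec_def o_def)
qed

lemma tangent_space_subspace:
  assumes "p \<in> pts M" shows "subspace (tangent_space M p)"
proof -
  obtain V c where V: "(V, c) \<in> atlas M" "p \<in> V" using chart_cover[OF assms] by blast
  show ?thesis unfolding tangent_space_eq_range[OF V]
    by (rule linear_subspace_image[OF chart_vec_linear[OF V] subspace_UNIV])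
qed

lemma chart_vec_inj:
  assumes V: "(V, c) \<in> atlas M" and p: "p \<in> V" shows "inj (chart_vec M V c p)"
  by (rule injI, rule euclidean_eqI) (metis chart_vec_coord[OF V p])

lemma tangent_space_dim:
  assumes "p \<in> pts M" shows "dim (tangent_space M p) = DIM('e)"
proof -
  obtain V c where V: "(V, c) \<in> atlas M" "p \<in> V" using chart_cover[OF assms] by blast
  have "dim (chart_vec M V c p ` UNIV) = dim (UNIV :: 'e set)"
    by (rule dim_image_eq[OF chart_vec_linear[OF V]]) (use chart_vec_inj[OF V] in auto)
  then show ?thesis unfolding tangent_space_eq_range[OF V] by simp
qed

subsection \<open>Vector fields\<close>

text \<open>With respect to a chart, \<open>X f\<close> is the sum of the components of \<open>X\<close> times the partial derivatives
  of \<open>f\<close>. So it is enough to differentiate the coordinate functions.\<close>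

lemma vector_field_onI:
  assumes U: "openin (mtop M) U" and X: "\<And>p. p \<in> U \<Longrightarrow> X p \<in> tangent_space M p"
    and comp: "\<And>V c b. (V, c) \<in> atlas M \<Longrightarrow> b \<in> Basis \<Longrightarrow>
                 smooth_fun_on M (U \<inter> V) (\<lambda>p. X p (\<lambda>q. c q \<bullet> b))"
  shows "vector_field_on M U X"
  unfolding vector_field_on_def
proof (intro conjI allI impI U ballI X)
  fix W f assume WU: "W \<subseteq> U" and f: "smooth_fun_on M W f"
  have W: "openin (mtop M) W" using smooth_fun_on_openin[OF f] .
  show "smooth_fun_on M W (\<lambda>p. X p f)"
  proof (rule smooth_fun_on_local)
    fix p assume p: "p \<in> W"
    then obtain V c where V: "(V, c) \<in> atlas M" "p \<in> V"
      using chart_cover[of p] openin_subset[OF W] by blast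
    have WV: "openin (mtop M) (W \<inter> V)" using W chart_openin[OF V(1)] by blast
    have D: "smooth_fun_on M (W \<inter> V) (\<lambda>p. frechet_derivative (f \<circ> inv_into V c) (at (c p)) b)" for b
    proof (rule smooth_fun_on_chartI[OF V(1) WV])
      show "smooth_on (c ` (W \<inter> V)) ((\<lambda>p. frechet_derivative (f \<circ> inv_into V c) (at (c p)) b) \<circ> inv_into V c)"
        by (rule smooth_on_cong[OF chart_image_open[OF V(1) W] _
              smooth_on_deriv[OF smooth_fun_on_chartD[OF f V(1)]]])
           (use chart_inj[OF V(1)] in auto)
    qed auto
    have "smooth_fun_on M (W \<inter> V) (\<lambda>p. \<Sum>b\<in>Basis. X p (\<lambda>q. c q \<bullet> b) *
            frechet_derivative (f \<circ> inv_into V c) (at (c p)) b)"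
    proof (intro smooth_fun_on_sum WV smooth_fun_on_mult D)
      show "smooth_fun_on M (W \<inter> V) (\<lambda>p. X p (\<lambda>q. c q \<bullet> b))" if "b \<in> Basis" for b
        by (rule smooth_fun_on_subset[OF comp[OF V(1) that] WV]) (use WU in auto)
    qed
    then have "smooth_fun_on M (W \<inter> V) (\<lambda>p. X p f)"
    proof (rule smooth_fun_on_cong)
      fix p assume p: "p \<in> W \<inter> V"
      then have sn: "smooth_near M p f" and "p \<in> V" "p \<in> U" using smooth_nearI[OF f] WU by auto
      have "X p = (\<Sum>b\<in>Basis. X p (\<lambda>q. c q \<bullet> b) *\<^sub>R chart_vec M V c p b)"
        by (rule tangent_vec_chart[OF V(1) \<open>p \<in> V\<close> X[OF \<open>p \<in> U\<close>]])
      then have "X p f = (\<Sum>b\<in>Basis. X p (\<lambda>q. c q \<bullet> b) *\<^sub>R chart_vec M V c p b) f" by (rule fun_cong)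
      also have "\<dots> = (\<Sum>b\<in>Basis. X p (\<lambda>q. c q \<bullet> b) * chart_vec M V c p b f)"
        by (simp add: sum_fun_apply scaleR_fun_def)
      finally show "(\<Sum>b\<in>Basis. X p (\<lambda>q. c q \<bullet> b) *
            frechet_derivative (f \<circ> inv_into V c) (at (c p)) b) = X p f"
        using sn by (simp add: chart_vec_def)
    qed
    then show "\<exists>Wa. p \<in> Wa \<and> Wa \<subseteq> W \<and> smooth_fun_on M Wa (\<lambda>p. X p f)"
      using p V by blast
  qed
qed

lemma vector_field_on_openin: "vector_field_on M U X \<Longrightarrow> openin (mtop M) U"
  and vector_field_on_tangent: "vector_field_on M U X \<Longrightarrow> p \<in> U \<Longrightarrow> X p \<in> tangent_space M p"
  and vector_field_on_smooth: "vector_field_on M U X \<Longrightarrow> smooth_fun_on M V f \<Longrightarrow> V \<subseteq> U \<Longrightarrow>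
        smooth_fun_on M V (\<lambda>p. X p f)"
  unfolding vector_field_on_def by auto

lemma vector_field_on_pts: "vector_field_on M U X \<Longrightarrow> p \<in> U \<Longrightarrow> p \<in> pts M"
  using vector_field_on_openin openin_subset by blast

lemma vector_field_on_coord:
  assumes "vector_field_on M U X" "(V, c) \<in> atlas M"
  shows "smooth_fun_on M (U \<inter> V) (\<lambda>p. X p (\<lambda>q. c q \<bullet> b))"
  using vector_field_on_openin[OF assms(1)] chart_openin[OF assms(2)]
  by (intro vector_field_on_smooth[OF assms(1)] smooth_fun_on_subset[OF smooth_fun_on_coord[OF assms(2)]])
     auto

lemma vector_field_on_subset:
  "vector_field_on M U X \<Longrightarrow> openin (mtop M) W \<Longrightarrow> W \<subseteq> U \<Longrightarrow> vector_field_on M W X"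
  unfolding vector_field_on_def by blast

lemma vector_field_on_cong:
  assumes "vector_field_on M U X" "\<And>p. p \<in> U \<Longrightarrow> X p = Y p"
  shows "vector_field_on M U Y"
  unfolding vector_field_on_def
proof (intro conjI allI impI ballI vector_field_on_openin[OF assms(1)])
  show "Y p \<in> tangent_space M p" if "p \<in> U" for p
    using vector_field_on_tangent[OF assms(1) that] assms(2)[OF that] by simp
  fix V f assume "V \<subseteq> U" "smooth_fun_on M V f"
  then show "smooth_fun_on M V (\<lambda>p. Y p f)"
    using smooth_fun_on_cong[OF vector_field_on_smooth[OF assms(1)]] assms(2) by (metis subsetD)
qed

lemma vector_field_on_lincomb:
  assumes X: "vector_field_on M U X" and Y: "vector_field_on M U Y"
  shows "vector_field_on M U (\<lambda>p. r *\<^sub>R X p + s *\<^sub>R Y p)"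
  unfolding vector_field_on_def
proof (intro conjI allI impI ballI vector_field_on_openin[OF X])
  show "r *\<^sub>R X p + s *\<^sub>R Y p \<in> tangent_space M p" if "p \<in> U" for p
    using vector_field_on_tangent[OF X that] vector_field_on_tangent[OF Y that]
      tangent_space_subspace[OF vector_field_on_pts[OF X that]]
    by (simp add: subspace_add subspace_scale)
  fix V f assume V: "V \<subseteq> U" and f: "smooth_fun_on M V f"
  show "smooth_fun_on M V (\<lambda>p. (r *\<^sub>R X p + s *\<^sub>R Y p) f)"
    using smooth_fun_on_openin[OF f]
    by (auto simp: scaleR_fun_def intro!: smooth_fun_on_add smooth_fun_on_mult smooth_fun_on_const
        vector_field_on_smooth[OF X f V] vector_field_on_smooth[OF Y f V])
qed

lemma chart_vec_vector_field:
  assumes V: "(V, c) \<in> atlas M" shows "vector_field_on M V (\<lambda>p. chart_vec M V c p w)"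
  unfolding vector_field_on_def
proof (intro conjI allI impI ballI chart_openin[OF V] chart_vec_in_tangent_space[OF V])
  fix W f assume W: "W \<subseteq> V" and f: "smooth_fun_on M W f"
  show "smooth_fun_on M W (\<lambda>p. chart_vec M V c p w f)"
  proof (rule smooth_fun_on_chartI[OF V smooth_fun_on_openin[OF f] W])
    have W': "W \<inter> V = W" using W by blast
    show "smooth_on (c ` W) ((\<lambda>p. chart_vec M V c p w f) \<circ> inv_into V c)"
    proof (rule smooth_on_cong[OF _ _ smooth_on_deriv[OF smooth_fun_on_chartD[OF f V, unfolded W'], of w]])
      show "open (c ` W)" using chart_image_open[OF V smooth_fun_on_openin[OF f]] W' by simp
      fix x assume "x \<in> c ` W"
      then obtain q where q: "q \<in> W" "x = c q" by blast
      then show "frechet_derivative (f \<circ> inv_into V c) (at x) w = ((\<lambda>p. chart_vec M V c p w f) \<circ> inv_into V c) x"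
        using W chart_inj[OF V] smooth_nearI[OF f] by (auto simp: chart_vec_def)
    qed
  qed
qed

lemma tangent_vec_extend:
  assumes "p \<in> pts M" "v \<in> tangent_space M p"
  obtains U X where "p \<in> U" "vector_field_on M U X" "X p = v"
proof -
  obtain V c where V: "(V, c) \<in> atlas M" "p \<in> V" using chart_cover[OF assms(1)] by blast
  then obtain w where "v = chart_vec M V c p w" using assms(2) tangent_space_eq_range by blast
  then show thesis using that[of V "\<lambda>p. chart_vec M V c p w"] V chart_vec_vector_field by blast
qed

end

section \<open>The trace of an endomorphism of a subspace\<close>

lemma linear_on_space_sum:
  assumes A: "linear_on_space T A" and T: "subspace T" and "finite I" "\<And>i. i \<in> I \<Longrightarrow> f i \<in> T"
  shows "A (\<Sum>i\<in>I. c i *\<^sub>R f i) = (\<Sum>i\<in>I. c i *\<^sub>R A (f i))"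
proof -
  have z: "A 0 = 0"
  proof -
    have "A (0 *\<^sub>R 0) = 0 *\<^sub>R A 0"
      using A subspace_0[OF T] unfolding linear_on_space_def by blast
    then show ?thesis by simp
  qed
  show ?thesis using assms(3,4)
  proof (induction I rule: finite_induct)
    case (insert i I)
    have "(\<Sum>i\<in>I. c i *\<^sub>R f i) \<in> T" "c i *\<^sub>R f i \<in> T"
      using insert.prems by (auto intro!: subspace_sum[OF T] subspace_scale[OF T])
    then have "A (c i *\<^sub>R f i + (\<Sum>i\<in>I. c i *\<^sub>R f i)) = c i *\<^sub>R A (f i) + A (\<Sum>i\<in>I. c i *\<^sub>R f i)"
      using A insert.prems unfolding linear_on_space_def by simp
    then show ?case using insert by simp
  qed (simp add: z)
qed

text \<open>Expanding each \<open>b \<in> B\<close> in the basis \<open>C\<close> turns the left side into a double sum over \<open>B\<close> and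
  \<open>C\<close>; summing over \<open>B\<close> first recombines the coefficients of \<open>A c\<close> with respect to \<open>B\<close> into the right
  side.\<close>

lemma trace_basis_independent:
  fixes B C :: "'v::real_vector set"
  assumes A: "linear_on_space T A" "A ` T \<subseteq> T"
    and B: "independent B" "finite B" "span B = T" and C: "independent C" "finite C" "span C = T"
  shows "(\<Sum>b\<in>B. representation B (A b) b) = (\<Sum>c\<in>C. representation C (A c) c)"
proof -
  have T: "subspace T" using B(3) subspace_span by blast
  have BT: "b \<in> T" if "b \<in> B" for b using that B(3) span_base by blast
  have CT: "c \<in> T" if "c \<in> C" for c using that C(3) span_base by blast
  have AT: "A x \<in> T" if "x \<in> T" for x using that A(2) by blast
  have repB: "(\<Sum>b\<in>B. representation B v b *\<^sub>R b) = v" if "v \<in> T" for v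
    using sum_representation_eq[OF B(1), of v B] that B(2,3) by simp
  have repC: "(\<Sum>c\<in>C. representation C v c *\<^sub>R c) = v" if "v \<in> T" for v
    using sum_representation_eq[OF C(1), of v C] that C(2,3) by simp
  have rB: "representation B (\<Sum>c\<in>C. k c *\<^sub>R v c) b = (\<Sum>c\<in>C. k c * representation B (v c) b)"
    if "\<And>c. c \<in> C \<Longrightarrow> v c \<in> T" for k v b
    using that by (simp add: representation_sum[OF B(1)] representation_scale[OF B(1)] B(3)
        subspace_scale[OF T])
  have rC: "representation C (\<Sum>b\<in>B. k b *\<^sub>R v b) c = (\<Sum>b\<in>B. k b * representation C (v b) c)"
    if "\<And>b. b \<in> B \<Longrightarrow> v b \<in> T" for k v c
    using that by (simp add: representation_sum[OF C(1)] representation_scale[OF C(1)] C(3)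
        subspace_scale[OF T])
  have "representation B (A b) b = (\<Sum>c\<in>C. representation C b c * representation B (A c) b)"
    if "b \<in> B" for b
  proof -
    have "A b = A (\<Sum>c\<in>C. representation C b c *\<^sub>R c)" using repC[OF BT[OF that]] by simp
    also have "\<dots> = (\<Sum>c\<in>C. representation C b c *\<^sub>R A c)"
      by (rule linear_on_space_sum[OF A(1) T C(2) CT])
    finally show ?thesis using rB[of A] AT CT by simp
  qed
  then have "(\<Sum>b\<in>B. representation B (A b) b)
      = (\<Sum>b\<in>B. \<Sum>c\<in>C. representation C b c * representation B (A c) b)" by simp
  also have "\<dots> = (\<Sum>c\<in>C. \<Sum>b\<in>B. representation B (A c) b * representation C b c)"
    by (subst sum.swap) (simp add: mult.commute)
  also have "\<dots> = (\<Sum>c\<in>C. representation C (A c) c)"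
  proof (rule sum.cong[OF refl])
    fix c assume "c \<in> C"
    then show "(\<Sum>b\<in>B. representation B (A c) b * representation C b c) = representation C (A c) c"
      using rC[of "\<lambda>b. b" "representation B (A c)" c] repB[OF AT[OF CT]] BT by simp
  qed
  finally show ?thesis .
qed

lemma trace_on_basis:
  fixes B :: "'v::real_vector set"
  assumes A: "linear_on_space T A" "A ` T \<subseteq> T"
    and B: "independent B" "finite B" "span B = T"
  shows "trace_on T A = (\<Sum>b\<in>B. representation B (A b) b)"
proof -
  define C where "C = (SOME C. independent C \<and> span C = T)"
  have C: "independent C \<and> span C = T"
    unfolding C_def by (rule someI[of _ B]) (use B in simp)
  have "C \<subseteq> span B" using C B(3) span_superset by blast
  then have "finite C" using independent_span_bound[OF B(2)] C by blast
  then show ?thesis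
    unfolding trace_on_def C_def[symmetric] Let_def
    using trace_basis_independent[OF A _ _ _ B] C by blast
qed

section \<open>Derivatives of a self-adjoint endomorphism field\<close>

text \<open>Both \<open>(N, h, P)\<close> and \<open>(S(N), g, \<phi>)\<close> are instances. The condition \<open>A\<^sup>3 = A\<close> is the common
  consequence of \<open>P\<^sup>2 = 1\<close> and of \<open>\<phi>\<^sup>2 = 1 - \<eta> \<otimes> \<xi>\<close>; it makes \<open>(A\<^sup>2 + \<epsilon> A)/2\<close> the projection onto the
  eigenspace for \<open>\<epsilon> = \<plusminus>1\<close>.\<close>

locale levi_civita_endo = smooth_mfd M
  for M :: "('a, 'e::euclidean_space) mfd" +
  fixes g :: "'a \<Rightarrow> 'a tvec \<Rightarrow> 'a tvec \<Rightarrow> real" and A :: "'a \<Rightarrow> 'a tvec \<Rightarrow> 'a tvec"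
    and D :: "'a connection"
  assumes metric: "riemannian_metric M g" and lc: "levi_civita M g D"
    and endo: "endomorphism_field M A"
    and self_adjoint: "\<And>p x y. p \<in> pts M \<Longrightarrow> x \<in> tangent_space M p \<Longrightarrow> y \<in> tangent_space M p \<Longrightarrow>
          g p (A p x) y = g p x (A p y)"
    and cube: "\<And>p x. p \<in> pts M \<Longrightarrow> x \<in> tangent_space M p \<Longrightarrow> A p (A p (A p x)) = A p x"
begin

abbreviation "T \<equiv> tangent_space M"
abbreviation "F \<equiv> fundamental_tensor M A g D"

lemma T_lincomb: "p \<in> pts M \<Longrightarrow> u \<in> T p \<Longrightarrow> v \<in> T p \<Longrightarrow> a *\<^sub>R u + b *\<^sub>R v \<in> T p"
  using tangent_space_subspace by (simp add: subspace_add subspace_scale)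

lemma T_diff: "p \<in> pts M \<Longrightarrow> u \<in> T p \<Longrightarrow> v \<in> T p \<Longrightarrow> u - v \<in> T p"
  using tangent_space_subspace by (simp add: subspace_diff)

lemma g_sym: "p \<in> pts M \<Longrightarrow> u \<in> T p \<Longrightarrow> v \<in> T p \<Longrightarrow> g p u v = g p v u"
  using metric unfolding riemannian_metric_def by blast

lemma g_lincomb_right:
  assumes "p \<in> pts M" "u \<in> T p" "v \<in> T p" "w \<in> T p"
  shows "g p u (a *\<^sub>R v + b *\<^sub>R w) = a * g p u v + b * g p u w"
proof -
  have "linear_on_space (T p) (g p u)"
    using metric assms unfolding riemannian_metric_def by blast
  moreover have "a *\<^sub>R v \<in> T p" "b *\<^sub>R w \<in> T p"
    using tangent_space_subspace assms by (simp_all add: subspace_scale)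
  ultimately show ?thesis using assms unfolding linear_on_space_def by simp
qed

lemma g_lincomb_left:
  assumes "p \<in> pts M" "u \<in> T p" "v \<in> T p" "w \<in> T p"
  shows "g p (a *\<^sub>R v + b *\<^sub>R w) u = a * g p v u + b * g p w u"
  using g_lincomb_right[OF assms, of a b] g_sym[of p _ u] T_lincomb assms by simp

lemma g_diff_left:
  assumes "p \<in> pts M" "u \<in> T p" "v \<in> T p" "w \<in> T p"
  shows "g p (v - w) u = g p v u - g p w u"
  using g_lincomb_left[OF assms, of 1 "-1"] by simp

lemma g_scale_left: "p \<in> pts M \<Longrightarrow> u \<in> T p \<Longrightarrow> v \<in> T p \<Longrightarrow> g p (a *\<^sub>R v) u = a * g p v u"
  using g_lincomb_left[of p u v v a 0] by simp

lemma g_scale_right: "p \<in> pts M \<Longrightarrow> u \<in> T p \<Longrightarrow> v \<in> T p \<Longrightarrow> g p u (a *\<^sub>R v) = a * g p u v"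
  using g_lincomb_right[of p u v v a 0] by simp

lemma g_nondegenerate:
  assumes "p \<in> pts M" "u \<in> T p" "\<And>z. z \<in> T p \<Longrightarrow> g p u z = 0"
  shows "u = 0"
  using metric assms unfolding riemannian_metric_def by (metis less_irrefl)

lemma g_smooth:
  assumes "vector_field_on M U X" "vector_field_on M U Y"
  shows "smooth_fun_on M U (\<lambda>p. g p (X p) (Y p))"
  using metric[unfolded riemannian_metric_def, THEN conjunct2, rule_format, OF assms] .

lemma A_mem: "p \<in> pts M \<Longrightarrow> x \<in> T p \<Longrightarrow> A p x \<in> T p"
  using endo unfolding endomorphism_field_def by blast

lemma A_lincomb:
  assumes "p \<in> pts M" "u \<in> T p" "v \<in> T p"
  shows "A p (a *\<^sub>R u + b *\<^sub>R v) = a *\<^sub>R A p u + b *\<^sub>R A p v"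
proof -
  have "linear_on_space (T p) (A p)" using endo assms unfolding endomorphism_field_def by blast
  moreover have "a *\<^sub>R u \<in> T p" "b *\<^sub>R v \<in> T p"
    using tangent_space_subspace assms by (simp_all add: subspace_scale)
  ultimately show ?thesis using assms unfolding linear_on_space_def by simp
qed

lemma A_field: "vector_field_on M U Y \<Longrightarrow> vector_field_on M U (\<lambda>q. A q (Y q))"
  using endo unfolding endomorphism_field_def by blast

subsection \<open>The connection\<close>

lemma connection: "affine_connection M D"
  using lc unfolding levi_civita_def by blast

lemma D_mem: "vector_field_on M U Y \<Longrightarrow> p \<in> U \<Longrightarrow> v \<in> T p \<Longrightarrow> D p v Y \<in> T p"
  using connection unfolding affine_connection_def by blast

lemma D_leibniz:
  assumes "vector_field_on M U Y" "p \<in> U" "v \<in> T p" "smooth_fun_on M U f"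
  shows "D p v (\<lambda>q. f q *\<^sub>R Y q) = v f *\<^sub>R Y p + f p *\<^sub>R D p v Y"
proof -
  from connection assms(1-3) have "\<forall>f. smooth_fun_on M U f \<longrightarrow>
      D p v (\<lambda>q. f q *\<^sub>R Y q) = v f *\<^sub>R Y p + f p *\<^sub>R D p v Y"
    unfolding affine_connection_def by presburger
  then show ?thesis using assms(4) by simp
qed

lemma D_lincomb_direction:
  assumes "vector_field_on M U Y" "p \<in> U" "u \<in> T p" "v \<in> T p"
  shows "D p (a *\<^sub>R u + b *\<^sub>R v) Y = a *\<^sub>R D p u Y + b *\<^sub>R D p v Y"
proof -
  have "linear_on_space (T p) (\<lambda>v. D p v Y)"
    using connection assms unfolding affine_connection_def by blast
  moreover have "a *\<^sub>R u \<in> T p" "b *\<^sub>R v \<in> T p"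
    using tangent_space_subspace[OF vector_field_on_pts[OF assms(1,2)]] assms
    by (simp_all add: subspace_scale)
  ultimately show ?thesis using assms unfolding linear_on_space_def by simp
qed

text \<open>The indicator function of \<open>U\<close> is smooth on \<open>U\<close>, has derivative \<open>0\<close> at \<open>p\<close>, and multiplication by
  it makes \<open>Y\<close> and \<open>Y'\<close> equal as total functions. So the Leibniz rule gives locality.\<close>

lemma D_local:
  assumes Y: "vector_field_on M U Y" and p: "p \<in> U" and v: "v \<in> T p"
    and eq: "\<And>q. q \<in> U \<Longrightarrow> Y q = Y' q"
  shows "D p v Y = D p v Y'"
proof -
  define ind :: "'a \<Rightarrow> real" where "ind q = (if q \<in> U then 1 else 0)" for q
  have U: "openin (mtop M) U" using vector_field_on_openin[OF Y] .
  have ind: "smooth_fun_on M U ind"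
    by (rule smooth_fun_on_cong[OF smooth_fun_on_const[OF U, of 1]]) (simp add: ind_def)
  have pM: "p \<in> pts M" using vector_field_on_pts[OF Y p] .
  have "v ind = v (\<lambda>q. 1)"
    by (rule tangent_vec_local[OF pM v U p]) (simp add: ind_def)
  then have 0: "v ind = 0" using tangent_vec_const[OF pM v] by simp
  have Y': "vector_field_on M U Y'" using vector_field_on_cong[OF Y eq] .
  have "D p v Y = D p v (\<lambda>q. ind q *\<^sub>R Y q)"
    using D_leibniz[OF Y p v ind] 0 p by (simp add: ind_def)
  also have "(\<lambda>q. ind q *\<^sub>R Y q) = (\<lambda>q. ind q *\<^sub>R Y' q)" using eq by (auto simp: ind_def)
  also have "D p v (\<lambda>q. ind q *\<^sub>R Y' q) = D p v Y'"
    using D_leibniz[OF Y' p v ind] 0 p by (simp add: ind_def)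
  finally show ?thesis .
qed

lemma D_scale:
  assumes Y: "vector_field_on M U Y" and p: "p \<in> U" and v: "v \<in> T p"
  shows "D p v (\<lambda>q. r *\<^sub>R Y q) = r *\<^sub>R D p v Y"
  using D_leibniz[OF Y p v smooth_fun_on_const[OF vector_field_on_openin[OF Y], of r]]
    tangent_vec_const[OF vector_field_on_pts[OF Y p] v, of r] by simp

lemma D_torsion:
  assumes "vector_field_on M U X" "vector_field_on M U Y" "p \<in> U"
  shows "D p (X p) Y = D p (Y p) X + lie_bracket M X Y p"
proof -
  have "D p (X p) Y - D p (Y p) X = lie_bracket M X Y p"
    using lc assms unfolding levi_civita_def by blast
  then show ?thesis by (simp add: algebra_simps)
qed

lemma D_metric:
  assumes "vector_field_on M U Y" "vector_field_on M U Z" "p \<in> U" "v \<in> T p"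
  shows "v (\<lambda>q. g q (Y q) (Z q)) = g p (D p v Y) (Z p) + g p (Y p) (D p v Z)"
  using lc assms unfolding levi_civita_def by blast

lemma lie_bracket_tangent:
  assumes "vector_field_on M U X" "vector_field_on M U Y" "p \<in> U"
  shows "lie_bracket M X Y p \<in> T p"
proof -
  have "lie_bracket M X Y p = D p (X p) Y - D p (Y p) X"
    using D_torsion[OF assms] by simp
  then show ?thesis
    using D_mem[OF assms(2,3) vector_field_on_tangent[OF assms(1,3)]]
      D_mem[OF assms(1,3) vector_field_on_tangent[OF assms(2,3)]]
      T_diff[OF vector_field_on_pts[OF assms(1,3)]] by simp
qed

subsection \<open>The fundamental tensor\<close>

text \<open>The covariant derivative of \<open>A\<close>, applied to a vector field instead of a vector.\<close>

definition nab :: "'a \<Rightarrow> 'a tvec \<Rightarrow> ('a \<Rightarrow> 'a tvec) \<Rightarrow> 'a tvec" where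
  "nab p x Y = D p x (\<lambda>q. A q (Y q)) - A p (D p x Y)"

lemma nab_mem:
  assumes "vector_field_on M U Y" "p \<in> U" "x \<in> T p" shows "nab p x Y \<in> T p"
  unfolding nab_def
  using D_mem[OF A_field[OF assms(1)] assms(2,3)] D_mem[OF assms] A_mem T_diff
    vector_field_on_pts[OF assms(1,2)] by blast

text \<open>Differentiate \<open>g(A Y, Z) = g(Y, A Z)\<close>. The left side depends on \<open>Z\<close> through its value at \<open>p\<close> only
  and the right side on \<open>Y\<close> through its value at \<open>p\<close> only. This gives both the tensoriality of
  \<open>\<nabla> A\<close> and the symmetry of the fundamental tensor.\<close>

lemma nab_self_adjoint:
  assumes Y: "vector_field_on M U Y" and Z: "vector_field_on M U Z" and p: "p \<in> U" and x: "x \<in> T p"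
  shows "g p (nab p x Y) (Z p) = g p (Y p) (nab p x Z)"
proof -
  have pM: "p \<in> pts M" using vector_field_on_pts[OF Y p] .
  note AY = A_field[OF Y] and AZ = A_field[OF Z]
  note m = vector_field_on_tangent[OF Y p] vector_field_on_tangent[OF Z p]
    vector_field_on_tangent[OF AY p] vector_field_on_tangent[OF AZ p]
    D_mem[OF Y p x] D_mem[OF Z p x] D_mem[OF AY p x] D_mem[OF AZ p x]
    A_mem[OF pM D_mem[OF Y p x]] A_mem[OF pM D_mem[OF Z p x]]
  have "x (\<lambda>q. g q (A q (Y q)) (Z q)) = x (\<lambda>q. g q (Y q) (A q (Z q)))"
    by (rule tangent_vec_local[OF pM x vector_field_on_openin[OF Y] p])
       (use self_adjoint vector_field_on_pts[OF Y] vector_field_on_tangent[OF Y]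
          vector_field_on_tangent[OF Z] in simp)
  then have "g p (D p x (\<lambda>q. A q (Y q))) (Z p) + g p (A p (Y p)) (D p x Z)
      = g p (D p x Y) (A p (Z p)) + g p (Y p) (D p x (\<lambda>q. A q (Z q)))"
    unfolding D_metric[OF AY Z p x] D_metric[OF Y AZ p x] .
  moreover have "g p (A p (Y p)) (D p x Z) = g p (Y p) (A p (D p x Z))"
      "g p (A p (D p x Y)) (Z p) = g p (D p x Y) (A p (Z p))"
    using self_adjoint[OF pM] m by simp_all
  moreover have "g p (Y p) (nab p x Z) = g p (Y p) (D p x (\<lambda>q. A q (Z q))) - g p (Y p) (A p (D p x Z))"
    using g_diff_left[OF pM m(1) m(8) m(10)] g_sym[OF pM m(1)] m T_diff[OF pM m(8) m(10)]
    by (simp add: nab_def)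
  moreover have "g p (nab p x Y) (Z p) = g p (D p x (\<lambda>q. A q (Y q))) (Z p) - g p (A p (D p x Y)) (Z p)"
    using g_diff_left[OF pM m(2) m(7) m(9)] by (simp add: nab_def)
  ultimately show ?thesis by linarith
qed

text \<open>The definition of \<^const>\<open>cov_deriv_endo\<close> chooses some extension of \<open>Y p\<close>. By self-adjointness its
  product with any \<open>z\<close> is \<open>g(Y p, (\<nabla>\<^sub>x A) Z)\<close> for an extension \<open>Z\<close> of \<open>z\<close>, whatever the choice.\<close>

lemma cov_deriv_endo_eq_nab:
  assumes Y: "vector_field_on M U Y" and p: "p \<in> U" and x: "x \<in> T p"
  shows "cov_deriv_endo M D A p x (Y p) = nab p x Y"
proof -
  have pM: "p \<in> pts M" using vector_field_on_pts[OF Y p] .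
  define Y' where "Y' = (SOME Y'. Y' p = Y p \<and> (\<exists>U. p \<in> U \<and> vector_field_on M U Y'))"
  have "Y' p = Y p \<and> (\<exists>U. p \<in> U \<and> vector_field_on M U Y')"
    unfolding Y'_def by (rule someI[of _ Y]) (use Y p in blast)
  then obtain U' where Y': "Y' p = Y p" "p \<in> U'" "vector_field_on M U' Y'" by blast
  have "nab p x Y' - nab p x Y = 0"
  proof (rule g_nondegenerate[OF pM])
    note mem = nab_mem[OF Y'(3,2) x] nab_mem[OF Y p x]
    show "nab p x Y' - nab p x Y \<in> T p" using T_diff[OF pM mem] .
    fix z assume z: "z \<in> T p"
    obtain W Z where Z: "p \<in> W" "vector_field_on M W Z" "Z p = z"
      using tangent_vec_extend[OF pM z] by blast
    define V where "V = U \<inter> U' \<inter> W"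
    have V: "openin (mtop M) V" "p \<in> V" "V \<subseteq> U" "V \<subseteq> U'" "V \<subseteq> W"
      using vector_field_on_openin[OF Y] vector_field_on_openin[OF Y'(3)]
        vector_field_on_openin[OF Z(2)] p Y'(2) Z(1) unfolding V_def by auto
    note YV = vector_field_on_subset[OF Y V(1,3)] and Y'V = vector_field_on_subset[OF Y'(3) V(1,4)]
      and ZV = vector_field_on_subset[OF Z(2) V(1,5)]
    have "g p (nab p x Y') z = g p (nab p x Y) z"
      using nab_self_adjoint[OF YV ZV V(2) x] nab_self_adjoint[OF Y'V ZV V(2) x] Y'(1) Z(3) by simp
    then show "g p (nab p x Y' - nab p x Y) z = 0" using g_diff_left[OF pM z mem] by simp
  qed
  then show ?thesis unfolding cov_deriv_endo_def Let_def Y'_def[symmetric] by (simp add: nab_def)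
qed

lemma F_field:
  assumes "vector_field_on M U Y" "p \<in> U" "x \<in> T p"
  shows "F p x (Y p) z = g p (nab p x Y) z"
  unfolding fundamental_tensor_def cov_deriv_endo_eq_nab[OF assms] ..

lemma cov_deriv_endo_mem:
  assumes "p \<in> pts M" "x \<in> T p" "y \<in> T p" shows "cov_deriv_endo M D A p x y \<in> T p"
proof -
  obtain U Y where Y: "p \<in> U" "vector_field_on M U Y" "Y p = y"
    using tangent_vec_extend[OF assms(1,3)] by blast
  show ?thesis using cov_deriv_endo_eq_nab[OF Y(2,1) assms(2)] nab_mem[OF Y(2,1) assms(2)] Y(3) by simp
qed

lemma F_sym:
  assumes "p \<in> pts M" "x \<in> T p" "y \<in> T p" "z \<in> T p" shows "F p x y z = F p x z y"
proof -
  obtain U Y where Y: "p \<in> U" "vector_field_on M U Y" "Y p = y"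
    using tangent_vec_extend[OF assms(1,3)] by blast
  obtain W Z where Z: "p \<in> W" "vector_field_on M W Z" "Z p = z"
    using tangent_vec_extend[OF assms(1,4)] by blast
  have V: "openin (mtop M) (U \<inter> W)" "p \<in> U \<inter> W"
    using vector_field_on_openin[OF Y(2)] vector_field_on_openin[OF Z(2)] Y Z by auto
  note YV = vector_field_on_subset[OF Y(2) V(1)] and ZV = vector_field_on_subset[OF Z(2) V(1)]
  have "F p x y z = g p (nab p x Y) (Z p)" using F_field[OF Y(2,1) assms(2)] Y Z by simp
  also have "\<dots> = g p (Y p) (nab p x Z)" using nab_self_adjoint[OF YV ZV V(2) assms(2)] by simp
  also have "\<dots> = g p (nab p x Z) (Y p)"
    using g_sym[OF assms(1)] nab_mem[OF Z(2,1) assms(2)] Y(3) assms(3) by simp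
  also have "\<dots> = F p x z y" using F_field[OF Z(2,1) assms(2)] Y Z by simp
  finally show ?thesis .
qed

lemma F_lincomb3:
  assumes "p \<in> pts M" "x \<in> T p" "y \<in> T p" "u \<in> T p" "v \<in> T p"
  shows "F p x y (a *\<^sub>R u + b *\<^sub>R v) = a * F p x y u + b * F p x y v"
  unfolding fundamental_tensor_def using g_lincomb_right cov_deriv_endo_mem assms by simp

lemma F_lincomb2:
  assumes "p \<in> pts M" "x \<in> T p" "u \<in> T p" "v \<in> T p" "z \<in> T p"
  shows "F p x (a *\<^sub>R u + b *\<^sub>R v) z = a * F p x u z + b * F p x v z"
  using F_lincomb3[OF assms(1,2,5,3,4), of a b] F_sym[OF assms(1,2) _ assms(5)]
    T_lincomb[OF assms(1,3,4)] assms by simp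

lemma F_lincomb1:
  assumes "p \<in> pts M" "u \<in> T p" "v \<in> T p" "y \<in> T p" "z \<in> T p"
  shows "F p (a *\<^sub>R u + b *\<^sub>R v) y z = a * F p u y z + b * F p v y z"
proof -
  obtain U Y where Y: "p \<in> U" "vector_field_on M U Y" "Y p = y"
    using tangent_vec_extend[OF assms(1,4)] by blast
  note AY = A_field[OF Y(2)]
  note m = D_mem[OF Y(2,1)] D_mem[OF AY Y(1)]
  have "nab p (a *\<^sub>R u + b *\<^sub>R v) Y = a *\<^sub>R nab p u Y + b *\<^sub>R nab p v Y"
    unfolding nab_def D_lincomb_direction[OF Y(2,1) assms(2,3)] D_lincomb_direction[OF AY Y(1) assms(2,3)]
      A_lincomb[OF assms(1) m(1)[OF assms(2)] m(1)[OF assms(3)]]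
    by (simp add: scaleR_diff_right)
  then show ?thesis
    using F_field[OF Y(2,1)] T_lincomb assms Y(3) nab_mem[OF Y(2,1)] g_lincomb_left by simp
qed

text \<open>Apply the projection \<open>(A\<^sup>2 + \<epsilon> A)/2\<close> to an arbitrary extension.\<close>

lemma eigenvector_extend:
  assumes "p \<in> pts M" "y \<in> T p" "A p y = \<epsilon> *\<^sub>R y" "\<epsilon> * \<epsilon> = 1"
  obtains U Y where "p \<in> U" "vector_field_on M U Y" "Y p = y"
    "\<And>q. q \<in> U \<Longrightarrow> A q (Y q) = \<epsilon> *\<^sub>R Y q"
proof -
  obtain U X where X: "p \<in> U" "vector_field_on M U X" "X p = y"
    using tangent_vec_extend[OF assms(1,2)] by blast
  define Y where "Y q = (1/2) *\<^sub>R A q (A q (X q)) + (\<epsilon>/2) *\<^sub>R A q (X q)" for q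
  note AX = A_field[OF X(2)] and AAX = A_field[OF A_field[OF X(2)]]
  have "vector_field_on M U Y" unfolding Y_def by (rule vector_field_on_lincomb[OF AAX AX])
  moreover have "Y p = y"
  proof -
    have "A p (\<epsilon> *\<^sub>R y) = (\<epsilon> * \<epsilon>) *\<^sub>R y"
      using A_lincomb[OF assms(1,2,2), of \<epsilon> 0] assms(3) by simp
    then show ?thesis using assms X(3) by (simp add: Y_def flip: scaleR_left_distrib)
  qed
  moreover have "A q (Y q) = \<epsilon> *\<^sub>R Y q" if q: "q \<in> U" for q
  proof -
    have "A q (Y q) = (1/2) *\<^sub>R A q (A q (A q (X q))) + (\<epsilon>/2) *\<^sub>R A q (A q (X q))"
      unfolding Y_def
      by (rule A_lincomb[OF vector_field_on_pts[OF X(2) q] vector_field_on_tangent[OF AAX q]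
            vector_field_on_tangent[OF AX q]])
    also have "\<dots> = (1/2) *\<^sub>R A q (X q) + (\<epsilon>/2) *\<^sub>R A q (A q (X q))"
      using cube[OF vector_field_on_pts[OF X(2) q] vector_field_on_tangent[OF X(2) q]] by simp
    also have "\<dots> = \<epsilon> *\<^sub>R Y q"
      using assms(4) by (simp add: Y_def scaleR_right_distrib)
    finally show ?thesis .
  qed
  ultimately show thesis using that X(1) by blast
qed

lemma nab_eigenfield:
  assumes Y: "vector_field_on M U Y" and p: "p \<in> U" and x: "x \<in> T p"
    and e: "\<And>q. q \<in> U \<Longrightarrow> A q (Y q) = \<epsilon> *\<^sub>R Y q"
  shows "nab p x Y = \<epsilon> *\<^sub>R D p x Y - A p (D p x Y)"
  unfolding nab_def using D_local[OF A_field[OF Y] p x e] D_scale[OF Y p x] by simp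

text \<open>Here \<open>(\<nabla>\<^sub>x A) Y = \<epsilon> \<nabla>\<^sub>x Y - A (\<nabla>\<^sub>x Y)\<close>, and in the product with \<open>z\<close> the operator \<open>A\<close> can be moved
  to \<open>z\<close>.\<close>

lemma F_eigenfield:
  assumes Y: "vector_field_on M U Y" and p: "p \<in> U" and x: "x \<in> T p" and z: "z \<in> T p"
    and e: "\<And>q. q \<in> U \<Longrightarrow> A q (Y q) = \<epsilon> *\<^sub>R Y q" and d: "A p z = \<delta> *\<^sub>R z"
  shows "F p x (Y p) z = (\<epsilon> - \<delta>) * g p (D p x Y) z"
proof -
  have pM: "p \<in> pts M" using vector_field_on_pts[OF Y p] .
  note m = D_mem[OF Y p x]
  have s: "\<epsilon> *\<^sub>R D p x Y \<in> T p" using T_lincomb[OF pM m m, of \<epsilon> 0] by simp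
  have "F p x (Y p) z = g p (\<epsilon> *\<^sub>R D p x Y - A p (D p x Y)) z"
    using F_field[OF Y p x] nab_eigenfield[OF Y p x e] by simp
  also have "\<dots> = \<epsilon> * g p (D p x Y) z - g p (D p x Y) (A p z)"
    using g_diff_left[OF pM z s A_mem[OF pM m]] g_scale_left[OF pM z m] self_adjoint[OF pM m z] by simp
  also have "\<dots> = (\<epsilon> - \<delta>) * g p (D p x Y) z"
    using g_scale_right[OF pM m z] d by (simp add: algebra_simps)
  finally show ?thesis .
qed

lemma F_eigenvector_diag:
  assumes "p \<in> pts M" "x \<in> T p" "y \<in> T p" "A p y = \<epsilon> *\<^sub>R y" "\<epsilon> * \<epsilon> = 1"
  shows "F p x y y = 0"
proof -
  obtain U Y where Y: "p \<in> U" "vector_field_on M U Y" "Y p = y" "\<And>q. q \<in> U \<Longrightarrow> A q (Y q) = \<epsilon> *\<^sub>R Y q"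
    using eigenvector_extend[OF assms(1,3,4,5)] by blast
  show ?thesis using F_eigenfield[OF Y(2,1) assms(2,3) Y(4) assms(4)] Y(3) by simp
qed

lemma eigenvectors_orthogonal:
  assumes "p \<in> pts M" "y \<in> T p" "z \<in> T p" "A p y = \<epsilon> *\<^sub>R y" "A p z = - \<epsilon> *\<^sub>R z" "\<epsilon> \<noteq> 0"
  shows "g p y z = 0"
proof -
  have "\<epsilon> * g p y z = - \<epsilon> * g p y z"
    using self_adjoint[OF assms(1,2,3)] g_scale_left[OF assms(1,3,2)] g_scale_right[OF assms(1,2,3), of "-\<epsilon>"]
      assms(4,5) by simp
  then show ?thesis using assms(6) by simp
qed

text \<open>This is the Koszul formula for \<open>2 \<epsilon> g(\<nabla>\<^sub>Y Y, Z)\<close>. The right side involves the metric on the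
  eigenspace of \<open>\<epsilon>\<close> only, because \<open>Y\<close> lies in it.\<close>

lemma F_eigenfields_mixed:
  assumes Y: "vector_field_on M U Y" and Z: "vector_field_on M U Z" and p: "p \<in> U"
    and eY: "\<And>q. q \<in> U \<Longrightarrow> A q (Y q) = \<epsilon> *\<^sub>R Y q" and eZ: "\<And>q. q \<in> U \<Longrightarrow> A q (Z q) = - \<epsilon> *\<^sub>R Z q"
    and e: "\<epsilon> \<noteq> 0"
  shows "F p (Y p) (Y p) (Z p)
    = - \<epsilon> * (2 * g p (Y p) (lie_bracket M Y Z p) + Z p (\<lambda>q. g q (Y q) (Y q)))"
proof -
  have pM: "p \<in> pts M" using vector_field_on_pts[OF Y p] .
  note y = vector_field_on_tangent[OF Y p] and z = vector_field_on_tangent[OF Z p]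
  note br = lie_bracket_tangent[OF Y Z p] and DZY = D_mem[OF Y p z]
  have "Y p (\<lambda>q. g q (Y q) (Z q)) = Y p (\<lambda>q. 0)"
    by (rule tangent_vec_local[OF pM y vector_field_on_openin[OF Y] p],
        rule eigenvectors_orthogonal[OF _ _ _ eY eZ e])
       (use vector_field_on_pts[OF Y] vector_field_on_tangent[OF Y] vector_field_on_tangent[OF Z] in auto)
  then have "g p (D p (Y p) Y) (Z p) + g p (Y p) (D p (Y p) Z) = 0"
    using D_metric[OF Y Z p y] tangent_vec_const[OF pM y] by simp
  moreover have "g p (Y p) (D p (Y p) Z) = g p (Y p) (D p (Z p) Y) + g p (Y p) (lie_bracket M Y Z p)"
    using g_lincomb_right[OF pM y DZY br, of 1 1] D_torsion[OF Y Z p] by simp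
  moreover have "Z p (\<lambda>q. g q (Y q) (Y q)) = 2 * g p (Y p) (D p (Z p) Y)"
    using D_metric[OF Y Y p z] g_sym[OF pM y DZY] by simp
  ultimately have "2 * g p (D p (Y p) Y) (Z p)
      = - (2 * g p (Y p) (lie_bracket M Y Z p) + Z p (\<lambda>q. g q (Y q) (Y q)))" by simp
  moreover have "F p (Y p) (Y p) (Z p) = \<epsilon> * (2 * g p (D p (Y p) Y) (Z p))"
    using F_eigenfield[OF Y p y z eY eZ[OF p]] by simp
  ultimately show ?thesis by (simp only: mult_minus_left mult_minus_right)
qed

end

section \<open>The product manifold \<open>\<real>\<^sup>+ \<times> N\<close>\<close>

lemma second_countable_top_of_set:
  "second_countable (top_of_set (S :: 'b::second_countable_topology set))"
proof (rule second_countable_subtopology)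
  obtain \<B> :: "'b set set" where B: "countable \<B>" "topological_basis \<B>"
    using ex_countable_basis by blast
  show "second_countable (euclidean :: 'b topology)"
    unfolding second_countable_def
  proof (intro exI[of _ \<B>] conjI allI impI ballI B(1))
    show "openin euclidean V" if "V \<in> \<B>" for V
      using that topological_basis_open[OF B(2)] by simp
    show "\<exists>V\<in>\<B>. x \<in> V \<and> V \<subseteq> U" if "openin euclidean U \<and> x \<in> U" for U x
      using that topological_basisE[OF B(2), of U x] by (metis open_openin)
  qed
qed

lemma second_countable_prod_topology:
  assumes "second_countable X" "second_countable Y"
  shows "second_countable (prod_topology X Y)"
proof -
  obtain \<A> where A: "countable \<A>" "\<forall>V\<in>\<A>. openin X V"
      "\<forall>U x. openin X U \<and> x \<in> U \<longrightarrow> (\<exists>V\<in>\<A>. x \<in> V \<and> V \<subseteq> U)"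
    using assms(1) unfolding second_countable_def by (elim exE conjE)
  obtain \<B> where B: "countable \<B>" "\<forall>V\<in>\<B>. openin Y V"
      "\<forall>U x. openin Y U \<and> x \<in> U \<longrightarrow> (\<exists>V\<in>\<B>. x \<in> V \<and> V \<subseteq> U)"
    using assms(2) unfolding second_countable_def by (elim exE conjE)
  show ?thesis
    unfolding second_countable_def
  proof (intro exI[of _ "(\<lambda>(V, W). V \<times> W) ` (\<A> \<times> \<B>)"] conjI ballI allI impI)
    show "countable ((\<lambda>(V, W). V \<times> W) ` (\<A> \<times> \<B>))" using A(1) B(1) by simp
    show "openin (prod_topology X Y) Z" if "Z \<in> (\<lambda>(V, W). V \<times> W) ` (\<A> \<times> \<B>)" for Z
      using that A(2) B(2) by (auto simp: openin_prod_Times_iff)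
    fix U z assume U: "openin (prod_topology X Y) U \<and> z \<in> U"
    obtain z1 z2 where z: "z = (z1, z2)" by (cases z)
    have "(z1, z2) \<in> U" using conjunct2[OF U] unfolding z .
    from openin_prod_topology_alt[THEN iffD1, OF conjunct1[OF U], rule_format, OF this]
    obtain U1 U2 where U12: "openin X U1" "openin Y U2" "z1 \<in> U1" "z2 \<in> U2" "U1 \<times> U2 \<subseteq> U"
      by (elim exE conjE)
    obtain V where V: "V \<in> \<A>" "z1 \<in> V" "V \<subseteq> U1" using A(3) U12(1,3) by blast
    obtain W where W: "W \<in> \<B>" "z2 \<in> W" "W \<subseteq> U2" using B(3) U12(2,4) by blast
    have "z \<in> V \<times> W" "V \<times> W \<subseteq> U" using V W U12(5) by (auto simp: z)
    moreover have "V \<times> W \<in> (\<lambda>(V, W). V \<times> W) ` (\<A> \<times> \<B>)"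
      by (rule image_eqI[of _ _ "(V, W)"]) (use V(1) W(1) in auto)
    ultimately show "\<exists>Z\<in>(\<lambda>(V, W). V \<times> W) ` (\<A> \<times> \<B>). z \<in> Z \<and> Z \<subseteq> U"
      by (intro bexI[of _ "V \<times> W"] conjI)
  qed
qed

lemma S_atlas_iff:
  "(X, C) \<in> atlas (S_mfd N) \<longleftrightarrow> (\<exists>V c. (V, c) \<in> atlas N \<and> X = {0<..} \<times> V \<and> C = (\<lambda>(t, q). (t, c q)))"
  by (auto simp: S_mfd_def)

lemma S_top: "mtop (S_mfd N) = prod_topology (top_of_set {0<..}) (mtop N)"
  by (simp add: S_mfd_def)

lemma S_pts: "pts (S_mfd N) = {0<..} \<times> pts N"
  by (simp add: S_mfd_def)

context smooth_mfd
begin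

abbreviation "Sc c \<equiv> (\<lambda>(t::real, q). (t, c q))"

lemma S_chart_inj: "(V, c) \<in> atlas M \<Longrightarrow> inj_on (Sc c) ({0<..} \<times> V)"
  using chart_inj by (auto simp: inj_on_def)

lemma S_chart_image: "Sc c ` (A \<times> V) = A \<times> c ` V"
  by auto

lemma S_inv_into:
  assumes V: "(V, c) \<in> atlas M" and "t > 0" "x \<in> c ` V"
  shows "inv_into ({0<..} \<times> V) (Sc c) (t, x) = (t, inv_into V c x)"
proof -
  have "(t, inv_into V c x) \<in> {0<..} \<times> V" "Sc c (t, inv_into V c x) = (t, x)"
    using assms by (auto simp: inv_into_into f_inv_into_f)
  then show ?thesis using inv_into_f_eq[OF S_chart_inj[OF V]] by blast
qed

lemma S_openin_Times: "openin (mtop M) V \<Longrightarrow> openin (mtop (S_mfd M)) ({0<..} \<times> V)"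
  by (simp add: S_top openin_prod_Times_iff)

lemma S_smooth_manifold: "smooth_manifold (S_mfd M)"
  unfolding smooth_manifold_def
proof (intro conjI ballI; (clarify)?)
  have H: "Hausdorff_space (mtop M)" "second_countable (mtop M)"
    using smooth_manifold unfolding smooth_manifold_def by auto
  have "Hausdorff_space (top_of_set {0::real<..})"
    by (intro Hausdorff_space_subtopology Hausdorff_space_euclidean)
  then show "Hausdorff_space (mtop (S_mfd M))"
    unfolding S_top Hausdorff_space_prod_topology using H(1) by blast
  show "second_countable (mtop (S_mfd M))"
    unfolding S_top using second_countable_prod_topology second_countable_top_of_set H(2) by blast
  show "(\<Union>(X, C)\<in>atlas (S_mfd M). X) = pts (S_mfd M)"
  proof (rule equalityI; rule subsetI)
    fix x assume "x \<in> (\<Union>(X, C)\<in>atlas (S_mfd M). X)"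
    then obtain X C where "(X, C) \<in> atlas (S_mfd M)" "x \<in> X" by auto
    then obtain V c where "(V, c) \<in> atlas M" "x \<in> {0<..} \<times> V" unfolding S_atlas_iff by metis
    then show "x \<in> pts (S_mfd M)" unfolding S_pts using chart_subset by auto
  next
    fix x assume "x \<in> pts (S_mfd M)"
    then have x: "fst x > 0" "snd x \<in> pts M" unfolding S_pts by auto
    obtain V c where "(V, c) \<in> atlas M" "snd x \<in> V" using chart_cover[OF x(2)] by blast
    then have "({0<..} \<times> V, Sc c) \<in> atlas (S_mfd M)" "x \<in> {0<..} \<times> V"
      using x(1) S_atlas_iff[of "{0<..} \<times> V" "Sc c" M] by (blast, simp add: mem_Times_iff)
    then show "x \<in> (\<Union>(X, C)\<in>atlas (S_mfd M). X)" by (intro UN_I[of "({0<..} \<times> V, Sc c)"]) simp_all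
  qed
next
  fix X C assume "(X, C) \<in> atlas (S_mfd M)"
  then obtain V c where V: "(V, c) \<in> atlas M" and X: "X = {0<..} \<times> V" and C: "C = Sc c"
    unfolding S_atlas_iff by blast
  have 1: "openin (mtop (S_mfd M)) X" unfolding X using S_openin_Times chart_openin[OF V] by blast
  have 2: "open (C ` X)" unfolding X C S_chart_image using chart_open_image[OF V]
    by (simp add: open_Times)
  obtain c' where c': "homeomorphic_maps (subtopology (mtop M) V) (top_of_set (c ` V)) c c'"
    using chart_homeo[OF V] unfolding homeomorphic_map_maps by blast
  have "homeomorphic_maps (top_of_set {0<..}) (top_of_set {0::real<..}) (\<lambda>x. x) (\<lambda>x. x)"
    by (simp add: homeomorphic_maps_def)
  then have "homeomorphic_maps (prod_topology (top_of_set {0<..}) (subtopology (mtop M) V))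
      (prod_topology (top_of_set {0<..}) (top_of_set (c ` V))) (Sc c) (Sc c')"
    using c' homeomorphic_maps_prod[of "top_of_set {0::real<..}" "subtopology (mtop M) V"
        "top_of_set {0<..}" "top_of_set (c ` V)" "\<lambda>t. t" c "\<lambda>t. t" c'] by simp
  then have "homeomorphic_map (prod_topology (top_of_set {0<..}) (subtopology (mtop M) V))
      (prod_topology (top_of_set {0<..}) (top_of_set (c ` V))) (Sc c)"
    unfolding homeomorphic_map_maps by blast
  moreover have "subtopology (mtop (S_mfd M)) X = prod_topology (top_of_set {0<..}) (subtopology (mtop M) V)"
    unfolding S_top X subtopology_Times by (simp add: subtopology_subtopology)
  ultimately have "homeomorphic_map (subtopology (mtop (S_mfd M)) X) (top_of_set (C ` X)) C"
    unfolding X C S_chart_image by simp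
  with 1 2 show "openin (mtop (S_mfd M)) X \<and> open (C ` X) \<and>
      homeomorphic_map (subtopology (mtop (S_mfd M)) X) (top_of_set (C ` X)) C"
    by (intro conjI)
next
  fix X C X' C' assume "(X, C) \<in> atlas (S_mfd M)" "(X', C') \<in> atlas (S_mfd M)"
  then obtain V c V' c' where V: "(V, c) \<in> atlas M" "(V', c') \<in> atlas M"
    and X: "X = {0<..} \<times> V" "X' = {0<..} \<times> V'" and C: "C = Sc c" "C' = Sc c'"
    unfolding S_atlas_iff by blast
  have eq: "C ` (X \<inter> X') = {0<..} \<times> c ` (V \<inter> V')"
    unfolding X C by (auto simp: Times_Int_Times S_chart_image)
  have o: "open ({0::real<..} \<times> c ` (V \<inter> V'))"
    using chart_image_open[OF V(1) chart_openin[OF V(2)]] by (simp add: open_Times Int_commute)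
  have "smooth_on ({0::real<..} \<times> c ` (V \<inter> V')) (\<lambda>x. (fst x, (c' \<circ> inv_into V c) (snd x)))"
  proof (rule smooth_on_Pair[OF o])
    show "smooth_on ({0::real<..} \<times> c ` (V \<inter> V')) (\<lambda>x. (c' \<circ> inv_into V c) (snd x))"
      by (rule smooth_on_compose[OF o _ chart_transition[OF V]])
         (auto intro: smooth_on_bounded_linear bounded_linear_snd)
  qed (intro smooth_on_bounded_linear bounded_linear_fst)
  then show "smooth_on (C ` (X \<inter> X')) (C' \<circ> inv_into X C)"
    unfolding eq by (rule smooth_on_cong[OF o, rotated]) (auto simp: X C S_inv_into[OF V(1)])
qed

end

locale product_mfd = smooth_mfd N for N :: "('a, 'e::euclidean_space) mfd"
begin

sublocale S: smooth_mfd "S_mfd N"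
  by unfold_locales (rule S_smooth_manifold)

abbreviation "SN \<equiv> S_mfd N"

lemma S_chart: "(V, c) \<in> atlas N \<Longrightarrow> ({0<..} \<times> V, Sc c) \<in> atlas SN"
  unfolding S_atlas_iff by blast

lemma S_openin_slice: "openin (mtop SN) W \<Longrightarrow> openin (mtop N) {q. (t, q) \<in> W}"
proof -
  assume W: "openin (mtop SN) W"
  show ?thesis
  proof (subst openin_subopen, clarify)
    fix q assume "(t, q) \<in> W"
    from openin_prod_topology_alt[THEN iffD1, OF W[unfolded S_top], rule_format, OF this]
    obtain A B where "openin (mtop N) B" "t \<in> A" "q \<in> B" "A \<times> B \<subseteq> W"
      by (elim exE conjE)
    then show "\<exists>T. openin (mtop N) T \<and> q \<in> T \<and> T \<subseteq> {q. (t, q) \<in> W}" by blast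
  qed
qed

lemma S_open_pos: "openin (mtop SN) W \<Longrightarrow> (t, q) \<in> W \<Longrightarrow> t > 0 \<and> q \<in> pts N"
  using openin_subset[of "mtop SN" W] unfolding S_pts by blast

text \<open>In charts, this is the composition with an affine map.\<close>

lemma smooth_fun_on_slice:
  assumes f: "smooth_fun_on SN W f"
  shows "smooth_fun_on N {q. (t, q) \<in> W} (\<lambda>q. f (t, q))"
proof -
  have W: "openin (mtop SN) W" using S.smooth_fun_on_openin[OF f] .
  let ?U = "{q. (t, q) \<in> W}"
  have U: "openin (mtop N) ?U" using S_openin_slice[OF W] .
  have "smooth_on (c ` (?U \<inter> V)) ((\<lambda>q. f (t, q)) \<circ> inv_into V c)" if V: "(V, c) \<in> atlas N" for V c
  proof -
    have o: "open (c ` (?U \<inter> V))" using chart_image_open[OF V U] .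
    have "smooth_on (c ` (?U \<inter> V)) (\<lambda>x. (f \<circ> inv_into ({0<..} \<times> V) (Sc c)) (t, x))"
      by (rule smooth_on_compose[OF o _ S.smooth_fun_on_chartD[OF f S_chart[OF V]]])
         (use S_open_pos[OF W] in \<open>force intro: smooth_on_Pair[OF o] smooth_on_const
           smooth_on_bounded_linear bounded_linear_ident\<close>)+
    then show ?thesis
      by (rule smooth_on_cong[OF o, rotated])
         (use S_open_pos[OF W] S_inv_into[OF V] chart_inj[OF V] in auto)
  qed
  then show ?thesis using U unfolding smooth_fun_on_def by blast
qed

lemma smooth_fun_on_snd:
  assumes f: "smooth_fun_on N W f"
  shows "smooth_fun_on SN ({0<..} \<times> W) (\<lambda>p. f (snd p))"
proof -
  have W: "openin (mtop N) W" using smooth_fun_on_openin[OF f] .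
  have "smooth_on (C ` ({0<..} \<times> W \<inter> X)) ((\<lambda>p. f (snd p)) \<circ> inv_into X C)"
    if X: "(X, C) \<in> atlas SN" for X C
  proof -
    obtain V c where V: "(V, c) \<in> atlas N" and XC: "X = {0<..} \<times> V" "C = Sc c"
      using X unfolding S_atlas_iff by blast
    have eq: "C ` ({0<..} \<times> W \<inter> X) = {0<..} \<times> c ` (W \<inter> V)"
      unfolding XC by (auto simp: Times_Int_Times S_chart_image)
    have o: "open ({0::real<..} \<times> c ` (W \<inter> V))"
      using chart_image_open[OF V W] by (simp add: open_Times)
    have "smooth_on ({0::real<..} \<times> c ` (W \<inter> V)) (\<lambda>x. (f \<circ> inv_into V c) (snd x))"
      by (rule smooth_on_compose[OF o _ smooth_fun_on_chartD[OF f V]])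
         (auto intro: smooth_on_bounded_linear bounded_linear_snd)
    then show ?thesis unfolding eq
      by (rule smooth_on_cong[OF o, rotated]) (auto simp: XC S_inv_into[OF V])
  qed
  then show ?thesis using S_openin_Times[OF W] unfolding smooth_fun_on_def by blast
qed

lemma smooth_fun_on_fst:
  assumes f: "smooth_on UNIV f"
  shows "smooth_fun_on SN (pts SN) (\<lambda>p. f (fst p))"
proof -
  have "smooth_on (C ` (pts SN \<inter> X)) ((\<lambda>p. f (fst p)) \<circ> inv_into X C)"
    if X: "(X, C) \<in> atlas SN" for X C
  proof -
    obtain V c where V: "(V, c) \<in> atlas N" and XC: "X = {0<..} \<times> V" "C = Sc c"
      using X unfolding S_atlas_iff by blast
    have eq: "C ` (pts SN \<inter> X) = {0<..} \<times> c ` V"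
      using S.chart_subset[OF X] unfolding XC by (simp add: Int_absorb1 S_chart_image)
    have o: "open ({0::real<..} \<times> c ` V)"
      using chart_open_image[OF V] by (simp add: open_Times)
    have "smooth_on ({0::real<..} \<times> c ` V) (\<lambda>x. f (fst x))"
      by (rule smooth_on_compose[OF o _ f])
         (auto intro: smooth_on_bounded_linear bounded_linear_fst)
    then show ?thesis unfolding eq
      by (rule smooth_on_cong[OF o, rotated]) (auto simp: XC S_inv_into[OF V])
  qed
  then show ?thesis unfolding smooth_fun_on_def by blast
qed

lemma smooth_near_fst: "p \<in> pts SN \<Longrightarrow> smooth_near SN p fst"
  using S.smooth_nearI[OF smooth_fun_on_fst[OF smooth_on_bounded_linear[OF bounded_linear_ident]]]
  by simp

lemma smooth_near_snd:
  assumes "t > 0" "smooth_near N q f" shows "smooth_near SN (t, q) (\<lambda>p. f (snd p))"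
proof -
  obtain U where U: "q \<in> U" "smooth_fun_on N U f" using assms(2) unfolding smooth_near_def by blast
  show ?thesis by (rule S.smooth_nearI[OF smooth_fun_on_snd[OF U(2)]]) (use assms U in auto)
qed

subsection \<open>Tangent vectors\<close>

text \<open>The two summands in the definition of \<^const>\<open>S_tangent\<close> are the derivatives of \<open>f\<close> along the
  slice and along the half-line. By the chain rule they are the values of one differential at
  \<open>(0, w)\<close> and \<open>(a, 0)\<close>.\<close>

lemma S_tangent_chart_vec:
  assumes V: "(V, c) \<in> atlas N" and q: "q \<in> V" and t: "t > 0"
  shows "S_tangent N (t, q) (chart_vec N V c q w) a
       = chart_vec SN ({0<..} \<times> V) (Sc c) (t, q) (a, w)"
proof
  fix f
  show "S_tangent N (t, q) (chart_vec N V c q w) a f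
      = chart_vec SN ({0<..} \<times> V) (Sc c) (t, q) (a, w) f"
  proof (cases "smooth_near SN (t, q) f")
    case True
    obtain W where W: "(t, q) \<in> W" "smooth_fun_on SN W f"
      using True unfolding smooth_near_def by blast
    have sn: "smooth_near N q (\<lambda>q. f (t, q))"
      by (rule smooth_nearI[OF smooth_fun_on_slice[OF W(2)]]) (use W(1) in simp)
    define G where "G = f \<circ> inv_into ({0<..} \<times> V) (Sc c)"
    define L where "L = frechet_derivative G (at (t, c q))"
    have G: "(G has_derivative L) (at (t, c q))"
      using S.smooth_near_in_chart[OF S_chart[OF V] _ True] q t
      unfolding L_def G_def by (simp add: frechet_derivative_works)
    note lin = has_derivative_linear[OF G]
    have Gf: "G (s, c r) = f (s, r)" if "s > 0" "r \<in> V" for s r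
      using S_inv_into[OF V that(1)] chart_inj[OF V] that by (simp add: G_def)
    have "((\<lambda>x. (t, x)) has_derivative (\<lambda>v. (0, v))) (at (c q))"
      by (auto intro!: derivative_eq_intros)
    from has_derivative_compose[OF this, of G L] G
    have "((\<lambda>x. G (t, x)) has_derivative (\<lambda>v. L (0, v))) (at (c q))" by simp
    then have "((\<lambda>r. f (t, r)) \<circ> inv_into V c has_derivative (\<lambda>v. L (0, v))) (at (c q))"
      by (rule has_derivative_transform_within_open[OF _ chart_open_image[OF V]])
         (use q Gf[OF t] chart_inj[OF V] in auto)
    then have 1: "frechet_derivative ((\<lambda>r. f (t, r)) \<circ> inv_into V c) (at (c q)) = (\<lambda>v. L (0, v))"
      using frechet_derivative_at by metis
    have "((\<lambda>s. (s, c q)) has_derivative (\<lambda>s. (s, 0))) (at t)"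
      by (auto intro!: derivative_eq_intros)
    from has_derivative_compose[OF this, of G L] G
    have "((\<lambda>s. G (s, c q)) has_derivative (\<lambda>s. L (s, 0))) (at t)" by simp
    then have "((\<lambda>s. f (s, q)) has_derivative (\<lambda>s. L (s, 0))) (at t)"
      by (rule has_derivative_transform_within_open[of _ _ _ _ "{0<..}"]) (use t q Gf in auto)
    moreover have "(\<lambda>s. L (s, 0)) = (*) (L (1, 0))"
    proof
      fix s :: real
      have "L (s *\<^sub>R (1, 0)) = s *\<^sub>R L (1, 0)" by (rule linear_scale[OF lin])
      then show "L (s, 0) = L (1, 0) * s" by simp
    qed
    ultimately have "((\<lambda>s. f (s, q)) has_field_derivative L (1, 0)) (at t)"
      by (simp add: has_field_derivative_def)
    then have 2: "deriv (\<lambda>s. f (s, q)) t = L (1, 0)" by (rule DERIV_imp_deriv)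
    have "L (a, w) = L (a *\<^sub>R (1, 0) + (0, w))" by simp
    also have "\<dots> = a * L (1, 0) + L (0, w)" by (simp only: linear_add[OF lin] linear_scale[OF lin]) simp
    finally show ?thesis using True sn 1 2 by (simp add: S_tangent_def chart_vec_def G_def L_def)
  qed (simp add: S_tangent_def chart_vec_def)
qed

lemma S_tangent_space:
  assumes "p \<in> pts SN"
  shows "tangent_space SN p = {S_tangent N p x a |x a. x \<in> tangent_space N (snd p)}"
proof -
  obtain t q where p: "p = (t, q)" "t > 0" "q \<in> pts N" using assms unfolding S_pts by auto
  obtain V c where V: "(V, c) \<in> atlas N" "q \<in> V" using chart_cover[OF p(3)] by blast
  have "tangent_space SN p = range (chart_vec SN ({0<..} \<times> V) (Sc c) p)"
    by (rule S.tangent_space_eq_range[OF S_chart[OF V(1)]]) (use p V in auto)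
  also have "\<dots> = {S_tangent N p x a |x a. x \<in> range (chart_vec N V c q)}" (is "?L = ?R")
  proof
    have k: "chart_vec SN ({0<..} \<times> V) (Sc c) p (a, w) = S_tangent N p (chart_vec N V c q w) a" for a w
      using S_tangent_chart_vec[OF V p(2)] unfolding p(1) by simp
    show "?L \<subseteq> ?R"
    proof
      fix v assume "v \<in> ?L"
      then obtain aw where "v = chart_vec SN ({0<..} \<times> V) (Sc c) p aw" by (rule rangeE)
      then have "v = S_tangent N p (chart_vec N V c q (snd aw)) (fst aw)"
        using k[of "fst aw" "snd aw"] by simp
      then show "v \<in> ?R" by auto
    qed
    show "?R \<subseteq> ?L" by (auto simp: k[symmetric])
  qed
  finally show ?thesis unfolding tangent_space_eq_range[OF V, symmetric] p(1) by simp
qed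

lemma S_tangent_in:
  "p \<in> pts SN \<Longrightarrow> x \<in> tangent_space N (snd p) \<Longrightarrow> S_tangent N p x a \<in> tangent_space SN p"
  unfolding S_tangent_space by blast

lemma S_eta_S_tangent:
  assumes "p \<in> pts SN" "x \<in> tangent_space N (snd p)"
  shows "S_eta p (S_tangent N p x a) = a"
proof -
  have "snd p \<in> pts N" using assms(1) unfolding S_pts by auto
  then show ?thesis
    using smooth_near_fst[OF assms(1)] tangent_vec_const[OF _ assms(2)]
    by (simp add: S_eta_def S_tangent_def)
qed

lemma N_part_S_tangent:
  assumes "p \<in> pts SN" "x \<in> tangent_space N (snd p)"
  shows "N_part N p (S_tangent N p x a) = x"
proof
  fix f
  obtain t q where p: "p = (t, q)" "t > 0" "q \<in> pts N" using assms(1) unfolding S_pts by auto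
  show "N_part N p (S_tangent N p x a) f = x f"
    using smooth_near_snd[OF p(2), of q f] tangent_vec_not_smooth[OF p(3), of x f] assms(2)
    by (simp add: N_part_def S_tangent_def p(1) o_def)
qed

lemma S_tangent_lincomb:
  "r *\<^sub>R S_tangent N p x a + s *\<^sub>R S_tangent N p y b
     = S_tangent N p (r *\<^sub>R x + s *\<^sub>R y) (r * a + s * b)"
  by (auto simp: S_tangent_def scaleR_fun_def fun_eq_iff algebra_simps)

lemma S_tangent_decomp:
  assumes "p \<in> pts SN" "v \<in> tangent_space SN p"
  shows "N_part N p v \<in> tangent_space N (snd p)" "v = S_tangent N p (N_part N p v) (S_eta p v)"
proof -
  obtain x a where x: "x \<in> tangent_space N (snd p)" "v = S_tangent N p x a"
    using assms S_tangent_space by blast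
  then show "N_part N p v \<in> tangent_space N (snd p)" "v = S_tangent N p (N_part N p v) (S_eta p v)"
    using N_part_S_tangent[OF assms(1) x(1)] S_eta_S_tangent[OF assms(1) x(1)] by simp_all
qed

text \<open>Thus the components of the part of \<open>v\<close> along \<open>N\<close> are among the components of \<open>v\<close> in the product
  chart.\<close>

lemma S_N_part_coord:
  assumes V: "(V, c) \<in> atlas N" and p: "p \<in> {0<..} \<times> V"
  shows "N_part N p v (\<lambda>q. c q \<bullet> b) = v (\<lambda>p. Sc c p \<bullet> (0, b))"
proof -
  have "smooth_near N (snd p) (\<lambda>q. c q \<bullet> b)"
    by (rule smooth_nearI[OF smooth_fun_on_coord[OF V]]) (use p in auto)
  moreover have "(\<lambda>q. c q \<bullet> b) \<circ> snd = (\<lambda>p. Sc c p \<bullet> (0, b))" by auto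
  ultimately show ?thesis by (simp add: N_part_def)
qed

subsection \<open>Vector fields\<close>

lemma S_vector_field_onI:
  assumes U: "openin (mtop SN) U"
    and X: "\<And>p. p \<in> U \<Longrightarrow> X p \<in> tangent_space SN p"
    and eta: "smooth_fun_on SN U (\<lambda>p. S_eta p (X p))"
    and comp: "\<And>V c b. (V, c) \<in> atlas N \<Longrightarrow> b \<in> Basis \<Longrightarrow>
      smooth_fun_on SN (U \<inter> {0<..} \<times> V) (\<lambda>p. N_part N p (X p) (\<lambda>q. c q \<bullet> b))"
  shows "vector_field_on SN U X"
proof (rule S.vector_field_onI[OF U X])
  fix Y C and b :: "real \<times> 'e" assume Y: "(Y, C) \<in> atlas SN" and b: "b \<in> Basis"
  obtain V c where V: "(V, c) \<in> atlas N" and YC: "Y = {0<..} \<times> V" "C = Sc c"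
    using Y unfolding S_atlas_iff by blast
  consider "b = (1, 0)" | b' where "b = (0, b')" "b' \<in> Basis"
    using b unfolding Basis_prod_def by auto
  then show "smooth_fun_on SN (U \<inter> Y) (\<lambda>p. X p (\<lambda>q. C q \<bullet> b))"
  proof cases
    case 1
    have "(\<lambda>q. C q \<bullet> b) = fst" unfolding YC 1 by auto
    then show ?thesis
      using S.smooth_fun_on_subset[OF eta, of "U \<inter> Y"] U S.chart_openin[OF Y]
      by (simp add: S_eta_def openin_Int)
  next
    case 2
    show ?thesis
      by (rule S.smooth_fun_on_cong[OF comp[OF V 2(2), folded YC(1)]])
         (use S_N_part_coord[OF V] in \<open>auto simp: YC 2(1)\<close>)
  qed
qed

lemma S_eta_smooth:
  assumes "vector_field_on SN U X" shows "smooth_fun_on SN U (\<lambda>p. S_eta p (X p))"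
  unfolding S_eta_def
  using S.vector_field_on_openin[OF assms] S.vector_field_on_pts[OF assms]
  by (intro S.vector_field_on_smooth[OF assms _ order_refl]
      S.smooth_fun_on_subset[OF smooth_fun_on_fst[OF smooth_on_bounded_linear[OF bounded_linear_ident]]])
     auto

lemma S_N_part_smooth:
  assumes X: "vector_field_on SN U X" and V: "(V, c) \<in> atlas N"
  shows "smooth_fun_on SN (U \<inter> {0<..} \<times> V) (\<lambda>p. N_part N p (X p) (\<lambda>q. c q \<bullet> b))"
  by (rule S.smooth_fun_on_cong[OF S.vector_field_on_coord[OF X S_chart[OF V], of "(0, b)"]])
     (use S_N_part_coord[OF V] in auto)

definition lift :: "('a \<Rightarrow> 'a tvec) \<Rightarrow> real \<times> 'a \<Rightarrow> (real \<times> 'a) tvec" where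
  "lift Y p = S_tangent N p (Y (snd p)) 0"

lemma
  assumes Y: "vector_field_on N W Y" and p: "p \<in> {0<..} \<times> W"
  shows lift_tangent: "lift Y p \<in> tangent_space SN p"
    and S_eta_lift: "S_eta p (lift Y p) = 0"
    and N_part_lift: "N_part N p (lift Y p) = Y (snd p)"
proof -
  have pS: "p \<in> pts SN" and Yp: "Y (snd p) \<in> tangent_space N (snd p)"
    using p vector_field_on_tangent[OF Y] vector_field_on_pts[OF Y] unfolding S_pts by auto
  show "lift Y p \<in> tangent_space SN p"
    unfolding lift_def using S_tangent_in[OF pS Yp] .
  show "S_eta p (lift Y p) = 0" "N_part N p (lift Y p) = Y (snd p)"
    unfolding lift_def using S_eta_S_tangent[OF pS Yp] N_part_S_tangent[OF pS Yp] by simp_all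
qed

lemma lift_vector_field:
  assumes Y: "vector_field_on N W Y"
  shows "vector_field_on SN ({0<..} \<times> W) (lift Y)"
proof (rule S_vector_field_onI)
  show U: "openin (mtop SN) ({0<..} \<times> W)"
    using S_openin_Times[OF vector_field_on_openin[OF Y]] .
  show "smooth_fun_on SN ({0<..} \<times> W) (\<lambda>p. S_eta p (lift Y p))"
    by (rule S.smooth_fun_on_cong[OF S.smooth_fun_on_const[OF U, of 0]]) (simp add: S_eta_lift[OF Y])
  fix V c and b :: 'e assume V: "(V, c) \<in> atlas N"
  have eq: "{0<..} \<times> W \<inter> {0<..} \<times> V = {0<..} \<times> (W \<inter> V)" by auto
  show "smooth_fun_on SN ({0<..} \<times> W \<inter> {0<..} \<times> V) (\<lambda>p. N_part N p (lift Y p) (\<lambda>q. c q \<bullet> b))"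
    unfolding eq
    by (rule S.smooth_fun_on_cong[OF smooth_fun_on_snd[OF vector_field_on_coord[OF Y V, of b]]])
       (auto simp: N_part_lift[OF Y])
qed (rule lift_tangent[OF Y])

lemma zero_tangent: "q \<in> pts N \<Longrightarrow> 0 \<in> tangent_space N q"
  using subspace_0[OF tangent_space_subspace] .

lemma
  assumes "p \<in> pts SN"
  shows S_xi_tangent: "S_xi N p \<in> tangent_space SN p"
    and S_eta_xi: "S_eta p (S_xi N p) = 1"
    and N_part_xi: "N_part N p (S_xi N p) = 0"
proof -
  have 0: "0 \<in> tangent_space N (snd p)" using zero_tangent assms unfolding S_pts by auto
  show "S_xi N p \<in> tangent_space SN p" "S_eta p (S_xi N p) = 1" "N_part N p (S_xi N p) = 0"
    unfolding S_xi_def using S_tangent_in[OF assms 0] S_eta_S_tangent[OF assms 0] N_part_S_tangent[OF assms 0]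
    by simp_all
qed

lemma S_xi_vector_field: "vector_field_on SN (pts SN) (S_xi N)"
proof (rule S_vector_field_onI[OF openin_topspace S_xi_tangent])
  show "smooth_fun_on SN (pts SN) (\<lambda>p. S_eta p (S_xi N p))"
    by (rule S.smooth_fun_on_cong[OF S.smooth_fun_on_const[OF openin_topspace, of 1]])
       (simp add: S_eta_xi)
  fix V c and b :: 'e assume V: "(V, c) \<in> atlas N"
  have o: "openin (mtop SN) (pts SN \<inter> {0<..} \<times> V)"
    using S_openin_Times[OF chart_openin[OF V]] by (simp add: openin_Int)
  show "smooth_fun_on SN (pts SN \<inter> {0<..} \<times> V) (\<lambda>p. N_part N p (S_xi N p) (\<lambda>q. c q \<bullet> b))"
    by (rule S.smooth_fun_on_cong[OF S.smooth_fun_on_const[OF o, of 0]]) (simp add: N_part_xi)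
qed

lemma lift_apply_snd:
  assumes "fst p > 0" "smooth_near N (snd p) f" shows "lift Y p (\<lambda>q. f (snd q)) = Y (snd p) f"
  using smooth_near_snd[OF assms] by (simp add: lift_def S_tangent_def)

lemma S_xi_apply_snd: "S_xi N p (\<lambda>q. f (snd q)) = 0"
  by (simp add: S_xi_def S_tangent_def)

lemma S_eta_lie_bracket:
  assumes "p \<in> pts SN"
  shows "S_eta p (lie_bracket SN X Z p) = X p (\<lambda>q. S_eta q (Z q)) - Z p (\<lambda>q. S_eta q (X q))"
  using smooth_near_fst[OF assms] by (simp add: S_eta_def lie_bracket_def)

lemma N_part_lie_bracket:
  assumes X: "vector_field_on SN U X" and Z: "vector_field_on SN U Z" and p: "p \<in> U"
    and V: "(V, c) \<in> atlas N" "p \<in> {0<..} \<times> V"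
  shows "N_part N p (lie_bracket SN X Z p) (\<lambda>q. c q \<bullet> b)
    = X p (\<lambda>q. N_part N q (Z q) (\<lambda>q. c q \<bullet> b)) - Z p (\<lambda>q. N_part N q (X q) (\<lambda>q. c q \<bullet> b))"
proof -
  let ?f = "\<lambda>p. Sc c p \<bullet> (0, b)"
  have pM: "p \<in> pts SN" using S.vector_field_on_pts[OF X p] .
  have o: "openin (mtop SN) ({0<..} \<times> V)" using S_openin_Times[OF chart_openin[OF V(1)]] .
  have loc: "v (\<lambda>q. N_part N q (Y q) (\<lambda>q. c q \<bullet> b)) = v (\<lambda>q. Y q ?f)"
    if "v \<in> tangent_space SN p" for v and Y :: "real \<times> 'a \<Rightarrow> (real \<times> 'a) tvec"
    by (rule S.tangent_vec_local[OF pM that o V(2)]) (rule S_N_part_coord[OF V(1)])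
  have "smooth_near SN p ?f"
    by (rule S.smooth_nearI[OF S.smooth_fun_on_coord[OF S_chart[OF V(1)]] V(2)])
  then show ?thesis
    unfolding S_N_part_coord[OF V] loc[OF S.vector_field_on_tangent[OF X p]]
      loc[OF S.vector_field_on_tangent[OF Z p]] by (simp add: lie_bracket_def)
qed

text \<open>The next two lemmas assume that the bracket is a tangent vector, which torsion-freeness of a
  connection supplies later. Then the bracket is determined by its values on the coordinate
  functions, and these are derivatives of the components of the two fields. The components of \<open>\<xi>\<close>
  are constant and those of lifted fields do not depend on \<open>t\<close>.\<close>

lemma S_lie_bracket_xi_lift:
  assumes Y: "vector_field_on N W Y" and p: "p \<in> {0<..} \<times> W"
    and br: "lie_bracket SN (S_xi N) (lift Y) p \<in> tangent_space SN p"
  shows "lie_bracket SN (S_xi N) (lift Y) p = 0"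
proof -
  let ?v = "lie_bracket SN (S_xi N) (lift Y) p"
  note LY = lift_vector_field[OF Y]
  note U = S.vector_field_on_openin[OF LY]
  have pM: "p \<in> pts SN" using S.vector_field_on_pts[OF LY p] .
  have sub: "{0<..} \<times> W \<subseteq> pts SN" using openin_subset[OF U] .
  note xi = S.vector_field_on_subset[OF S_xi_vector_field U sub]
  note tl = lift_tangent[OF Y p] and tx = S_xi_tangent[OF pM]
  have "S_xi N p (\<lambda>q. S_eta q (lift Y q)) = S_xi N p (\<lambda>q. 0)"
    by (rule S.tangent_vec_local[OF pM tx U p]) (rule S_eta_lift[OF Y])
  moreover have "lift Y p (\<lambda>q. S_eta q (S_xi N q)) = lift Y p (\<lambda>q. 1)"
    by (rule S.tangent_vec_local[OF pM tl U p]) (use sub S_eta_xi in auto)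
  ultimately have 1: "S_eta p ?v = 0"
    using S_eta_lie_bracket[OF pM] S.tangent_vec_const[OF pM tx] S.tangent_vec_const[OF pM tl] by simp
  have sM: "snd p \<in> pts N" using pM unfolding S_pts by auto
  obtain V c where V: "(V, c) \<in> atlas N" "snd p \<in> V" using chart_cover[OF sM] by blast
  have pV: "p \<in> {0<..} \<times> V" using p V(2) by (simp add: mem_Times_iff)
  have 2: "N_part N p ?v = 0"
  proof (rule tangent_vec_eqI[OF V S_tangent_decomp(1)[OF pM br] zero_tangent[OF sM]])
    fix b :: 'e
    have "S_xi N p (\<lambda>q. N_part N q (lift Y q) (\<lambda>q. c q \<bullet> b)) = S_xi N p (\<lambda>q. Y (snd q) (\<lambda>q. c q \<bullet> b))"
      by (rule S.tangent_vec_local[OF pM tx U p]) (simp only: N_part_lift[OF Y])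
    moreover have "lift Y p (\<lambda>q. N_part N q (S_xi N q) (\<lambda>q. c q \<bullet> b)) = lift Y p (\<lambda>q. 0)"
      by (rule S.tangent_vec_local[OF pM tl U p]) (use sub N_part_xi in auto)
    moreover have "S_xi N p (\<lambda>q. Y (snd q) (\<lambda>q. c q \<bullet> b)) = 0"
      by (rule S_xi_apply_snd)
    ultimately show "N_part N p ?v (\<lambda>q. c q \<bullet> b) = 0 (\<lambda>q. c q \<bullet> b)"
      using N_part_lie_bracket[OF xi LY p V(1) pV, of b] S.tangent_vec_const[OF pM tl] by simp
  qed
  have "?v = S_tangent N p 0 0" using S_tangent_decomp(2)[OF pM br] unfolding 1 2 .
  then show ?thesis by (simp add: S_tangent_def fun_eq_iff)
qed

lemma S_lie_bracket_lift:
  assumes Y: "vector_field_on N W Y" and Z: "vector_field_on N W Z" and p: "p \<in> {0<..} \<times> W"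
    and brN: "lie_bracket N Y Z (snd p) \<in> tangent_space N (snd p)"
    and br: "lie_bracket SN (lift Y) (lift Z) p \<in> tangent_space SN p"
  shows "lie_bracket SN (lift Y) (lift Z) p = S_tangent N p (lie_bracket N Y Z (snd p)) 0"
proof -
  let ?v = "lie_bracket SN (lift Y) (lift Z) p"
  note LY = lift_vector_field[OF Y] and LZ = lift_vector_field[OF Z]
  note U = S.vector_field_on_openin[OF LY]
  have pM: "p \<in> pts SN" using S.vector_field_on_pts[OF LY p] .
  have p0: "fst p > 0" and pW: "snd p \<in> W" using p by auto
  note tY = lift_tangent[OF Y p] and tZ = lift_tangent[OF Z p]
  have "lift Y p (\<lambda>q. S_eta q (lift Z q)) = lift Y p (\<lambda>q. 0)"
    by (rule S.tangent_vec_local[OF pM tY U p]) (rule S_eta_lift[OF Z])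
  moreover have "lift Z p (\<lambda>q. S_eta q (lift Y q)) = lift Z p (\<lambda>q. 0)"
    by (rule S.tangent_vec_local[OF pM tZ U p]) (rule S_eta_lift[OF Y])
  ultimately have 1: "S_eta p ?v = 0"
    using S_eta_lie_bracket[OF pM] S.tangent_vec_const[OF pM tY] S.tangent_vec_const[OF pM tZ] by simp
  have sM: "snd p \<in> pts N" using pM unfolding S_pts by auto
  obtain V c where V: "(V, c) \<in> atlas N" "snd p \<in> V" using chart_cover[OF sM] by blast
  have pV: "p \<in> {0<..} \<times> V" using p V(2) by (simp add: mem_Times_iff)
  have 2: "N_part N p ?v = lie_bracket N Y Z (snd p)"
  proof (rule tangent_vec_eqI[OF V S_tangent_decomp(1)[OF pM br] brN])
    fix b :: 'e
    let ?c = "\<lambda>q. c q \<bullet> b"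
    have sn: "smooth_near N (snd p) ?c" "smooth_near N (snd p) (\<lambda>q. Y q ?c)"
        "smooth_near N (snd p) (\<lambda>q. Z q ?c)"
      using V pW by (auto intro: smooth_nearI[OF smooth_fun_on_coord]
          smooth_nearI[OF vector_field_on_coord[OF Y]] smooth_nearI[OF vector_field_on_coord[OF Z]])
    have "lift Y p (\<lambda>q. N_part N q (lift Z q) ?c) = lift Y p (\<lambda>q. Z (snd q) ?c)"
      by (rule S.tangent_vec_local[OF pM tY U p]) (simp only: N_part_lift[OF Z])
    moreover have "lift Z p (\<lambda>q. N_part N q (lift Y q) ?c) = lift Z p (\<lambda>q. Y (snd q) ?c)"
      by (rule S.tangent_vec_local[OF pM tZ U p]) (simp only: N_part_lift[OF Y])
    moreover have "lift Y p (\<lambda>q. Z (snd q) ?c) = Y (snd p) (\<lambda>q. Z q ?c)"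
      by (rule lift_apply_snd[OF p0 sn(3)])
    moreover have "lift Z p (\<lambda>q. Y (snd q) ?c) = Z (snd p) (\<lambda>q. Y q ?c)"
      by (rule lift_apply_snd[OF p0 sn(2)])
    ultimately show "N_part N p ?v ?c = lie_bracket N Y Z (snd p) ?c"
      using N_part_lie_bracket[OF LY LZ p V(1) pV, of b] sn(1) by (simp add: lie_bracket_def)
  qed
  show ?thesis using S_tangent_decomp(2)[OF pM br] unfolding 1 2 .
qed

end

section \<open>The structure on \<open>\<real>\<^sup>+ \<times> N\<close>\<close>

context product_mfd
begin

lemma N_part_chart:
  assumes X: "vector_field_on SN U X" and V: "(V, c) \<in> atlas N"
    and p: "p \<in> U" "p \<in> {0<..} \<times> V"
  shows "N_part N p (X p)
    = (\<Sum>b\<in>Basis. N_part N p (X p) (\<lambda>q. c q \<bullet> b) *\<^sub>R chart_vec N V c (snd p) b)"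
  by (rule tangent_vec_chart[OF V _ S_tangent_decomp(1)[OF S.vector_field_on_pts[OF X p(1)]
        S.vector_field_on_tangent[OF X p(1)]]])
     (use p(2) in auto)

text \<open>The part of \<open>X\<close> along \<open>N\<close> depends on \<open>t\<close>, so it is not a field on \<open>N\<close>. Its expansion in a
  coordinate frame of \<open>N\<close> separates the smooth coefficients on \<open>S(N)\<close> from the values of \<open>B\<close> on fields
  of \<open>N\<close>.\<close>

lemma smooth_fun_on_bilinear_N_part:
  assumes lin1: "\<And>q y. q \<in> pts N \<Longrightarrow> y \<in> tangent_space N q \<Longrightarrow>
        linear_on_space (tangent_space N q) (\<lambda>x. B q x y :: real)"
    and lin2: "\<And>q x. q \<in> pts N \<Longrightarrow> x \<in> tangent_space N q \<Longrightarrow>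
        linear_on_space (tangent_space N q) (B q x)"
    and sm: "\<And>U Y Z. vector_field_on N U Y \<Longrightarrow> vector_field_on N U Z \<Longrightarrow>
        smooth_fun_on N U (\<lambda>q. B q (Y q) (Z q))"
    and X: "vector_field_on SN U X" and Z: "vector_field_on SN U Z"
  shows "smooth_fun_on SN U (\<lambda>p. B (snd p) (N_part N p (X p)) (N_part N p (Z p)))"
proof (rule S.smooth_fun_on_local)
  fix p assume p: "p \<in> U"
  note U = S.vector_field_on_openin[OF X]
  have "snd p \<in> pts N" using S.vector_field_on_pts[OF X p] unfolding S_pts by auto
  then obtain V c where V: "(V, c) \<in> atlas N" "snd p \<in> V" using chart_cover by blast
  let ?W = "U \<inter> {0<..} \<times> V"
  have pW: "p \<in> ?W"
    using p V(2) S.vector_field_on_pts[OF X p] unfolding S_pts by (auto simp: mem_Times_iff)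
  have oV: "openin (mtop SN) ({0<..} \<times> V)" using S_openin_Times[OF chart_openin[OF V(1)]] .
  have W: "openin (mtop SN) ?W" using U oV by blast
  let ?e = "\<lambda>b q. chart_vec N V c q b"
  let ?X = "\<lambda>b p. N_part N p (X p) (\<lambda>q. c q \<bullet> b)" and ?Z = "\<lambda>b p. N_part N p (Z p) (\<lambda>q. c q \<bullet> b)"
  have "smooth_fun_on SN ?W
      (\<lambda>p. \<Sum>b\<in>Basis. ?X b p * (\<Sum>b'\<in>Basis. ?Z b' p * B (snd p) (?e b (snd p)) (?e b' (snd p))))"
  proof (intro S.smooth_fun_on_sum W S.smooth_fun_on_mult)
    fix b b' :: 'e
    show "smooth_fun_on SN ?W (?X b)" by (rule S_N_part_smooth[OF X V(1)])
    show "smooth_fun_on SN ?W (?Z b')" by (rule S_N_part_smooth[OF Z V(1)])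
    show "smooth_fun_on SN ?W (\<lambda>p. B (snd p) (?e b (snd p)) (?e b' (snd p)))"
      by (rule S.smooth_fun_on_subset[OF smooth_fun_on_snd[OF sm[OF chart_vec_vector_field[OF V(1)]
            chart_vec_vector_field[OF V(1)]]] W]) auto
  qed
  then have "smooth_fun_on SN ?W (\<lambda>p. B (snd p) (N_part N p (X p)) (N_part N p (Z p)))"
  proof (rule S.smooth_fun_on_cong)
    fix r assume r: "r \<in> ?W"
    then have rV: "snd r \<in> V" and rU: "r \<in> U" and rW: "r \<in> {0<..} \<times> V" by auto
    have rN: "snd r \<in> pts N" using chart_subset[OF V(1)] rV by auto
    note sub = tangent_space_subspace[OF rN]
    have e: "?e b (snd r) \<in> tangent_space N (snd r)" for b
      by (rule chart_vec_in_tangent_space[OF V(1) rV])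
    have nZ: "N_part N r (Z r) \<in> tangent_space N (snd r)"
      using S_tangent_decomp(1) S.vector_field_on_pts[OF Z rU] S.vector_field_on_tangent[OF Z rU] by blast
    have "B (snd r) (N_part N r (X r)) (N_part N r (Z r))
        = B (snd r) (\<Sum>b\<in>Basis. ?X b r *\<^sub>R ?e b (snd r)) (N_part N r (Z r))"
      using N_part_chart[OF X V(1) rU rW] by (rule arg_cong)
    also have "\<dots> = (\<Sum>b\<in>Basis. ?X b r *\<^sub>R B (snd r) (?e b (snd r)) (N_part N r (Z r)))"
      by (rule linear_on_space_sum[OF lin1[OF rN nZ] sub]) (use e in auto)
    also have "\<dots> = (\<Sum>b\<in>Basis. ?X b r *\<^sub>R B (snd r) (?e b (snd r)) (\<Sum>b'\<in>Basis. ?Z b' r *\<^sub>R ?e b' (snd r)))"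
      using N_part_chart[OF Z V(1) rU rW] by (rule arg_cong)
    also have "\<dots> = (\<Sum>b\<in>Basis. ?X b r *\<^sub>R (\<Sum>b'\<in>Basis. ?Z b' r *\<^sub>R B (snd r) (?e b (snd r)) (?e b' (snd r))))"
      by (intro sum.cong refl arg_cong[of _ _ "scaleR _"] linear_on_space_sum[OF lin2[OF rN e] sub])
         (use e in auto)
    finally show "(\<Sum>b\<in>Basis. ?X b r * (\<Sum>b'\<in>Basis. ?Z b' r * B (snd r) (?e b (snd r)) (?e b' (snd r))))
        = B (snd r) (N_part N r (X r)) (N_part N r (Z r))" by simp
  qed
  then show "\<exists>W. p \<in> W \<and> W \<subseteq> U \<and>
      smooth_fun_on SN W (\<lambda>p. B (snd p) (N_part N p (X p)) (N_part N p (Z p)))"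
    using pW by (intro exI[of _ ?W]) simp
qed

lemma S_phi_vector_field:
  assumes P: "endomorphism_field N P" and X: "vector_field_on SN U X"
  shows "vector_field_on SN U (\<lambda>p. S_phi N P p (X p))"
proof -
  note U = S.vector_field_on_openin[OF X]
  have m: "P (snd p) (N_part N p (X p)) \<in> tangent_space N (snd p)" if p: "p \<in> U" for p
  proof -
    have "snd p \<in> pts N" using S.vector_field_on_pts[OF X p] unfolding S_pts by auto
    moreover have "N_part N p (X p) \<in> tangent_space N (snd p)"
      using S_tangent_decomp(1) S.vector_field_on_pts[OF X p] S.vector_field_on_tangent[OF X p] by blast
    ultimately show ?thesis using P unfolding endomorphism_field_def by blast
  qed
  have pS: "p \<in> pts SN" if "p \<in> U" for p using S.vector_field_on_pts[OF X that] .
  show ?thesis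
  proof (rule S_vector_field_onI[OF U])
    show "S_phi N P p (X p) \<in> tangent_space SN p" if "p \<in> U" for p
      unfolding S_phi_def by (rule S_tangent_in[OF pS[OF that] m[OF that]])
    show "smooth_fun_on SN U (\<lambda>p. S_eta p (S_phi N P p (X p)))"
      by (rule S.smooth_fun_on_cong[OF S.smooth_fun_on_const[OF U, of 0]])
         (simp add: S_phi_def S_eta_S_tangent[OF pS m])
    fix V c and b :: 'e assume V: "(V, c) \<in> atlas N"
    let ?W = "U \<inter> {0<..} \<times> V"
    have oV: "openin (mtop SN) ({0<..} \<times> V)" using S_openin_Times[OF chart_openin[OF V]] .
    have W: "openin (mtop SN) ?W" using U oV by blast
    let ?X = "\<lambda>b p. N_part N p (X p) (\<lambda>q. c q \<bullet> b)"
    let ?E = "\<lambda>b' q. P q (chart_vec N V c q b')"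
    have E: "vector_field_on N V (?E b')" for b'
      using P chart_vec_vector_field[OF V] unfolding endomorphism_field_def by blast
    have "smooth_fun_on SN ?W (\<lambda>p. \<Sum>b'\<in>Basis. ?X b' p * ?E b' (snd p) (\<lambda>q. c q \<bullet> b))"
    proof (intro S.smooth_fun_on_sum W S.smooth_fun_on_mult)
      fix b' :: 'e
      show "smooth_fun_on SN ?W (?X b')" by (rule S_N_part_smooth[OF X V])
      have "smooth_fun_on N V (\<lambda>q. ?E b' q (\<lambda>q. c q \<bullet> b))"
        by (rule vector_field_on_smooth[OF E smooth_fun_on_coord[OF V] order_refl])
      then show "smooth_fun_on SN ?W (\<lambda>p. ?E b' (snd p) (\<lambda>q. c q \<bullet> b))"
        by (rule S.smooth_fun_on_subset[OF smooth_fun_on_snd W]) auto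
    qed
    then show "smooth_fun_on SN ?W (\<lambda>p. N_part N p (S_phi N P p (X p)) (\<lambda>q. c q \<bullet> b))"
    proof (rule S.smooth_fun_on_cong)
      fix r assume r: "r \<in> ?W"
      then have rV: "snd r \<in> V" and rU: "r \<in> U" and rW: "r \<in> {0<..} \<times> V" by auto
      have rN: "snd r \<in> pts N" using chart_subset[OF V] rV by auto
      have lin: "linear_on_space (tangent_space N (snd r)) (P (snd r))"
        using P rN unfolding endomorphism_field_def by blast
      have "N_part N r (S_phi N P r (X r)) = P (snd r) (N_part N r (X r))"
        unfolding S_phi_def by (rule N_part_S_tangent[OF pS[OF rU] m[OF rU]])
      also have "\<dots> = P (snd r) (\<Sum>b'\<in>Basis. ?X b' r *\<^sub>R chart_vec N V c (snd r) b')"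
        using N_part_chart[OF X V rU rW] by (rule arg_cong)
      also have "\<dots> = (\<Sum>b'\<in>Basis. ?X b' r *\<^sub>R ?E b' (snd r))"
        by (rule linear_on_space_sum[OF lin tangent_space_subspace[OF rN]])
           (use chart_vec_in_tangent_space[OF V rV] in auto)
      finally show "(\<Sum>b'\<in>Basis. ?X b' r * ?E b' (snd r) (\<lambda>q. c q \<bullet> b))
          = N_part N r (S_phi N P r (X r)) (\<lambda>q. c q \<bullet> b)"
        by (simp add: sum_fun_apply scaleR_fun_def)
    qed
  qed
qed

end

locale paracomplex_cone = product_mfd N
  for N :: "('a, 'e::euclidean_space) mfd" +
  fixes P :: "'a \<Rightarrow> 'a tvec \<Rightarrow> 'a tvec" and h :: "'a \<Rightarrow> 'a tvec \<Rightarrow> 'a tvec \<Rightarrow> real"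
    and D' :: "'a connection" and D :: "(real \<times> 'a) connection"
  assumes dim2: "DIM('e) = 2"
    and apc: "almost_paracomplex_riemannian N P h"
    and lcN: "levi_civita N h D'"
    and lcS: "levi_civita SN (S_metric N P h) D"
begin

lemma P_endo: "endomorphism_field N P" and h_metric: "riemannian_metric N h"
  using apc unfolding almost_paracomplex_riemannian_def by blast+

lemma P_involution: "q \<in> pts N \<Longrightarrow> x \<in> tangent_space N q \<Longrightarrow> P q (P q x) = x"
  and P_isometry: "q \<in> pts N \<Longrightarrow> x \<in> tangent_space N q \<Longrightarrow> y \<in> tangent_space N q \<Longrightarrow>
        h q (P q x) (P q y) = h q x y"
  and P_trace: "q \<in> pts N \<Longrightarrow> trace_on (tangent_space N q) (P q) = 0"
  using apc unfolding almost_paracomplex_riemannian_def by blast+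

lemma P_mem: "q \<in> pts N \<Longrightarrow> x \<in> tangent_space N q \<Longrightarrow> P q x \<in> tangent_space N q"
  using P_endo unfolding endomorphism_field_def by blast

sublocale base: levi_civita_endo N h P D'
proof
  show "h q (P q x) y = h q x (P q y)"
    if "q \<in> pts N" "x \<in> tangent_space N q" "y \<in> tangent_space N q" for q x y
    using P_isometry[OF that(1,2) P_mem[OF that(1,3)]] P_involution[OF that(1,3)] by simp
qed (use lcN P_endo h_metric P_involution in auto)

lemma S_phi_S_tangent:
  assumes "p \<in> pts SN" "x \<in> base.T (snd p)"
  shows "S_phi N P p (S_tangent N p x a) = S_tangent N p (P (snd p) x) 0"
  unfolding S_phi_def N_part_S_tangent[OF assms] ..

lemma S_metric_S_tangent:
  assumes "p \<in> pts SN" "x \<in> base.T (snd p)" "y \<in> base.T (snd p)"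
  shows "S_metric N P h p (S_tangent N p x a) (S_tangent N p y b)
    = a * b + cosh (2 * fst p) * h (snd p) x y + sinh (2 * fst p) * h (snd p) x (P (snd p) y)"
  by (simp add: S_metric_def associated_metric_def assms S_eta_S_tangent N_part_S_tangent)

lemma S_pts_snd: "p \<in> pts SN \<Longrightarrow> snd p \<in> pts N"
  and S_pts_fst: "p \<in> pts SN \<Longrightarrow> fst p > 0"
  unfolding S_pts by auto

lemma S_tangent_cases:
  assumes "p \<in> pts SN" "v \<in> tangent_space SN p"
  obtains x a where "x \<in> base.T (snd p)" "v = S_tangent N p x a"
  using assms S_tangent_space by blast

lemma S_phi_endomorphism_field: "endomorphism_field SN (S_phi N P)"
  unfolding endomorphism_field_def
proof (intro conjI ballI allI impI)
  fix p assume p: "p \<in> pts SN"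
  note q = S_pts_snd[OF p]
  show "S_phi N P p ` tangent_space SN p \<subseteq> tangent_space SN p"
    by (auto elim!: S_tangent_cases[OF p] simp: S_phi_S_tangent[OF p] S_tangent_in[OF p] P_mem[OF q])
  have lc: "S_phi N P p (r *\<^sub>R u + s *\<^sub>R v) = r *\<^sub>R S_phi N P p u + s *\<^sub>R S_phi N P p v"
    if u: "u \<in> tangent_space SN p" and v: "v \<in> tangent_space SN p" for u v r s
  proof -
    obtain x a where x: "x \<in> base.T (snd p)" "u = S_tangent N p x a"
      using S_tangent_cases[OF p u] .
    obtain y b where y: "y \<in> base.T (snd p)" "v = S_tangent N p y b"
      using S_tangent_cases[OF p v] .
    show ?thesis
      unfolding x(2) y(2) S_tangent_lincomb S_phi_S_tangent[OF p x(1)] S_phi_S_tangent[OF p y(1)]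
        S_phi_S_tangent[OF p base.T_lincomb[OF q x(1) y(1)]] base.A_lincomb[OF q x(1) y(1)]
      by simp
  qed
  show "linear_on_space (tangent_space SN p) (S_phi N P p)"
    unfolding linear_on_space_def
  proof (intro conjI ballI allI)
    fix u v assume uv: "u \<in> tangent_space SN p" "v \<in> tangent_space SN p"
    show "S_phi N P p (u + v) = S_phi N P p u + S_phi N P p v"
      using lc[OF uv, of 1 1] by simp
  next
    fix r u assume u: "u \<in> tangent_space SN p"
    show "S_phi N P p (r *\<^sub>R u) = r *\<^sub>R S_phi N P p u"
      using lc[OF u u, of r 0] by simp
  qed
next
  fix U X assume "vector_field_on SN U X"
  then show "vector_field_on SN U (\<lambda>p. S_phi N P p (X p))"
    by (rule S_phi_vector_field[OF P_endo])
qed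

lemma h_self_nonneg: "q \<in> pts N \<Longrightarrow> x \<in> base.T q \<Longrightarrow> h q x x \<ge> 0"
  and h_self_pos: "q \<in> pts N \<Longrightarrow> x \<in> base.T q \<Longrightarrow> x \<noteq> 0 \<Longrightarrow> h q x x > 0"
proof -
  assume q: "q \<in> pts N" and x: "x \<in> base.T q"
  show pos: "x \<noteq> 0 \<Longrightarrow> h q x x > 0" using h_metric q x unfolding riemannian_metric_def by blast
  show "h q x x \<ge> 0"
  proof (cases "x = 0")
    case True
    then show ?thesis using base.g_scale_right[OF q x x, of 0] by simp
  qed (use pos in simp)
qed

lemma S_metric_riemannian: "riemannian_metric SN (S_metric N P h)"
  unfolding riemannian_metric_def
proof (intro conjI ballI allI impI)
  fix p u assume p: "p \<in> pts SN" and u: "u \<in> tangent_space SN p"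
  note q = S_pts_snd[OF p]
  let ?T = "base.T (snd p)" and ?h = "h (snd p)" and ?P = "P (snd p)"
  obtain x a where x: "x \<in> ?T" "u = S_tangent N p x a" using S_tangent_cases[OF p u] .
  have lc: "S_metric N P h p u (r *\<^sub>R v + s *\<^sub>R w) = r * S_metric N P h p u v + s * S_metric N P h p u w"
    if v: "v \<in> tangent_space SN p" and w: "w \<in> tangent_space SN p" for v w r s
  proof -
    obtain y b where y: "y \<in> ?T" "v = S_tangent N p y b" using S_tangent_cases[OF p v] .
    obtain z c where z: "z \<in> ?T" "w = S_tangent N p z c" using S_tangent_cases[OF p w] .
    show ?thesis
      unfolding x(2) y(2) z(2) S_tangent_lincomb S_metric_S_tangent[OF p x(1) y(1)]
        S_metric_S_tangent[OF p x(1) z(1)] S_metric_S_tangent[OF p x(1) base.T_lincomb[OF q y(1) z(1)]]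
        base.A_lincomb[OF q y(1) z(1)] base.g_lincomb_right[OF q x(1) y(1) z(1)]
        base.g_lincomb_right[OF q x(1) P_mem[OF q y(1)] P_mem[OF q z(1)]]
      by (simp add: algebra_simps)
  qed
  show "linear_on_space (tangent_space SN p) (S_metric N P h p u)"
    unfolding linear_on_space_def
  proof (intro conjI ballI allI)
    fix v w assume vw: "v \<in> tangent_space SN p" "w \<in> tangent_space SN p"
    show "S_metric N P h p u (v + w) = S_metric N P h p u v + S_metric N P h p u w"
      using lc[OF vw, of 1 1] by simp
  next
    fix r v assume v: "v \<in> tangent_space SN p"
    show "S_metric N P h p u (r *\<^sub>R v) = r *\<^sub>R S_metric N P h p u v"
      using lc[OF v v, of r 0] by simp
  qed
  show "S_metric N P h p u v = S_metric N P h p v u" if v: "v \<in> tangent_space SN p" for v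
  proof -
    obtain y b where y: "y \<in> ?T" "v = S_tangent N p y b" using S_tangent_cases[OF p v] .
    have "?h x (?P y) = ?h y (?P x)"
      using base.self_adjoint[OF q x(1) y(1)] base.g_sym[OF q y(1) P_mem[OF q x(1)]] by simp
    then show ?thesis
      unfolding x(2) y(2) S_metric_S_tangent[OF p x(1) y(1)] S_metric_S_tangent[OF p y(1) x(1)]
      using base.g_sym[OF q x(1) y(1)] by simp
  qed
  show "S_metric N P h p u u > 0" if "u \<noteq> 0"
  proof -
    let ?ch = "cosh (2 * fst p)" and ?sh = "sinh (2 * fst p)"
    \<comment> \<open>\<open>h (x + P x, x + P x) \<ge> 0\<close> gives \<open>h (x, P x) \<ge> - h (x, x)\<close>, while \<open>cosh > sinh > 0\<close>.\<close>
    have "?h (1 *\<^sub>R x + 1 *\<^sub>R ?P x) (1 *\<^sub>R x + 1 *\<^sub>R ?P x) \<ge> 0"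
      using h_self_nonneg[OF q base.T_lincomb[OF q x(1) P_mem[OF q x(1)]]] .
    then have "?h x (?P x) \<ge> - ?h x x"
      unfolding base.g_lincomb_right[OF q base.T_lincomb[OF q x(1) P_mem[OF q x(1)]] x(1) P_mem[OF q x(1)]]
        base.g_lincomb_left[OF q x(1) x(1) P_mem[OF q x(1)]]
        base.g_lincomb_left[OF q P_mem[OF q x(1)] x(1) P_mem[OF q x(1)]]
      using P_isometry[OF q x(1) x(1)] base.g_sym[OF q x(1) P_mem[OF q x(1)]] by simp
    then have "?sh * ?h x (?P x) \<ge> ?sh * (- ?h x x)"
      by (rule mult_left_mono) (use S_pts_fst[OF p] in simp)
    then have ge: "S_metric N P h p u u \<ge> a * a + (?ch - ?sh) * ?h x x"
      unfolding x(2) S_metric_S_tangent[OF p x(1) x(1)] by (simp add: algebra_simps)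
    have cs: "?ch - ?sh > 0" by (simp add: cosh_minus_sinh)
    show ?thesis
    proof (cases "x = 0")
      case True
      have "a \<noteq> 0"
      proof
        assume "a = 0"
        then have "u = 0" unfolding x(2) True by (simp add: S_tangent_def fun_eq_iff)
        then show False using that by simp
      qed
      then have "a * a > 0" by (simp add: zero_less_mult_iff) linarith
      moreover have "(?ch - ?sh) * ?h x x \<ge> 0" using cs h_self_nonneg[OF q x(1)] by simp
      ultimately show ?thesis using ge by linarith
    next
      case False
      then have "(?ch - ?sh) * ?h x x > 0" using cs h_self_pos[OF q x(1)] by simp
      moreover have "a * a \<ge> 0" by simp
      ultimately show ?thesis using ge by linarith
    qed
  qed
next
  fix U X Y assume X: "vector_field_on SN U X" and Y: "vector_field_on SN U Y"
  note U = S.vector_field_on_openin[OF X]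
  have sub: "U \<subseteq> pts SN" using openin_subset[OF U] .
  have hp: "smooth_fun_on SN U (\<lambda>p. h (snd p) (N_part N p (X p)) (N_part N p (Y p)))"
  proof (rule smooth_fun_on_bilinear_N_part[OF _ _ _ X Y])
    fix q x assume "q \<in> pts N" "x \<in> base.T q"
    then show "linear_on_space (base.T q) (\<lambda>y. h q y x)"
        "linear_on_space (base.T q) (h q x)"
      using base.g_lincomb_left[of q x _ _ 1 1] base.g_lincomb_right[of q x _ _ 1 1]
        base.g_scale_left[of q x] base.g_scale_right[of q x]
      by (auto simp: linear_on_space_def)
  next
    fix U Y Z assume "vector_field_on N U Y" "vector_field_on N U Z"
    then show "smooth_fun_on N U (\<lambda>q. h q (Y q) (Z q))" by (rule base.g_smooth)
  qed
  have hPp: "smooth_fun_on SN U (\<lambda>p. h (snd p) (N_part N p (X p)) (P (snd p) (N_part N p (Y p))))"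
  proof (rule smooth_fun_on_bilinear_N_part[where B = "\<lambda>q x y. h q x (P q y)", OF _ _ _ X Y])
    fix q x assume q: "q \<in> pts N" "x \<in> base.T q"
    then show "linear_on_space (base.T q) (\<lambda>y. h q y (P q x))"
      using base.g_lincomb_left[of q "P q x" _ _ 1 1] base.g_scale_left[of q "P q x"] P_mem
      by (auto simp: linear_on_space_def)
    show "linear_on_space (base.T q) (\<lambda>y. h q x (P q y))"
      using q base.g_lincomb_right[of q x _ _ 1 1] base.g_scale_right[of q x] P_mem
        base.A_lincomb[of q _ _ 1 1] base.A_lincomb[of q _ _ _ 0]
      by (auto simp: linear_on_space_def)
  next
    fix U Y Z assume Y: "vector_field_on N U Y" and Z: "vector_field_on N U Z"
    show "smooth_fun_on N U (\<lambda>q. h q (Y q) (P q (Z q)))"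
      by (rule base.g_smooth[OF Y base.A_field[OF Z]])
  qed
  have two: "smooth_on UNIV (\<lambda>t::real. 2 * t)"
    by (intro smooth_on_bounded_linear bounded_linear_mult_right)
  have ch: "smooth_fun_on SN U (\<lambda>p. cosh (2 * fst p))"
    by (rule S.smooth_fun_on_subset[OF smooth_fun_on_fst U sub])
       (rule smooth_on_compose[OF open_UNIV _ smooth_on_cosh_sinh(1)[of UNIV] two], simp)
  have sh: "smooth_fun_on SN U (\<lambda>p. sinh (2 * fst p))"
    by (rule S.smooth_fun_on_subset[OF smooth_fun_on_fst U sub])
       (rule smooth_on_compose[OF open_UNIV _ smooth_on_cosh_sinh(2)[of UNIV] two], simp)
  show "smooth_fun_on SN U (\<lambda>p. S_metric N P h p (X p) (Y p))"
    unfolding S_metric_def associated_metric_def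
    by (intro S.smooth_fun_on_add S.smooth_fun_on_mult S_eta_smooth[OF X] S_eta_smooth[OF Y] ch sh hp hPp)
qed

lemma S_phi_self_adjoint:
  assumes p: "p \<in> pts SN" and "u \<in> tangent_space SN p" "v \<in> tangent_space SN p"
  shows "S_metric N P h p (S_phi N P p u) v = S_metric N P h p u (S_phi N P p v)"
proof -
  note q = S_pts_snd[OF p]
  obtain x a where x: "x \<in> base.T (snd p)" "u = S_tangent N p x a"
    using S_tangent_cases[OF p assms(2)] .
  obtain y b where y: "y \<in> base.T (snd p)" "v = S_tangent N p y b"
    using S_tangent_cases[OF p assms(3)] .
  show ?thesis
    unfolding x(2) y(2) S_phi_S_tangent[OF p x(1)] S_phi_S_tangent[OF p y(1)]
      S_metric_S_tangent[OF p P_mem[OF q x(1)] y(1)] S_metric_S_tangent[OF p x(1) P_mem[OF q y(1)]]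
    using base.self_adjoint[OF q x(1) y(1)] base.self_adjoint[OF q x(1) P_mem[OF q y(1)]]
    by simp
qed

lemma S_phi_squared:
  assumes p: "p \<in> pts SN" and "u \<in> tangent_space SN p"
  shows "S_phi N P p (S_phi N P p u) = u - S_eta p u *\<^sub>R S_xi N p"
proof -
  note q = S_pts_snd[OF p]
  obtain x a where x: "x \<in> base.T (snd p)" "u = S_tangent N p x a"
    using S_tangent_cases[OF p assms(2)] .
  have "u - S_eta p u *\<^sub>R S_xi N p = S_tangent N p x 0"
    using S_tangent_lincomb[of 1 p x a "-a" 0 1] S_eta_S_tangent[OF p x(1)]
    by (simp add: x(2) S_xi_def)
  then show ?thesis
    unfolding x(2) S_phi_S_tangent[OF p x(1)] S_phi_S_tangent[OF p P_mem[OF q x(1)]]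
      P_involution[OF q x(1)] by simp
qed

lemma S_phi_xi: "p \<in> pts SN \<Longrightarrow> S_phi N P p (S_xi N p) = 0"
proof -
  assume p: "p \<in> pts SN"
  note q = S_pts_snd[OF p]
  have "P (snd p) 0 = 0" using base.A_lincomb[OF q zero_tangent[OF q] zero_tangent[OF q], of 0 0] by simp
  then show ?thesis
    unfolding S_xi_def S_phi_S_tangent[OF p zero_tangent[OF q]] by (simp add: S_tangent_def fun_eq_iff)
qed

sublocale cone: levi_civita_endo "S_mfd N" "S_metric N P h" "S_phi N P" D
proof
  fix p x assume p: "p \<in> pts SN" and x: "x \<in> tangent_space SN p"
  note q = S_pts_snd[OF p]
  obtain y a where y: "y \<in> base.T (snd p)" "x = S_tangent N p y a"
    using S_tangent_cases[OF p x] .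
  show "S_phi N P p (S_phi N P p (S_phi N P p x)) = S_phi N P p x"
    unfolding y(2) S_phi_S_tangent[OF p y(1)] S_phi_S_tangent[OF p P_mem[OF q y(1)]]
      P_involution[OF q y(1)] ..
qed (use S_metric_riemannian lcS S_phi_endomorphism_field S_phi_self_adjoint in auto)

text \<open>If \<open>P = 1\<close> or \<open>P = -1\<close> on the tangent plane, the trace would be \<open>2\<close> or \<open>-2\<close>. So \<open>1 + P\<close> and \<open>1 - P\<close>
  are both nonzero, and their images consist of eigenvectors.\<close>

lemma P_eigenbasis:
  assumes q: "q \<in> pts N"
  obtains u v where "u \<in> base.T q" "v \<in> base.T q" "P q u = u" "P q v = - v"
    "u \<noteq> 0" "v \<noteq> 0" "independent {u, v}" "span {u, v} = base.T q" "u \<noteq> v"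
proof -
  let ?T = "base.T q"
  note sub = tangent_space_subspace[OF q]
  obtain B where B: "B \<subseteq> ?T" "independent B" "?T \<subseteq> span B" "card B = dim ?T"
    using basis_exists by blast
  have cB: "card B = 2" using B(4) tangent_space_dim[OF q] dim2 by simp
  then have fB: "finite B" by (metis card.infinite zero_neq_numeral)
  have sB: "span B = ?T" using B(1,3) sub by (simp add: span_minimal subset_antisym)
  have lin: "linear_on_space ?T (P q)" "P q ` ?T \<subseteq> ?T"
    using P_endo q unfolding endomorphism_field_def by blast+
  have tr: "(\<Sum>b\<in>B. representation B (P q b) b) = 0"
    using trace_on_basis[OF lin B(2) fB sB] P_trace[OF q] by simp
  have "\<exists>x\<in>?T. P q x \<noteq> x"
  proof (rule ccontr)
    assume "\<not> (\<exists>x\<in>?T. P q x \<noteq> x)"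
    then have "representation B (P q b) b = 1" if "b \<in> B" for b
      using that B(1) representation_basis[OF B(2) that] by auto
    then show False using tr cB by simp
  qed
  then obtain x where x: "x \<in> ?T" "P q x \<noteq> x" by blast
  have "\<exists>x\<in>?T. P q x \<noteq> - x"
  proof (rule ccontr)
    assume "\<not> (\<exists>x\<in>?T. P q x \<noteq> - x)"
    then have "representation B (P q b) b = -1" if "b \<in> B" for b
      using that B(1) representation_basis[OF B(2) that]
        representation_neg[OF B(2) span_base[OF that]] by auto
    then show False using tr cB by simp
  qed
  then obtain y where y: "y \<in> ?T" "P q y \<noteq> - y" by blast
  define u where "u = 1 *\<^sub>R y + 1 *\<^sub>R P q y"
  define v where "v = 1 *\<^sub>R x + (-1) *\<^sub>R P q x"
  have uT: "u \<in> ?T" and vT: "v \<in> ?T"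
    unfolding u_def v_def using base.T_lincomb[OF q] x(1) y(1) P_mem[OF q] by blast+
  have Pu: "P q u = u"
    unfolding u_def base.A_lincomb[OF q y(1) P_mem[OF q y(1)]] P_involution[OF q y(1)] by simp
  have Pv: "P q v = - v"
    unfolding v_def base.A_lincomb[OF q x(1) P_mem[OF q x(1)]] P_involution[OF q x(1)] by simp
  have u0: "u \<noteq> 0" unfolding u_def using y(2) by (simp add: add_eq_0_iff)
  have v0: "v \<noteq> 0" unfolding v_def using x(2) by simp
  have uv: "u \<notin> span {v}"
  proof
    assume "u \<in> span {v}"
    then obtain k where k: "u = k *\<^sub>R v" by (auto simp: span_singleton)
    have "u = P q (k *\<^sub>R v)" using Pu k by simp
    also have "\<dots> = - u" using base.A_lincomb[OF q vT vT, of k 0] Pv k by simp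
    finally have "2 *\<^sub>R u = 0" by (simp add: scaleR_2 eq_neg_iff_add_eq_0)
    then show False using u0 by simp
  qed
  have ind: "independent {u, v}"
    using uv v0 by (simp add: independent_insertI)
  have ne: "u \<noteq> v" using uv span_base[of v "{v}"] by auto
  have "?T \<subseteq> span {u, v}"
  proof
    fix z assume z: "z \<in> ?T"
    show "z \<in> span {u, v}"
    proof (rule ccontr)
      assume n: "z \<notin> span {u, v}"
      then have "independent (insert z {u, v})" by (rule independent_insertI[OF _ ind])
      moreover have "insert z {u, v} \<subseteq> span B" using z uT vT sB by auto
      ultimately have "card (insert z {u, v}) \<le> card B" using independent_span_bound[OF fB] by blast
      moreover have "z \<noteq> u" "z \<noteq> v" using n span_base[of _ "{u, v}"] by auto
      ultimately show False using ne cB by simp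
    qed
  qed
  moreover have "span {u, v} \<subseteq> ?T" by (rule span_minimal[OF _ sub]) (use uT vT in simp)
  ultimately show thesis using that[OF uT vT Pu Pv u0 v0 ind _ ne] by blast
qed

end

context paracomplex_cone
begin

lemma span_triple_intro: "x = a *\<^sub>R u + b *\<^sub>R v + c *\<^sub>R w \<Longrightarrow> x \<in> span {u, v, w}"
  by (simp add: span_add span_scale span_base)

lemma S_tangent_span:
  assumes p: "p \<in> pts SN" and uv: "u \<in> base.T (snd p)" "v \<in> base.T (snd p)"
    and span: "span {u, v} = base.T (snd p)"
  shows "span {S_xi N p, S_tangent N p u 0, S_tangent N p v 0} = cone.T p"
proof
  have "{S_xi N p, S_tangent N p u 0, S_tangent N p v 0} \<subseteq> cone.T p"
    using S_xi_tangent[OF p] S_tangent_in[OF p] uv by blast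
  then show "span {S_xi N p, S_tangent N p u 0, S_tangent N p v 0} \<subseteq> cone.T p"
    by (rule span_minimal[OF _ S.tangent_space_subspace[OF p]])
  show "cone.T p \<subseteq> span {S_xi N p, S_tangent N p u 0, S_tangent N p v 0}"
  proof
    fix x assume x: "x \<in> cone.T p"
    obtain y c where y: "y \<in> base.T (snd p)" "x = S_tangent N p y c"
      using S_tangent_cases[OF p x] .
    then have "y \<in> span {u, v}" using span by simp
    then obtain a b where "y = a *\<^sub>R u + b *\<^sub>R v"
      unfolding span_insert span_singleton by (auto simp: algebra_simps)
    then have "x = c *\<^sub>R S_xi N p + a *\<^sub>R S_tangent N p u 0 + b *\<^sub>R S_tangent N p v 0"
      using S_tangent_lincomb[of c p 0 1 a u 0] S_tangent_lincomb[of 1 p "a *\<^sub>R u" c b v 0]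
      by (simp add: y(2) S_xi_def)
    then show "x \<in> span {S_xi N p, S_tangent N p u 0, S_tangent N p v 0}"
      by (rule span_triple_intro)
  qed
qed

lemma S_phi_trace:
  assumes p: "p \<in> pts SN" shows "trace_on (cone.T p) (S_phi N P p) = 0"
proof -
  note q = S_pts_snd[OF p]
  obtain u v where u: "u \<in> base.T (snd p)" "P (snd p) u = u" "u \<noteq> 0"
    and v: "v \<in> base.T (snd p)" "P (snd p) v = - v" "v \<noteq> 0"
    and uv: "independent {u, v}" "span {u, v} = base.T (snd p)" "u \<noteq> v"
    using P_eigenbasis[OF q] by metis
  let ?u = "S_tangent N p u 0" and ?v = "S_tangent N p v 0" and ?x = "S_xi N p"
  let ?B = "{?x, ?u, ?v}"
  have "u \<notin> span {v}" using uv(1,3) by (simp add: independent_insert)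
  have "?u \<notin> span {?v}"
  proof
    assume "?u \<in> span {?v}"
    then obtain k where "?u = k *\<^sub>R ?v" by (auto simp: span_singleton)
    also have "\<dots> = S_tangent N p (k *\<^sub>R v) 0" using S_tangent_lincomb[of k p v 0 0 v 0] by simp
    finally have "N_part N p ?u = N_part N p (S_tangent N p (k *\<^sub>R v) 0)" by simp
    then have "u = k *\<^sub>R v"
      using N_part_S_tangent[OF p u(1)] N_part_S_tangent[OF p, of "k *\<^sub>R v"]
        base.T_lincomb[OF q v(1) v(1), of k 0] by simp
    then show False using \<open>u \<notin> span {v}\<close> by (auto simp: span_singleton)
  qed
  moreover have "?v \<noteq> 0"
  proof
    assume "?v = 0"
    also have "0 = S_tangent N p 0 0" by (simp add: S_tangent_def fun_eq_iff)
    finally have "N_part N p ?v = N_part N p (S_tangent N p 0 0)" by simp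
    then show False using N_part_S_tangent[OF p v(1)] N_part_S_tangent[OF p zero_tangent[OF q]] v(3) by simp
  qed
  ultimately have i: "independent {?u, ?v}" by (simp add: independent_insertI)
  have "subspace {w. S_eta p w = 0}"
    by (auto simp: subspace_def S_eta_def scaleR_fun_def)
  then have "span {?u, ?v} \<subseteq> {w. S_eta p w = 0}"
    by (intro span_minimal) (simp_all add: S_eta_S_tangent[OF p] u v)
  moreover have "S_eta p ?x = 1" using S_eta_xi[OF p] .
  ultimately have x: "?x \<notin> span {?u, ?v}" by auto
  have ind: "independent ?B" using independent_insertI[OF x i] .
  have ne: "?x \<noteq> ?u" "?x \<noteq> ?v" "?u \<noteq> ?v"
    using x span_base[of _ "{?u, ?v}"] \<open>?u \<notin> span {?v}\<close> span_base[of ?v "{?v}"] by auto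
  have sp: "span ?B = cone.T p" by (rule S_tangent_span[OF p u(1) v(1) uv(2)])
  have Pv: "S_phi N P p ?v = - ?v"
    using S_phi_S_tangent[OF p v(1)] S_tangent_lincomb[of "-1" p v 0 0 v 0] v(2) by simp
  have Pu: "S_phi N P p ?u = ?u" using S_phi_S_tangent[OF p u(1)] u(2) by simp
  have lin: "linear_on_space (cone.T p) (S_phi N P p)"
    "S_phi N P p ` cone.T p \<subseteq> cone.T p"
    using S_phi_endomorphism_field p unfolding endomorphism_field_def by blast+
  have "trace_on (cone.T p) (S_phi N P p) = (\<Sum>b\<in>?B. representation ?B (S_phi N P p b) b)"
    by (rule trace_on_basis[OF lin ind _ sp]) simp
  also have "\<dots> = representation ?B 0 ?x + (representation ?B ?u ?u + representation ?B (- ?v) ?v)"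
    using ne by (simp add: S_phi_xi[OF p] Pu Pv)
  also have "\<dots> = 0"
    by (simp add: representation_neg[OF ind span_base] representation_basis[OF ind] representation_zero)
  finally show ?thesis .
qed

lemma S_apapR: "apapR_manifold SN (S_phi N P) (S_xi N) S_eta (S_metric N P h)"
  unfolding apapR_manifold_def
proof (intro conjI ballI)
  show "odd DIM(real \<times> 'e)" using dim2 by simp
  show "one_form SN S_eta"
    unfolding one_form_def linear_on_space_def
    using S_eta_smooth by (auto simp: S_eta_def scaleR_fun_def)
  fix p assume p: "p \<in> pts SN"
  note q = S_pts_snd[OF p]
  show "S_eta p (S_xi N p) = 1" "S_phi N P p (S_xi N p) = 0"
    "trace_on (cone.T p) (S_phi N P p) = 0"
    by (rule S_eta_xi[OF p] S_phi_xi[OF p] S_phi_trace[OF p])+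
  fix u assume u: "u \<in> cone.T p"
  show "S_phi N P p (S_phi N P p u) = u - S_eta p u *\<^sub>R S_xi N p"
    by (rule S_phi_squared[OF p u])
  obtain x a where x: "x \<in> base.T (snd p)" "u = S_tangent N p x a"
    using S_tangent_cases[OF p u] .
  show "S_eta p (S_phi N P p u) = 0"
    unfolding x(2) S_phi_S_tangent[OF p x(1)] by (rule S_eta_S_tangent[OF p P_mem[OF q x(1)]])
  fix v assume v: "v \<in> cone.T p"
  obtain y b where y: "y \<in> base.T (snd p)" "v = S_tangent N p y b"
    using S_tangent_cases[OF p v] .
  note Px = P_mem[OF q x(1)] and Py = P_mem[OF q y(1)]
  show "S_metric N P h p (S_phi N P p u) (S_phi N P p v) = S_metric N P h p u v - S_eta p u * S_eta p v"
    unfolding x(2) y(2) S_phi_S_tangent[OF p x(1)] S_phi_S_tangent[OF p y(1)]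
      S_metric_S_tangent[OF p Px Py] S_metric_S_tangent[OF p x(1) y(1)]
      S_eta_S_tangent[OF p x(1)] S_eta_S_tangent[OF p y(1)]
      P_isometry[OF q x(1) y(1)] P_isometry[OF q x(1) Py] by simp
qed (rule S_smooth_manifold S_phi_endomorphism_field S_xi_vector_field S_metric_riemannian)+

section \<open>The fundamental tensor of the cone\<close>

abbreviation "G \<equiv> S_metric N P h"

lemma xi_field: "openin (mtop SN) U \<Longrightarrow> vector_field_on SN U (S_xi N)"
  by (rule S.vector_field_on_subset[OF S_xi_vector_field]) (auto dest: openin_subset)

lemma G_xi_S_tangent:
  assumes "p \<in> pts SN" "x \<in> base.T (snd p)"
  shows "G p (S_xi N p) (S_tangent N p x a) = a"
  using S_metric_S_tangent[OF assms(1) zero_tangent[OF S_pts_snd[OF assms(1)]] assms(2), of 1 a]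
    base.g_scale_left[OF S_pts_snd[OF assms(1)] _ assms(2), of _ 0] assms(2)
    P_mem[OF S_pts_snd[OF assms(1)] assms(2)]
    base.g_scale_left[OF S_pts_snd[OF assms(1)] P_mem[OF S_pts_snd[OF assms(1)] assms(2)] assms(2), of 0]
  by (simp add: S_xi_def)

lemma G_lift:
  assumes "vector_field_on N W Y" "vector_field_on N W Z" "p \<in> {0<..} \<times> W"
  shows "G p (lift Y p) (lift Z p) = cosh (2 * fst p) * h (snd p) (Y (snd p)) (Z (snd p))
    + sinh (2 * fst p) * h (snd p) (Y (snd p)) (P (snd p) (Z (snd p)))"
proof -
  have "p \<in> pts SN"
    using S.vector_field_on_pts[OF lift_vector_field[OF assms(1)] assms(3)] .
  moreover have "snd p \<in> W" using assms(3) by auto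
  ultimately show ?thesis
    using S_metric_S_tangent[of p "Y (snd p)" "Z (snd p)" 0 0]
      vector_field_on_tangent[OF assms(1)] vector_field_on_tangent[OF assms(2)]
    by (simp add: lift_def)
qed

lemma D_xi_orthogonal_xi:
  assumes p: "p \<in> pts SN" and x: "x \<in> cone.T p"
  shows "G p (D p x (S_xi N)) (S_xi N p) = 0"
proof -
  have "x (\<lambda>q. G q (S_xi N q) (S_xi N q)) = x (\<lambda>q. 1)"
    by (rule S.tangent_vec_local[OF p x openin_topspace p])
       (metis G_xi_S_tangent S_pts_snd S_xi_def zero_tangent)
  then have "G p (D p x (S_xi N)) (S_xi N p) + G p (S_xi N p) (D p x (S_xi N)) = 0"
    using cone.D_metric[OF S_xi_vector_field S_xi_vector_field p x] S.tangent_vec_const[OF p x] by simp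
  then show ?thesis
    using cone.g_sym[OF p S_xi_tangent[OF p] cone.D_mem[OF S_xi_vector_field p x]] by simp
qed

lemma D_xi_lift:
  assumes Y: "vector_field_on N W Y" and p: "p \<in> {0<..} \<times> W"
  shows "D p (S_xi N p) (lift Y) = D p (lift Y p) (S_xi N)"
proof -
  note LY = lift_vector_field[OF Y]
  note xi = xi_field[OF S.vector_field_on_openin[OF LY]]
  show ?thesis
    using cone.D_torsion[OF xi LY p] S_lie_bracket_xi_lift[OF Y p cone.lie_bracket_tangent[OF xi LY p]]
    by simp
qed

lemma G_xi_lift_derivative:
  assumes Y: "vector_field_on N W Y" and p: "p \<in> {0<..} \<times> W" and v: "v \<in> cone.T p"
  shows "v (\<lambda>q. G q (S_xi N q) (lift Y q)) = 0"
proof -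
  note LY = lift_vector_field[OF Y]
  note U = S.vector_field_on_openin[OF LY]
  have pM: "p \<in> pts SN" using S.vector_field_on_pts[OF LY p] .
  have "v (\<lambda>q. G q (S_xi N q) (lift Y q)) = v (\<lambda>q. 0)"
  proof (rule S.tangent_vec_local[OF pM v U p])
    fix q assume q: "q \<in> {0::real<..} \<times> W"
    then have "Y (snd q) \<in> base.T (snd q)" using vector_field_on_tangent[OF Y] by auto
    then show "G q (S_xi N q) (lift Y q) = 0"
      unfolding lift_def by (rule G_xi_S_tangent[OF S.vector_field_on_pts[OF LY q]])
  qed
  then show ?thesis using S.tangent_vec_const[OF pM v] by simp
qed

lemma D_xi_xi_orthogonal_lift:
  assumes Y: "vector_field_on N W Y" and p: "p \<in> {0<..} \<times> W"
  shows "G p (D p (S_xi N p) (S_xi N)) (lift Y p) = 0"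
proof -
  note LY = lift_vector_field[OF Y]
  note xi = xi_field[OF S.vector_field_on_openin[OF LY]]
  have pM: "p \<in> pts SN" using S.vector_field_on_pts[OF LY p] .
  note tx = S_xi_tangent[OF pM] and tY = lift_tangent[OF Y p]
  have "G p (D p (S_xi N p) (S_xi N)) (lift Y p) + G p (S_xi N p) (D p (S_xi N p) (lift Y)) = 0"
    using cone.D_metric[OF xi LY p tx] G_xi_lift_derivative[OF Y p tx] by simp
  moreover have "G p (S_xi N p) (D p (S_xi N p) (lift Y)) = 0"
    using D_xi_orthogonal_xi[OF pM tY] cone.g_sym[OF pM tx cone.D_mem[OF xi p tY]]
    by (simp add: D_xi_lift[OF Y p])
  ultimately show ?thesis by simp
qed

text \<open>The \<open>t\<close>-derivative of \<open>cosh 2t h(Y, Z) + sinh 2t h(Y, P Z)\<close> exchanges \<open>cosh\<close> and \<open>sinh\<close>. By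
  \<open>P\<^sup>2 = 1\<close> this amounts to replacing \<open>Y\<close> by \<open>P Y\<close>, up to the factor \<open>2\<close>.\<close>

lemma G_lift_derivative_xi:
  assumes Y: "vector_field_on N W Y" and Z: "vector_field_on N W Z" and p: "p \<in> {0<..} \<times> W"
  shows "S_xi N p (\<lambda>q. G q (lift Y q) (lift Z q)) = 2 * G p (S_phi N P p (lift Y p)) (lift Z p)"
proof -
  note LY = lift_vector_field[OF Y] and LZ = lift_vector_field[OF Z]
  note U = S.vector_field_on_openin[OF LY]
  have pM: "p \<in> pts SN" using S.vector_field_on_pts[OF LY p] .
  note q = S_pts_snd[OF pM]
  have pW: "snd p \<in> W" using p by auto
  note tY = vector_field_on_tangent[OF Y pW] and tZ = vector_field_on_tangent[OF Z pW]
  let ?a = "\<lambda>r. h r (Y r) (Z r)" and ?b = "\<lambda>r. h r (Y r) (P r (Z r))"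
  let ?f = "\<lambda>q. cosh (2 * fst q) * ?a (snd q) + sinh (2 * fst q) * ?b (snd q)"
  have "smooth_near SN p (\<lambda>q. G q (lift Y q) (lift Z q))"
    by (rule S.smooth_nearI[OF cone.g_smooth[OF LY LZ] p])
  then have sn: "smooth_near SN p ?f"
    by (rule S.smooth_near_cong[OF U p G_lift[OF Y Z], rotated])
  have "S_xi N p (\<lambda>q. G q (lift Y q) (lift Z q)) = S_xi N p ?f"
    by (rule S.tangent_vec_local[OF pM S_xi_tangent[OF pM] U p G_lift[OF Y Z]])
  also have "\<dots> = deriv (\<lambda>t. cosh (2 * t) * ?a (snd p) + sinh (2 * t) * ?b (snd p)) (fst p)"
    using sn by (simp add: S_xi_def S_tangent_def)
  also have "\<dots> = 2 * sinh (2 * fst p) * ?a (snd p) + 2 * cosh (2 * fst p) * ?b (snd p)"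
    by (rule DERIV_imp_deriv) (auto intro!: derivative_eq_intros)
  also have "\<dots> = 2 * G p (S_phi N P p (lift Y p)) (lift Z p)"
    unfolding lift_def S_phi_S_tangent[OF pM tY] S_metric_S_tangent[OF pM P_mem[OF q tY] tZ]
      base.self_adjoint[OF q tY tZ] base.self_adjoint[OF q tY P_mem[OF q tZ]] P_involution[OF q tZ]
    by simp
  finally show ?thesis .
qed

text \<open>The form \<open>g(\<nabla>\<^sub>Y \<xi>, Z) = - g(\<xi>, \<nabla>\<^sub>Y Z)\<close> is symmetric on lifted fields, because their brackets are
  orthogonal to \<open>\<xi>\<close>. Since \<open>\<nabla>\<^sub>\<xi> Y = \<nabla>\<^sub>Y \<xi>\<close>, it is half of the derivative of \<open>g(Y, Z)\<close> along \<open>\<xi>\<close>.\<close>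

lemma D_lift_xi:
  assumes Y: "vector_field_on N W Y" and Z: "vector_field_on N W Z" and p: "p \<in> {0<..} \<times> W"
  shows "G p (D p (lift Y p) (S_xi N)) (lift Z p) = G p (S_phi N P p (lift Y p)) (lift Z p)"
proof -
  note LY = lift_vector_field[OF Y] and LZ = lift_vector_field[OF Z]
  note xi = xi_field[OF S.vector_field_on_openin[OF LY]]
  have pM: "p \<in> pts SN" using S.vector_field_on_pts[OF LY p] .
  have pW: "snd p \<in> W" using p by auto
  note tx = S_xi_tangent[OF pM] and tY = lift_tangent[OF Y p] and tZ = lift_tangent[OF Z p]
  have a: "2 * G p (S_phi N P p (lift Y p)) (lift Z p)
      = G p (D p (lift Y p) (S_xi N)) (lift Z p) + G p (lift Y p) (D p (lift Z p) (S_xi N))"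
    using cone.D_metric[OF LY LZ p tx]
    unfolding G_lift_derivative_xi[OF Y Z p] D_xi_lift[OF Y p] D_xi_lift[OF Z p] .
  have "G p (D p (lift Y p) (S_xi N)) (lift Z p) = - G p (S_xi N p) (D p (lift Y p) (lift Z))"
    using cone.D_metric[OF xi LZ p tY] G_xi_lift_derivative[OF Z p tY] by simp
  also have "D p (lift Y p) (lift Z) = D p (lift Z p) (lift Y)
      + S_tangent N p (lie_bracket N Y Z (snd p)) 0"
    using cone.D_torsion[OF LY LZ p]
      S_lie_bracket_lift[OF Y Z p base.lie_bracket_tangent[OF Y Z pW] cone.lie_bracket_tangent[OF LY LZ p]]
    by simp
  also have "G p (S_xi N p) \<dots> = G p (S_xi N p) (D p (lift Z p) (lift Y))"
    using cone.g_lincomb_right[OF pM tx cone.D_mem[OF LY p tZ]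
        S_tangent_in[OF pM base.lie_bracket_tangent[OF Y Z pW]], of 1 1 0]
      G_xi_S_tangent[OF pM base.lie_bracket_tangent[OF Y Z pW], of 0] by simp
  also have "- \<dots> = G p (D p (lift Z p) (S_xi N)) (lift Y p)"
    using cone.D_metric[OF xi LY p tZ] G_xi_lift_derivative[OF Y p tZ] by simp
  finally show ?thesis using a cone.g_sym[OF pM tY cone.D_mem[OF xi p tZ]] by simp
qed

lemma tangent_vec_lift:
  assumes p: "p \<in> pts SN" and x: "x \<in> cone.T p"
  obtains W Y a where "vector_field_on N W Y" "p \<in> {0<..} \<times> W" "x = 1 *\<^sub>R lift Y p + a *\<^sub>R S_xi N p"
proof -
  obtain y a where y: "y \<in> base.T (snd p)" "x = S_tangent N p y a"
    using S_tangent_cases[OF p x] .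
  obtain W Y where Y: "snd p \<in> W" "vector_field_on N W Y" "Y (snd p) = y"
    using tangent_vec_extend[OF S_pts_snd[OF p] y(1)] .
  have "x = 1 *\<^sub>R lift Y p + a *\<^sub>R S_xi N p"
    unfolding lift_def S_xi_def S_tangent_lincomb using y Y by simp
  moreover have "p \<in> {0<..} \<times> W" using Y(1) S_pts_fst[OF p] by (simp add: mem_Times_iff)
  ultimately show thesis using that Y(2) by blast
qed

lemma D_xi:
  assumes p: "p \<in> pts SN" and x: "x \<in> cone.T p"
  shows "D p x (S_xi N) = S_phi N P p x"
proof -
  note m = cone.D_mem[OF S_xi_vector_field p x] cone.A_mem[OF p x]
  note xT = S_xi_tangent[OF p]
  have "D p x (S_xi N) - S_phi N P p x = 0"
  proof (rule cone.g_nondegenerate[OF p cone.T_diff[OF p m]])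
    fix z assume z: "z \<in> cone.T p"
    obtain W1 Y a where Y: "vector_field_on N W1 Y" "p \<in> {0<..} \<times> W1"
      and xe: "x = 1 *\<^sub>R lift Y p + a *\<^sub>R S_xi N p" using tangent_vec_lift[OF p x] .
    obtain W2 Z b where Z: "vector_field_on N W2 Z" "p \<in> {0<..} \<times> W2"
      and ze: "z = 1 *\<^sub>R lift Z p + b *\<^sub>R S_xi N p" using tangent_vec_lift[OF p z] .
    have W: "openin (mtop N) (W1 \<inter> W2)" "p \<in> {0<..} \<times> (W1 \<inter> W2)"
      using vector_field_on_openin[OF Y(1)] vector_field_on_openin[OF Z(1)] Y(2) Z(2) by auto
    note Y' = vector_field_on_subset[OF Y(1) W(1) Int_lower1]
      and Z' = vector_field_on_subset[OF Z(1) W(1) Int_lower2]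
    note tY = lift_tangent[OF Y] and tZ = lift_tangent[OF Z]
    note DY = cone.D_mem[OF S_xi_vector_field p tY] and Dx = cone.D_mem[OF S_xi_vector_field p xT]
    have "G p (D p x (S_xi N)) z = G p (D p x (S_xi N)) (lift Z p)"
      unfolding ze cone.g_lincomb_right[OF p m(1) tZ xT] using D_xi_orthogonal_xi[OF p x] by simp
    also have "\<dots> = G p (D p (lift Y p) (S_xi N)) (lift Z p)"
      unfolding xe cone.D_lincomb_direction[OF S_xi_vector_field p tY xT]
        cone.g_lincomb_left[OF p tZ DY Dx] D_xi_xi_orthogonal_lift[OF Z] by simp
    also have "\<dots> = G p (S_phi N P p (lift Y p)) (lift Z p)"
      by (rule D_lift_xi[OF Y' Z' W(2)])
    also have "\<dots> = G p (S_phi N P p x) (lift Z p)"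
      unfolding xe cone.A_lincomb[OF p tY xT] S_phi_xi[OF p] by simp
    also have "\<dots> = G p (S_phi N P p x) z"
      unfolding ze cone.g_lincomb_right[OF p m(2) tZ xT]
      using cone.self_adjoint[OF p x xT] cone.g_scale_right[OF p x xT, of 0] S_phi_xi[OF p] by simp
    finally show "G p (D p x (S_xi N) - S_phi N P p x) z = 0"
      using cone.g_diff_left[OF p z m] by simp
  qed
  then show ?thesis by simp
qed

text \<open>Since \<open>\<phi> \<xi> = 0\<close>, one has \<open>(\<nabla>\<^sub>x \<phi>) \<xi> = - \<phi> (\<nabla>\<^sub>x \<xi>) = - \<phi>\<^sup>2 x\<close>; the rest is symmetry of \<open>F\<close>.\<close>

lemma cone_F_xi:
  assumes p: "p \<in> pts SN" and x: "x \<in> cone.T p" and y: "y \<in> cone.T p"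
  shows "cone.F p x y (S_xi N p) = - G p (S_phi N P p x) (S_phi N P p y)"
proof -
  note xT = S_xi_tangent[OF p] and px = cone.A_mem[OF p x]
  have "cone.nab p x (S_xi N) = 0 *\<^sub>R D p x (S_xi N) - S_phi N P p (D p x (S_xi N))"
    by (rule cone.nab_eigenfield[OF S_xi_vector_field p x]) (simp add: S_phi_xi)
  then have n: "cone.nab p x (S_xi N) = (-1) *\<^sub>R S_phi N P p (S_phi N P p x)"
    by (simp add: D_xi[OF p x])
  have "cone.F p x y (S_xi N p) = cone.F p x (S_xi N p) y" by (rule cone.F_sym[OF p x y xT])
  also have "\<dots> = G p (cone.nab p x (S_xi N)) y"
    by (rule cone.F_field[OF S_xi_vector_field p x])
  also have "\<dots> = - G p (S_phi N P p (S_phi N P p x)) y"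
    unfolding n using cone.g_scale_left[OF p y cone.A_mem[OF p px], of "-1"] by simp
  also have "\<dots> = - G p (S_phi N P p x) (S_phi N P p y)"
    using cone.self_adjoint[OF p px y] by simp
  finally show ?thesis .
qed

lemma S_phi_eigenvector:
  assumes p: "p \<in> pts SN" and y: "y \<in> cone.T p"
    and e: "S_phi N P p y = \<epsilon> *\<^sub>R y" "\<epsilon> \<noteq> 0"
  obtains y' where "y' \<in> base.T (snd p)" "y = S_tangent N p y' 0" "P (snd p) y' = \<epsilon> *\<^sub>R y'"
proof -
  note q = S_pts_snd[OF p]
  obtain y' a where y': "y' \<in> base.T (snd p)" "y = S_tangent N p y' a"
    using S_tangent_cases[OF p y] .
  have eq: "S_tangent N p (P (snd p) y') 0 = S_tangent N p (\<epsilon> *\<^sub>R y') (\<epsilon> * a)"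
    using e(1) S_tangent_lincomb[of \<epsilon> p y' a 0 y' a] unfolding y'(2) S_phi_S_tangent[OF p y'(1)] by simp
  have ey: "\<epsilon> *\<^sub>R y' \<in> base.T (snd p)" using base.T_lincomb[OF q y'(1) y'(1), of \<epsilon> 0] by simp
  have "\<epsilon> * a = 0"
    using arg_cong[OF eq, of "S_eta p"] S_eta_S_tangent[OF p P_mem[OF q y'(1)]] S_eta_S_tangent[OF p ey] by simp
  moreover have "P (snd p) y' = \<epsilon> *\<^sub>R y'"
    using arg_cong[OF eq, of "N_part N p"] N_part_S_tangent[OF p P_mem[OF q y'(1)]] N_part_S_tangent[OF p ey] by simp
  ultimately show thesis using that y' e(2) by simp
qed

lemma lift_eigenfield:
  assumes "vector_field_on N W Y" "\<And>q. q \<in> W \<Longrightarrow> P q (Y q) = \<epsilon> *\<^sub>R Y q" "p \<in> {0<..} \<times> W"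
  shows "S_phi N P p (lift Y p) = \<epsilon> *\<^sub>R lift Y p"
proof -
  have pM: "p \<in> pts SN" using S.vector_field_on_pts[OF lift_vector_field[OF assms(1)] assms(3)] .
  have pW: "snd p \<in> W" using assms(3) by auto
  show ?thesis
    unfolding lift_def S_phi_S_tangent[OF pM vector_field_on_tangent[OF assms(1) pW]] assms(2)[OF pW]
    using S_tangent_lincomb[of \<epsilon> p "Y (snd p)" 0 0 "Y (snd p)" 0] by simp
qed

text \<open>Extend \<open>y\<close> to a lifted eigenfield \<open>Y\<close>. Then \<open>\<nabla>\<^sub>\<xi> Y = \<nabla>\<^sub>Y \<xi> = \<phi> Y = Y\<close>, which is orthogonal to
  \<open>z\<close>.\<close>

lemma cone_F_xi_eigenvectors:
  assumes p: "p \<in> pts SN" and y: "y \<in> cone.T p" "S_phi N P p y = y"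
    and z: "z \<in> cone.T p" "S_phi N P p z = - z"
  shows "cone.F p (S_xi N p) y z = 0"
proof -
  obtain y' where y': "y' \<in> base.T (snd p)" "y = S_tangent N p y' 0" "P (snd p) y' = 1 *\<^sub>R y'"
    using S_phi_eigenvector[OF p y(1), of 1] y(2) by auto
  obtain W Y where Y: "snd p \<in> W" "vector_field_on N W Y" "Y (snd p) = y'"
      "\<And>q. q \<in> W \<Longrightarrow> P q (Y q) = 1 *\<^sub>R Y q"
    using base.eigenvector_extend[OF S_pts_snd[OF p] y'(1,3)] by auto
  have pW: "p \<in> {0<..} \<times> W" using Y(1) S_pts_fst[OF p] by (simp add: mem_Times_iff)
  have ly: "lift Y p = y" unfolding lift_def Y(3) y'(2) ..
  note tx = S_xi_tangent[OF p] and LY = lift_vector_field[OF Y(2)]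
  have "cone.F p (S_xi N p) (lift Y p) z = (1 - (-1)) * G p (D p (S_xi N p) (lift Y)) z"
    by (rule cone.F_eigenfield[OF LY pW tx z(1)]) (simp_all add: lift_eigenfield[OF Y(2,4)] z(2))
  also have "D p (S_xi N p) (lift Y) = y"
    using D_xi_lift[OF Y(2) pW] D_xi[OF p, of y] y unfolding ly by simp
  also have "G p y z = 0"
    by (rule cone.eigenvectors_orthogonal[OF p y(1) z(1), of 1]) (simp_all add: y z)
  finally show ?thesis unfolding ly by simp
qed

text \<open>Both tensors are given by \<open>F_eigenfields_mixed\<close>. On eigenvectors of \<open>P\<close> for \<open>\<epsilon>\<close> the metric of the
  slice is \<open>cosh 2t + \<epsilon> sinh 2t\<close> times \<open>h\<close>, the bracket of the lifts is the lift of the bracket, and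
  lifts differentiate along the slice, where this factor is constant.\<close>

lemma cone_F_eigenvectors:
  assumes p: "p \<in> pts SN"
    and y: "y \<in> base.T (snd p)" "P (snd p) y = \<epsilon> *\<^sub>R y"
    and z: "z \<in> base.T (snd p)" "P (snd p) z = - \<epsilon> *\<^sub>R z" and e: "\<epsilon> * \<epsilon> = 1"
  shows "cone.F p (S_tangent N p y 0) (S_tangent N p y 0) (S_tangent N p z 0)
    = (cosh (2 * fst p) + \<epsilon> * sinh (2 * fst p)) * base.F (snd p) y y z"
proof -
  note q = S_pts_snd[OF p]
  have e0: "\<epsilon> \<noteq> 0" using e by auto
  obtain W1 Y where Y: "snd p \<in> W1" "vector_field_on N W1 Y" "Y (snd p) = y"
      "\<And>q. q \<in> W1 \<Longrightarrow> P q (Y q) = \<epsilon> *\<^sub>R Y q"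
    by (rule base.eigenvector_extend[OF q y e]) (rule that)
  obtain W2 Z where Z: "snd p \<in> W2" "vector_field_on N W2 Z" "Z (snd p) = z"
      "\<And>q. q \<in> W2 \<Longrightarrow> P q (Z q) = (- \<epsilon>) *\<^sub>R Z q"
    by (rule base.eigenvector_extend[OF q z]) (use e that in auto)
  define W where "W = W1 \<inter> W2"
  have W: "openin (mtop N) W" "snd p \<in> W" "W \<subseteq> W1" "W \<subseteq> W2"
    using vector_field_on_openin[OF Y(2)] vector_field_on_openin[OF Z(2)] Y(1) Z(1)
    unfolding W_def by auto
  have pW: "p \<in> {0<..} \<times> W" using W(2) S_pts_fst[OF p] by (simp add: mem_Times_iff)
  note Y' = vector_field_on_subset[OF Y(2) W(1,3)] and Z' = vector_field_on_subset[OF Z(2) W(1,4)]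
  have eY: "P q (Y q) = \<epsilon> *\<^sub>R Y q" and eZ: "P q (Z q) = - \<epsilon> *\<^sub>R Z q" if "q \<in> W" for q
    using Y(4)[of q] Z(4)[of q] that W(3,4) by auto
  note LY = lift_vector_field[OF Y'] and LZ = lift_vector_field[OF Z']
  let ?k = "\<lambda>t. cosh (2 * t) + \<epsilon> * sinh (2 * t)"
  let ?B = "lie_bracket N Y Z (snd p)" and ?H = "\<lambda>q. h q (Y q) (Y q)"
  have brT: "?B \<in> base.T (snd p)" by (rule base.lie_bracket_tangent[OF Y' Z' W(2)])
  have snH: "smooth_near N (snd p) ?H" by (rule smooth_nearI[OF base.g_smooth[OF Y' Y'] W(2)])
  have 1: "G p (lift Y p) (lie_bracket SN (lift Y) (lift Z) p) = ?k (fst p) * h (snd p) y ?B"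
  proof -
    have "h (snd p) y (P (snd p) ?B) = \<epsilon> * h (snd p) y ?B"
      using base.self_adjoint[OF q y(1) brT] base.g_scale_left[OF q brT y(1)] y(2) by simp
    then show ?thesis
      unfolding S_lie_bracket_lift[OF Y' Z' pW brT cone.lie_bracket_tangent[OF LY LZ pW]]
        lift_def Y(3) S_metric_S_tangent[OF p y(1) brT] by (simp add: algebra_simps)
  qed
  have 2: "lift Z p (\<lambda>r. G r (lift Y r) (lift Y r)) = ?k (fst p) * Z (snd p) ?H"
  proof -
    let ?f = "\<lambda>r. ?k (fst r) * ?H (snd r)"
    have eq: "G r (lift Y r) (lift Y r) = ?f r" if r: "r \<in> {0<..} \<times> W" for r
    proof -
      have rW: "snd r \<in> W" using r by auto
      note t = vector_field_on_tangent[OF Y' rW] and rN = vector_field_on_pts[OF Y' rW]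
      show ?thesis
        unfolding G_lift[OF Y' Y' r] eY[OF rW] base.g_scale_right[OF rN t t]
        by (simp add: algebra_simps)
    qed
    note U = S.vector_field_on_openin[OF LY]
    have sn: "smooth_near SN p ?f"
      by (rule S.smooth_near_cong[OF U pW eq S.smooth_nearI[OF cone.g_smooth[OF LY LY] pW]])
    have "lift Z p (\<lambda>r. G r (lift Y r) (lift Y r)) = lift Z p ?f"
      by (rule S.tangent_vec_local[OF p lift_tangent[OF Z' pW] U pW eq])
    also have "\<dots> = Z (snd p) (\<lambda>q. ?k (fst p) * ?H q)"
      using sn by (simp add: lift_def S_tangent_def)
    also have "\<dots> = ?k (fst p) * Z (snd p) ?H"
      by (rule tangent_vec_scale[OF q vector_field_on_tangent[OF Z' W(2)] snH])
    finally show ?thesis .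
  qed
  have "cone.F p (lift Y p) (lift Y p) (lift Z p) = - \<epsilon> * (2 * G p (lift Y p) (lie_bracket SN (lift Y) (lift Z) p)
      + lift Z p (\<lambda>r. G r (lift Y r) (lift Y r)))"
    by (rule cone.F_eigenfields_mixed[OF LY LZ pW lift_eigenfield[OF Y' eY] lift_eigenfield[OF Z' eZ] e0])
  also have "\<dots> = ?k (fst p) * (- \<epsilon> * (2 * h (snd p) y ?B + Z (snd p) ?H))"
    unfolding 1 2 by (simp add: algebra_simps)
  also have "- \<epsilon> * (2 * h (snd p) y ?B + Z (snd p) ?H) = base.F (snd p) (Y (snd p)) (Y (snd p)) (Z (snd p))"
    using base.F_eigenfields_mixed[OF Y' Z' W(2) eY eZ e0] unfolding Y(3) by simp
  finally show ?thesis unfolding lift_def Y(3) Z(3) .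
qed

end

section \<open>Components in a \<open>\<phi>\<close>-basis and the classification\<close>

lemma vec_of_coords_linear:
  fixes f :: "'v::real_vector \<Rightarrow> real"
  assumes T: "subspace T" and e: "\<And>i. i \<le> 2 \<Longrightarrow> e i \<in> T"
    and f: "\<And>u v a b. u \<in> T \<Longrightarrow> v \<in> T \<Longrightarrow> f (a *\<^sub>R u + b *\<^sub>R v) = a * f u + b * f v"
  shows "f (vec_of_coords e x) = x 0 * f (e 0) + x 1 * f (e 1) + x 2 * f (e 2)"
proof -
  have e012: "e 0 \<in> T" "e 1 \<in> T" "e 2 \<in> T" using e by simp_all
  have "{..2::nat} = {0, 1, 2}" by auto
  then have "vec_of_coords e x = x 0 *\<^sub>R e 0 + 1 *\<^sub>R (x 1 *\<^sub>R e 1 + x 2 *\<^sub>R e 2)"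
    by (simp add: vec_of_coords_def)
  moreover have "x 1 *\<^sub>R e 1 + x 2 *\<^sub>R e 2 \<in> T"
    using e012 T by (simp add: subspace_add subspace_scale)
  ultimately have "f (vec_of_coords e x) = x 0 * f (e 0) + 1 * f (x 1 *\<^sub>R e 1 + x 2 *\<^sub>R e 2)"
    using f[OF e012(1)] by metis
  then show ?thesis using f[OF e012(2,3)] by simp
qed

lemma vec_of_coords_in:
  "subspace T \<Longrightarrow> (\<And>i. i \<le> 2 \<Longrightarrow> e i \<in> T) \<Longrightarrow> vec_of_coords e x \<in> T"
  unfolding vec_of_coords_def by (rule subspace_sum) (auto simp: subspace_scale)

lemma vec_of_coords_unit: "i \<le> 2 \<Longrightarrow> vec_of_coords e (\<lambda>j. if j = i then 1 else 0) = e i"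
  unfolding vec_of_coords_def by (simp add: if_distrib[of "\<lambda>c. c *\<^sub>R _"] cong: if_cong)

lemma lee_form_eq: "lee_form F e k = F (e 1) (e 1) (e k) + F (e 2) (e 2) (e k)"
proof -
  have "{1..2::nat} = {1, 2}" by auto
  then show ?thesis by (simp add: lee_form_def)
qed

text \<open>In a \<open>\<phi>\<close>-basis, where \<open>\<phi>\<close> exchanges \<open>e\<^sub>1\<close> and \<open>e\<^sub>2\<close>, these are eigenvectors of \<open>\<phi>\<close>. The coefficients
  are written out to match the rules for linear combinations.\<close>

definition eig_plus :: "(nat \<Rightarrow> 'v::real_vector) \<Rightarrow> 'v" where
  "eig_plus e = 1 *\<^sub>R e 1 + 1 *\<^sub>R e 2"

definition eig_minus :: "(nat \<Rightarrow> 'v::real_vector) \<Rightarrow> 'v" where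
  "eig_minus e = 1 *\<^sub>R e 1 + (-1) *\<^sub>R e 2"

context paracomplex_cone
begin

context
  fixes p e
  assumes p: "p \<in> pts SN" and basis: "phi_basis SN (S_phi N P) (S_xi N) G p e"
begin

lemma basis_mem: "i \<le> 2 \<Longrightarrow> e i \<in> cone.T p"
  and basis_orthonormal: "i \<le> 2 \<Longrightarrow> j \<le> 2 \<Longrightarrow> G p (e i) (e j) = (if i = j then 1 else 0)"
  and basis_phi: "S_phi N P p (e 0) = 0" "S_phi N P p (e 1) = e 2" "S_phi N P p (e 2) = e 1"
  and basis_xi: "e 0 = S_xi N p"
  using basis unfolding phi_basis_def by auto

lemma basis_mem': "e 0 \<in> cone.T p" "e 1 \<in> cone.T p"
    "e 2 \<in> cone.T p"
  by (simp_all add: basis_mem)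

lemma eig_mem: "eig_plus e \<in> cone.T p" "eig_minus e \<in> cone.T p"
  unfolding eig_plus_def eig_minus_def by (rule cone.T_lincomb[OF p basis_mem'(2,3)])+

lemma eig_phi: "S_phi N P p (eig_plus e) = 1 *\<^sub>R eig_plus e" "S_phi N P p (eig_minus e) = (-1) *\<^sub>R eig_minus e"
  unfolding eig_plus_def eig_minus_def cone.A_lincomb[OF p basis_mem'(2,3)] basis_phi
  by (simp_all add: scaleR_right_diff_distrib)

lemma F_bilinear_12:
  assumes "x \<in> cone.T p"
  shows "cone.F p x (a *\<^sub>R e 1 + b *\<^sub>R e 2) (c *\<^sub>R e 1 + d *\<^sub>R e 2)
    = a * c * cone.F p x (e 1) (e 1) + (a * d + b * c) * cone.F p x (e 1) (e 2) + b * d * cone.F p x (e 2) (e 2)"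
  unfolding cone.F_lincomb2[OF p assms basis_mem'(2,3) cone.T_lincomb[OF p basis_mem'(2,3)]]
    cone.F_lincomb3[OF p assms basis_mem'(2) basis_mem'(2,3)]
    cone.F_lincomb3[OF p assms basis_mem'(3) basis_mem'(2,3)]
    cone.F_sym[OF p assms basis_mem'(3,2)]
  by (simp add: algebra_simps)

text \<open>By polarization, from \<open>F(x, y, y) = 0\<close> for \<open>y = e\<^sub>1 + e\<^sub>2\<close> and for \<open>y = e\<^sub>1 - e\<^sub>2\<close>.\<close>

lemma F_horizontal:
  assumes x: "x \<in> cone.T p"
  shows "cone.F p x (e 1) (e 2) = 0" "cone.F p x (e 2) (e 1) = 0"
    "cone.F p x (e 2) (e 2) = - cone.F p x (e 1) (e 1)"
proof -
  have "cone.F p x (eig_plus e) (eig_plus e) = 0"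
    by (rule cone.F_eigenvector_diag[OF p x eig_mem(1) eig_phi(1)]) simp
  moreover have "cone.F p x (eig_minus e) (eig_minus e) = 0"
    by (rule cone.F_eigenvector_diag[OF p x eig_mem(2) eig_phi(2)]) simp
  ultimately show "cone.F p x (e 1) (e 2) = 0" "cone.F p x (e 2) (e 2) = - cone.F p x (e 1) (e 1)"
    unfolding eig_plus_def eig_minus_def F_bilinear_12[OF x] by simp_all
  then show "cone.F p x (e 2) (e 1) = 0" using cone.F_sym[OF p x basis_mem'(3,2)] by simp
qed

lemma F_mixed:
  assumes x: "x \<in> cone.T p"
  shows "cone.F p x (eig_plus e) (eig_minus e) = 2 * cone.F p x (e 1) (e 1)"
    and "cone.F p x (eig_minus e) (eig_plus e) = 2 * cone.F p x (e 1) (e 1)"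
  unfolding eig_plus_def eig_minus_def F_bilinear_12[OF x] using F_horizontal[OF x] by simp_all

lemma F_xi_horizontal: "cone.F p (e 0) (e 1) (e 1) = 0"
  using cone_F_xi_eigenvectors[OF p eig_mem(1) _ eig_mem(2)] eig_phi F_mixed(1)[OF basis_mem'(1)]
  by (simp add: basis_xi)

lemma F_third_xi:
  assumes "i \<le> 2" "j \<le> 2"
  shows "cone.F p (e i) (e j) (e 0) = (if i = j \<and> i \<noteq> 0 then -1 else 0)"
    "cone.F p (e i) (e 0) (e j) = (if i = j \<and> i \<noteq> 0 then -1 else 0)"
proof -
  have z: "G p 0 y = 0" "G p y 0 = 0" if "y \<in> cone.T p" for y
    using cone.g_scale_left[OF p that that, of 0] cone.g_scale_right[OF p that that, of 0] by simp_all
  have "i \<in> {0, 1, 2}" "j \<in> {0, 1, 2}" using assms by auto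
  then show 1: "cone.F p (e i) (e j) (e 0) = (if i = j \<and> i \<noteq> 0 then -1 else 0)"
    unfolding basis_xi cone_F_xi[OF p basis_mem[OF assms(1)] basis_mem[OF assms(2)]]
    using basis_phi basis_orthonormal z basis_mem' S.tangent_space_subspace[OF p]
    by (auto simp: subspace_0)
  then show "cone.F p (e i) (e 0) (e j) = (if i = j \<and> i \<noteq> 0 then -1 else 0)"
    using cone.F_sym[OF p basis_mem[OF assms(1)] basis_mem'(1) basis_mem[OF assms(2)]] by simp
qed

text \<open>Two of the \<open>27\<close> components remain unknown; the others are \<open>0\<close>, \<open>-1\<close> or the negatives of these.\<close>

lemma F_expand:
  "cone.F p (vec_of_coords e x) (vec_of_coords e y) (vec_of_coords e z)
    = (x 1 * cone.F p (e 1) (e 1) (e 1) + x 2 * cone.F p (e 2) (e 1) (e 1)) * (y 1 * z 1 - y 2 * z 2)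
      - x 1 * (y 0 * z 1 + y 1 * z 0) - x 2 * (y 0 * z 2 + y 2 * z 0)"
proof -
  note sub = S.tangent_space_subspace[OF p]
  note vT = vec_of_coords_in[of _ e, OF sub basis_mem]
  have 3: "cone.F p u v (vec_of_coords e z)
      = z 0 * cone.F p u v (e 0) + z 1 * cone.F p u v (e 1) + z 2 * cone.F p u v (e 2)"
    if "u \<in> cone.T p" "v \<in> cone.T p" for u v
    by (rule vec_of_coords_linear[OF sub basis_mem, where f = "cone.F p u v"])
       (assumption | rule cone.F_lincomb3[OF p that])+
  have 2: "cone.F p u (vec_of_coords e y) w
      = y 0 * cone.F p u (e 0) w + y 1 * cone.F p u (e 1) w + y 2 * cone.F p u (e 2) w"
    if "u \<in> cone.T p" "w \<in> cone.T p" for u w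
    by (rule vec_of_coords_linear[OF sub basis_mem, where f = "\<lambda>v. cone.F p u v w"])
       (assumption | rule cone.F_lincomb2[OF p that(1) _ _ that(2)])+
  have 1: "cone.F p (vec_of_coords e x) v w
      = x 0 * cone.F p (e 0) v w + x 1 * cone.F p (e 1) v w + x 2 * cone.F p (e 2) v w"
    if "v \<in> cone.T p" "w \<in> cone.T p" for v w
    by (rule vec_of_coords_linear[OF sub basis_mem, where f = "\<lambda>u. cone.F p u v w"])
       (assumption | rule cone.F_lincomb1[OF p _ _ that])+
  note t0 = F_third_xi[of 0 0] F_third_xi[of 0 1] F_third_xi[of 0 2]
    F_third_xi[of 1 0] F_third_xi[of 1 1] F_third_xi[of 1 2]
    F_third_xi[of 2 0] F_third_xi[of 2 1] F_third_xi[of 2 2]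
  note h = F_horizontal[OF basis_mem'(1)] F_horizontal[OF basis_mem'(2)] F_horizontal[OF basis_mem'(3)]
  show ?thesis
    by (simp only: 1[OF vT vT] 2[OF basis_mem'(1) vT] 2[OF basis_mem'(2) vT] 2[OF basis_mem'(3) vT]
        3[OF basis_mem'(1) basis_mem'(1)] 3[OF basis_mem'(1) basis_mem'(2)] 3[OF basis_mem'(1) basis_mem'(3)]
        3[OF basis_mem'(2) basis_mem'(1)] 3[OF basis_mem'(2) basis_mem'(2)] 3[OF basis_mem'(2) basis_mem'(3)]
        3[OF basis_mem'(3) basis_mem'(1)] 3[OF basis_mem'(3) basis_mem'(2)] 3[OF basis_mem'(3) basis_mem'(3)]
        h F_xi_horizontal)
       (simp add: t0 algebra_simps del: One_nat_def)
qed

lemma lee_components: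
  "lee_form (cone.F p) e 0 = -2"
  "lee_form (cone.F p) e 1 = cone.F p (e 1) (e 1) (e 1)"
  "lee_form (cone.F p) e 2 = - cone.F p (e 2) (e 1) (e 1)"
  unfolding lee_form_eq using F_third_xi[of 1 1] F_third_xi[of 2 2]
    F_horizontal[OF basis_mem'(2)] F_horizontal[OF basis_mem'(3)] by simp_all

lemma F_eq_F1_F4:
  "cone.F p (vec_of_coords e x) (vec_of_coords e y) (vec_of_coords e z)
    = F1_part (cone.F p) e x y z + F4_part (cone.F p) e x y z"
  unfolding F_expand F1_part_def F4_part_def lee_components by (simp add: algebra_simps)

text \<open>\<open>F(x, e\<^sub>1, e\<^sub>1)\<close> is half of \<open>F(x, e\<^sub>1 + e\<^sub>2, e\<^sub>1 - e\<^sub>2)\<close>. For \<open>x = e\<^sub>1 \<plusminus> e\<^sub>2\<close> the latter is a multiple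
  of a value of the tensor of \<open>N\<close>.\<close>

lemma F1_part_zero:
  assumes W0: "\<And>x y z. x \<in> base.T (snd p) \<Longrightarrow> y \<in> base.T (snd p) \<Longrightarrow>
      z \<in> base.T (snd p) \<Longrightarrow> base.F (snd p) x y z = 0"
  shows "F1_part (cone.F p) e x y z = 0"
proof -
  obtain y' where y': "y' \<in> base.T (snd p)" "eig_plus e = S_tangent N p y' 0"
      "P (snd p) y' = 1 *\<^sub>R y'"
    by (rule S_phi_eigenvector[OF p eig_mem(1) eig_phi(1)]) (use that in auto)
  obtain z' where z': "z' \<in> base.T (snd p)" "eig_minus e = S_tangent N p z' 0"
      "P (snd p) z' = (-1) *\<^sub>R z'"
    by (rule S_phi_eigenvector[OF p eig_mem(2) eig_phi(2)]) (use that in auto)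
  have "cone.F p (eig_plus e) (eig_plus e) (eig_minus e) = 0"
    using cone_F_eigenvectors[OF p y'(1,3) z'(1)] z'(3) W0[OF y'(1) y'(1) z'(1)] unfolding y'(2) z'(2) by simp
  then have a: "cone.F p (eig_plus e) (e 1) (e 1) = 0" using F_mixed(1)[OF eig_mem(1)] by simp
  have "cone.F p (eig_minus e) (eig_minus e) (eig_plus e) = 0"
    using cone_F_eigenvectors[OF p z'(1,3) y'(1)] y'(3) W0[OF z'(1) z'(1) y'(1)] unfolding y'(2) z'(2) by simp
  then have b: "cone.F p (eig_minus e) (e 1) (e 1) = 0" using F_mixed(2)[OF eig_mem(2)] by simp
  have "cone.F p (e 1) (e 1) (e 1) = 0" "cone.F p (e 2) (e 1) (e 1) = 0"
    using a b unfolding eig_plus_def eig_minus_def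
      cone.F_lincomb1[OF p basis_mem'(2,3) basis_mem'(2) basis_mem'(2)] by simp_all
  then show ?thesis unfolding F1_part_def lee_components by simp
qed

end

text \<open>The lifts of \<open>u\<close> and \<open>v\<close> are orthogonal. Scaled to length \<open>1/\<surd>2\<close>, their sum and difference are
  the vectors \<open>e\<^sub>1\<close> and \<open>e\<^sub>2\<close>.\<close>

lemma phi_basis_exists:
  assumes p: "p \<in> pts SN"
    and u: "u \<in> base.T (snd p)" "P (snd p) u = u" "u \<noteq> 0"
    and v: "v \<in> base.T (snd p)" "P (snd p) v = - v" "v \<noteq> 0"
    and span: "span {u, v} = base.T (snd p)"
  obtains e r s where "phi_basis SN (S_phi N P) (S_xi N) G p e" "r \<noteq> 0" "s \<noteq> 0"
    "e 1 = r *\<^sub>R S_tangent N p u 0 + s *\<^sub>R S_tangent N p v 0"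
    "e 2 = r *\<^sub>R S_tangent N p u 0 + (- s) *\<^sub>R S_tangent N p v 0"
proof -
  note q = S_pts_snd[OF p]
  let ?u = "S_tangent N p u 0" and ?v = "S_tangent N p v 0"
  note uT = S_tangent_in[OF p u(1), of 0] and vT = S_tangent_in[OF p v(1), of 0] and xT = S_xi_tangent[OF p]
  have phiu: "S_phi N P p ?u = 1 *\<^sub>R ?u" using S_phi_S_tangent[OF p u(1)] u(2) by simp
  have phiv: "S_phi N P p ?v = - 1 *\<^sub>R ?v"
    using S_phi_S_tangent[OF p v(1)] v(2) S_tangent_lincomb[of "-1" p v 0 0 v 0] by simp
  have pos: "G p w w > 0" if "w \<in> cone.T p" "w \<noteq> 0" for w
    using S_metric_riemannian p that unfolding riemannian_metric_def by blast
  have nz: "S_tangent N p w 0 \<noteq> 0" if w: "w \<in> base.T (snd p)" "w \<noteq> 0" for w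
  proof
    assume "S_tangent N p w 0 = 0"
    also have "0 = S_tangent N p 0 0" by (simp add: S_tangent_def fun_eq_iff)
    finally have "N_part N p (S_tangent N p w 0) = N_part N p (S_tangent N p 0 0)" by simp
    then show False using N_part_S_tangent[OF p w(1)] N_part_S_tangent[OF p zero_tangent[OF q]] w(2) by simp
  qed
  have gu: "G p ?u ?u > 0" and gv: "G p ?v ?v > 0" using pos uT vT nz u v by blast+
  have guv: "G p ?u ?v = 0" "G p ?v ?u = 0"
    using cone.eigenvectors_orthogonal[OF p uT vT phiu phiv] cone.g_sym[OF p uT vT] by simp_all
  define r where "r = 1 / sqrt (2 * G p ?u ?u)"
  define s where "s = 1 / sqrt (2 * G p ?v ?v)"
  have r: "r * r * G p ?u ?u = 1/2" "r \<noteq> 0" and s: "s * s * G p ?v ?v = 1/2" "s \<noteq> 0"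
    using gu gv unfolding r_def s_def by (auto simp: field_simps)
  define e where "e i = (if i = 0 then S_xi N p else if i = (1::nat) then r *\<^sub>R ?u + s *\<^sub>R ?v
      else r *\<^sub>R ?u + (- s) *\<^sub>R ?v)" for i
  have e: "e 0 = S_xi N p" "e 1 = r *\<^sub>R ?u + s *\<^sub>R ?v" "e 2 = r *\<^sub>R ?u + (- s) *\<^sub>R ?v"
    by (simp_all add: e_def)
  have eT: "e 0 \<in> cone.T p" "e 1 \<in> cone.T p" "e 2 \<in> cone.T p"
    unfolding e using xT cone.T_lincomb[OF p uT vT] by blast+
  have three: "i = 0 \<or> i = 1 \<or> i = 2" if "i \<le> 2" for i :: nat using that by auto
  have img: "e ` {..2} = {e 0, e 1, e 2}"
  proof -
    have "{..2::nat} = {0, 1, 2}" by auto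
    then show ?thesis by simp
  qed
  have G2: "G p (a *\<^sub>R ?u + b *\<^sub>R ?v) (c *\<^sub>R ?u + d *\<^sub>R ?v) = a * c * G p ?u ?u + b * d * G p ?v ?v" for a b c d
    unfolding cone.g_lincomb_right[OF p cone.T_lincomb[OF p uT vT] uT vT]
      cone.g_lincomb_left[OF p uT uT vT] cone.g_lincomb_left[OF p vT uT vT] by (simp add: guv)
  have Gx: "G p (S_xi N p) (a *\<^sub>R ?u + b *\<^sub>R ?v) = 0" for a b
    unfolding cone.g_lincomb_right[OF p xT uT vT] G_xi_S_tangent[OF p u(1)] G_xi_S_tangent[OF p v(1)] by simp
  have Gxx: "G p (S_xi N p) (S_xi N p) = 1"
    using G_xi_S_tangent[OF p zero_tangent[OF q], of 1] by (simp add: S_xi_def)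
  have on: "G p (e 0) (e 0) = 1" "G p (e 0) (e 1) = 0" "G p (e 0) (e 2) = 0"
    "G p (e 1) (e 1) = 1" "G p (e 1) (e 2) = 0" "G p (e 2) (e 2) = 1"
    unfolding e Gx Gxx G2 using r(1) s(1) by simp_all
  have sym: "G p (e i) (e j) = G p (e j) (e i)" if "i \<le> 2" "j \<le> 2" for i j
    using cone.g_sym[OF p, of "e i" "e j"] three[OF that(1)] three[OF that(2)] eT by auto
  have "phi_basis SN (S_phi N P) (S_xi N) G p e"
    unfolding phi_basis_def
  proof (intro conjI allI impI)
    show "e i \<in> cone.T p" if "i \<le> 2" for i using three[OF that] eT by auto
    show "G p (e i) (e j) = (if i = j then 1 else 0)" if "i \<le> 2" "j \<le> 2" for i j
      using three[OF that(1)] three[OF that(2)] on sym[of 1 0] sym[of 2 0] sym[of 2 1] by auto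
    show "e 0 = S_xi N p" by (rule e(1))
    show "S_phi N P p (e 0) = 0" unfolding e(1) by (rule S_phi_xi[OF p])
    show "S_phi N P p (e 1) = e 2" "S_phi N P p (e 2) = e 1"
      unfolding e cone.A_lincomb[OF p uT vT] phiu phiv by simp_all
    show "span (e ` {..2}) = cone.T p"
    proof
      show "span (e ` {..2}) \<subseteq> cone.T p"
        unfolding img by (rule span_minimal[OF _ S.tangent_space_subspace[OF p]]) (use eT in auto)
      have "?u = 0 *\<^sub>R e 0 + (1/(2 * r)) *\<^sub>R e 1 + (1/(2 * r)) *\<^sub>R e 2"
        "?v = 0 *\<^sub>R e 0 + (1/(2 * s)) *\<^sub>R e 1 + (-(1/(2 * s))) *\<^sub>R e 2"
        unfolding e using r(2) s(2) by (simp_all add: algebra_simps flip: scaleR_left_distrib scaleR_2)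
      from this[THEN span_triple_intro]
      have "?u \<in> span {e 0, e 1, e 2}" "?v \<in> span {e 0, e 1, e 2}" .
      moreover have "S_xi N p \<in> span {e 0, e 1, e 2}" by (rule span_base) (simp add: e(1))
      ultimately have "{S_xi N p, ?u, ?v} \<subseteq> span {e 0, e 1, e 2}" by simp
      then have "span {S_xi N p, ?u, ?v} \<subseteq> span {e 0, e 1, e 2}" by (rule span_minimal) simp
      then show "cone.T p \<subseteq> span (e ` {..2})"
        unfolding img S_tangent_span[OF p u(1) v(1) span] .
    qed
  qed
  then show thesis using that[of e r s] r(2) s(2) e(2,3) by blast
qed

lemma DIM3: "DIM(real \<times> 'e) = 3"
  using dim2 by simp

lemma in_class_F1_F4: "class_F1_F4 SN (S_phi N P) (S_xi N) S_eta G D"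
  unfolding class_F1_F4_def class_of_part_def using S_apapR DIM3 F_eq_F1_F4 by blast

lemma pts_nonempty: obtains q where "q \<in> pts N"
  using apc unfolding almost_paracomplex_riemannian_def by blast

lemma cone_point: "q \<in> pts N \<Longrightarrow> (1, q) \<in> pts SN"
  unfolding S_pts by simp

text \<open>\<open>F\<^sub>1\<^sub>1\<^sub>0 = -1\<close>, whereas \<open>F\<^sup>1\<close> vanishes when one of its last two arguments is \<open>\<xi>\<close>.\<close>

lemma not_in_class_F1: "\<not> class_F1 SN (S_phi N P) (S_xi N) S_eta G D"
proof
  assume F1: "class_F1 SN (S_phi N P) (S_xi N) S_eta G D"
  obtain q where q: "q \<in> pts N" using pts_nonempty .
  obtain u v where uv: "u \<in> base.T q" "v \<in> base.T q" "P q u = u" "P q v = - v"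
    "u \<noteq> 0" "v \<noteq> 0" "span {u, v} = base.T q"
    by (rule P_eigenbasis[OF q]) (rule that)
  note p = cone_point[OF q]
  obtain e where e: "phi_basis SN (S_phi N P) (S_xi N) G (1, q) e"
    by (rule phi_basis_exists[OF p, of u v]) (use uv that in auto)
  let ?d = "\<lambda>i j::nat. if j = i then 1 else 0::real"
  have "cone.F (1, q) (vec_of_coords e (?d 1)) (vec_of_coords e (?d 1)) (vec_of_coords e (?d 0))
      = F1_part (cone.F (1, q)) e (?d 1) (?d 1) (?d 0)"
    using F1 p e unfolding class_F1_def class_of_part_def by blast
  then show False
    using F_third_xi(1)[OF p e, of 1 1] by (simp add: vec_of_coords_unit F1_part_def)
qed

lemma W0_iff_base_F:
  "W0_manifold N P h D' \<longleftrightarrow> (\<forall>q\<in>pts N. \<forall>x\<in>base.T q. \<forall>y\<in>base.T q. \<forall>z\<in>base.T q.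
     base.F q x y z = 0)"
proof
  assume W: "W0_manifold N P h D'"
  show "\<forall>q\<in>pts N. \<forall>x\<in>base.T q. \<forall>y\<in>base.T q. \<forall>z\<in>base.T q. base.F q x y z = 0"
  proof (intro ballI)
    fix q x y z assume q: "q \<in> pts N" and x: "x \<in> base.T q" "y \<in> base.T q"
      and z: "z \<in> base.T q"
    then have "cov_deriv_endo N D' P q x y = 0" using W unfolding W0_manifold_def by blast
    then show "base.F q x y z = 0"
      unfolding fundamental_tensor_def using base.g_scale_left[OF q z z, of 0] by simp
  qed
next
  assume F: "\<forall>q\<in>pts N. \<forall>x\<in>base.T q. \<forall>y\<in>base.T q. \<forall>z\<in>base.T q. base.F q x y z = 0"
  show "W0_manifold N P h D'"
    unfolding W0_manifold_def
  proof (intro conjI ballI apc)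
    fix q x y assume q: "q \<in> pts N" and xy: "x \<in> base.T q" "y \<in> base.T q"
    show "cov_deriv_endo N D' P q x y = 0"
      by (rule base.g_nondegenerate[OF q base.cov_deriv_endo_mem[OF q xy]])
         (use F q xy in \<open>simp add: fundamental_tensor_def\<close>)
  qed
qed

lemma in_class_F4_if_W0:
  assumes "W0_manifold N P h D'" shows "class_F4 SN (S_phi N P) (S_xi N) S_eta G D"
proof -
  have "F1_part (cone.F p) e x y z = 0"
    if p: "p \<in> pts SN" and e: "phi_basis SN (S_phi N P) (S_xi N) G p e" for p e x y z
    by (rule F1_part_zero[OF p e]) (use assms W0_iff_base_F S_pts_snd[OF p] in blast)
  then show ?thesis
    unfolding class_F4_def class_of_part_def using S_apapR DIM3 F_eq_F1_F4 by simp
qed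

text \<open>Of the eight components with respect to \<open>u\<close>, \<open>v\<close>, those with equal last two indices vanish
  always, and the others are the two that are assumed to vanish, up to symmetry.\<close>

lemma base_F_zero:
  assumes q: "q \<in> pts N" and u: "u \<in> base.T q" "P q u = 1 *\<^sub>R u"
    and v: "v \<in> base.T q" "P q v = (-1) *\<^sub>R v"
    and F: "base.F q u u v = 0" "base.F q v v u = 0"
  shows "base.F q (a *\<^sub>R u + b *\<^sub>R v) (c *\<^sub>R u + d *\<^sub>R v) (k *\<^sub>R u + l *\<^sub>R v) = 0"
proof -
  have diag: "base.F q x u u = 0" "base.F q x v v = 0" if "x \<in> base.T q" for x
    using base.F_eigenvector_diag[OF q that u] base.F_eigenvector_diag[OF q that v] by simp_all
  note l = base.T_lincomb[OF q u(1) v(1)]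
  show ?thesis
    unfolding base.F_lincomb1[OF q u(1) v(1) l l] base.F_lincomb2[OF q u(1) u(1) v(1) l]
      base.F_lincomb2[OF q v(1) u(1) v(1) l] base.F_lincomb3[OF q u(1) u(1) u(1) v(1)]
      base.F_lincomb3[OF q u(1) v(1) u(1) v(1)] base.F_lincomb3[OF q v(1) u(1) u(1) v(1)]
      base.F_lincomb3[OF q v(1) v(1) u(1) v(1)] diag[OF u(1)] diag[OF v(1)]
      base.F_sym[OF q u(1) v(1) u(1)] base.F_sym[OF q v(1) u(1) v(1)] F by simp
qed

text \<open>It is enough to look at \<open>t = 1\<close>. There \<open>F\<^sup>4(e\<^sub>i, e\<^sub>1, e\<^sub>1) = 0\<close>, so that \<open>F(x, e\<^sub>1 + e\<^sub>2, e\<^sub>1 - e\<^sub>2) = 0\<close>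
  for \<open>x = e\<^sub>1 \<plusminus> e\<^sub>2\<close>; the factors \<open>cosh 2 \<plusminus> sinh 2\<close> are nonzero, so the tensor of \<open>N\<close> vanishes
  on eigenvectors.\<close>

lemma W0_if_in_class_F4:
  assumes F4: "class_F4 SN (S_phi N P) (S_xi N) S_eta G D" shows "W0_manifold N P h D'"
  unfolding W0_iff_base_F
proof (intro ballI)
  fix q x y z
  assume q: "q \<in> pts N" and xyz: "x \<in> base.T q" "y \<in> base.T q" "z \<in> base.T q"
  obtain u v where uT: "u \<in> base.T q" and vT: "v \<in> base.T q"
    and Pu: "P q u = u" and Pv: "P q v = - v" and uv0: "u \<noteq> 0" "v \<noteq> 0"
    and span: "span {u, v} = base.T q"
    by (rule P_eigenbasis[OF q]) (rule that)
  let ?p = "(1::real, q)"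
  let ?u = "S_tangent N ?p u 0" and ?v = "S_tangent N ?p v 0"
  note p = cone_point[OF q]
  have uS: "?u \<in> cone.T ?p" and vS: "?v \<in> cone.T ?p"
    using S_tangent_in[OF p] uT vT by simp_all
  obtain e r s where e: "phi_basis SN (S_phi N P) (S_xi N) G ?p e" and rs: "r \<noteq> 0" "s \<noteq> 0"
    and e1: "e 1 = r *\<^sub>R ?u + s *\<^sub>R ?v" and e2: "e 2 = r *\<^sub>R ?u + (- s) *\<^sub>R ?v"
    by (rule phi_basis_exists[OF p, of u v]) (use uT vT Pu Pv uv0 span that in auto)
  let ?d = "\<lambda>i j::nat. if j = i then 1 else 0::real"
  have F4e: "cone.F ?p (vec_of_coords e (?d i)) (vec_of_coords e (?d 1)) (vec_of_coords e (?d 1))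
      = F4_part (cone.F ?p) e (?d i) (?d 1) (?d 1)" for i
    using F4 p e unfolding class_F4_def class_of_part_def by blast
  have "cone.F ?p (e 1) (e 1) (e 1) = 0" "cone.F ?p (e 2) (e 1) (e 1) = 0"
    using F4e[of 1] F4e[of 2] by (simp_all add: vec_of_coords_unit F4_part_def)
  then have "cone.F ?p (eig_plus e) (e 1) (e 1) = 0" "cone.F ?p (eig_minus e) (e 1) (e 1) = 0"
    unfolding eig_plus_def eig_minus_def
      cone.F_lincomb1[OF p basis_mem'(2,3)[OF p e] basis_mem'(2,2)[OF p e]] by simp_all
  then have F0: "cone.F ?p (eig_plus e) (eig_plus e) (eig_minus e) = 0"
      "cone.F ?p (eig_minus e) (eig_minus e) (eig_plus e) = 0"
    using F_mixed[OF p e] eig_mem[OF p e] by simp_all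
  define y' where "y' = (2 * r) *\<^sub>R u"
  define z' where "z' = (2 * s) *\<^sub>R v"
  have y': "y' \<in> base.T q" "P q y' = 1 *\<^sub>R y'"
    unfolding y'_def using base.T_lincomb[OF q uT uT, of "2 * r" 0] base.A_lincomb[OF q uT uT, of "2 * r" 0] Pu
    by simp_all
  have z': "z' \<in> base.T q" "P q z' = (-1) *\<^sub>R z'"
    unfolding z'_def using base.T_lincomb[OF q vT vT, of "2 * s" 0] base.A_lincomb[OF q vT vT, of "2 * s" 0] Pv
    by simp_all
  have eig: "eig_plus e = S_tangent N ?p y' 0" "eig_minus e = S_tangent N ?p z' 0"
  proof -
    have "eig_plus e = (2 * r) *\<^sub>R ?u" "eig_minus e = (2 * s) *\<^sub>R ?v"
      unfolding eig_plus_def eig_minus_def e1 e2 mult_2 scaleR_left_distrib by simp_all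
    then show "eig_plus e = S_tangent N ?p y' 0" "eig_minus e = S_tangent N ?p z' 0"
      using S_tangent_lincomb[of "2 * r" ?p u 0 0 u 0] S_tangent_lincomb[of "2 * s" ?p v 0 0 v 0]
      by (simp_all add: y'_def z'_def)
  qed
  have "cosh 2 + sinh 2 \<noteq> (0::real)" "cosh 2 - sinh 2 \<noteq> (0::real)"
    by (simp_all add: cosh_plus_sinh cosh_minus_sinh)
  then have B: "base.F q y' y' z' = 0" "base.F q z' z' y' = 0"
    using F0 cone_F_eigenvectors[OF p, of y' 1 z'] cone_F_eigenvectors[OF p, of z' "-1" y'] y' z'
    unfolding eig by simp_all
  have "w \<in> base.T q \<Longrightarrow> \<exists>a b. w = a *\<^sub>R y' + b *\<^sub>R z'" for w
  proof -
    assume "w \<in> base.T q"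
    then have "w \<in> span {u, v}" using span by simp
    then obtain a b where "w = a *\<^sub>R u + b *\<^sub>R v"
      unfolding span_insert span_singleton by (auto simp: algebra_simps)
    then have "w = (a / (2 * r)) *\<^sub>R y' + (b / (2 * s)) *\<^sub>R z'"
      using rs by (simp add: y'_def z'_def)
    then show ?thesis by blast
  qed
  then obtain a b c d k l where "x = a *\<^sub>R y' + b *\<^sub>R z'" "y = c *\<^sub>R y' + d *\<^sub>R z'" "z = k *\<^sub>R y' + l *\<^sub>R z'"
    using xyz by metis
  then show "base.F q x y z = 0"
    using base_F_zero[OF q y' z' B] by simp
qed

end

theorem theorem3p2:
  fixes N :: "('a, 'e::euclidean_space) mfd"
    and P :: "'a \<Rightarrow> 'a tvec \<Rightarrow> 'a tvec"
    and h :: "'a \<Rightarrow> 'a tvec \<Rightarrow> 'a tvec \<Rightarrow> real"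
    and D' :: "'a connection"
    and D :: "(real \<times> 'a) connection"
  assumes "DIM('e) = 2"
    and "almost_paracomplex_riemannian N P h"
    and "levi_civita N h D'"
    and "levi_civita (S_mfd N) (S_metric N P h) D"
  shows "class_F1_F4 (S_mfd N) (S_phi N P) (S_xi N) S_eta (S_metric N P h) D \<and>
         (class_F4 (S_mfd N) (S_phi N P) (S_xi N) S_eta (S_metric N P h) D
            \<longleftrightarrow> W0_manifold N P h D') \<and>
         \<not> class_F1 (S_mfd N) (S_phi N P) (S_xi N) S_eta (S_metric N P h) D"
proof -
  interpret paracomplex_cone N P h D' D
    using assms by unfold_locales (auto simp: almost_paracomplex_riemannian_def)
  show ?thesis
    using in_class_F1_F4 not_in_class_F1 in_class_F4_if_W0 W0_if_in_class_F4 by blast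
qed

end
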